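(* Let $\{S_i\}_{i\in\mathcal{I}}$ be any IFS with associated self-similar measure $\mu_{\mathbf p}$, and suppose $x$ is a periodic point with period $\theta=(e_1,\ldots,e_s)$. Then the local dimension of $\mu_{\mathbf p}$ at $x$ exists and is given by $$\dim_{\mathrm{loc}}\mu_{\mathbf p}(x)=\frac{\log\operatorname{sp}(T(\theta))}{\log L(\theta)},$$ where if $x$ is a boundary point of a net interval with two different symbolic representations given by periods $\theta$ and $\phi$, then $\theta$ is chosen to satisfy $$\frac{\log\operatorname{sp}(T(\theta))}{\log L(\theta)}\le\frac{\log\operatorname{sp}(T(\phi))}{\log L(\phi)}.$$
   Context: IFS. An iterated function system of similarities (IFS) is a finite set of (distinct) maps $S_i(x)=r_ix+d_i$ on $\mathbb{R}$, $i\in\mathcal{I}$, with $0<|r_i|<1$ and $\#\mathcal{I}\ge 2$. Its attractor $K$ is the unique non-empty compact set with $K=\bigcup_{i}S_i(K)$. Standing assumptions: $K$ is not a singleton and (normalization) the convex hull of $K$ is $[0,1]$. Given $\mathbf p=(p_i)_{i\in\mathcal I}$ with $p_i>0$, $\sum p_i=1$, the associated self-similar measure $\mu_{\mathbf p}$ is the unique Borel probability measure with $\mu_{\mathbf p}(E)=\sum_i p_i\mu_{\mathbf p}(S_i^{-1}(E))$ for all Borel $E$. $\mathcal{I}^*$ is the set of finite words; for $\sigma=(\sigma_1,\dots,\sigma_n)$, $S_\sigma=S_{\sigma_1}\circ\cdots\circ S_{\sigma_n}$, $r_\sigma=\prod r_{\sigma_k}$, and $\sigma^-$ is $\sigma$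 with the last letter deleted; for the empty word $S_\emptyset=\mathrm{id}$, $r_\emptyset=1$. For $t>0$, $\Lambda_t=\{\sigma\in\mathcal I^*:|r_\sigma|<t\le|r_{\sigma^-}|\}$ (convention: $|r_{\emptyset^-}|=\infty$, so $\Lambda_t=\{\emptyset\}$ for $t>1$). Net intervals. For $t>0$ let $h_1<\dots<h_{s(t)}$ be the distinct elements of $\{S_\sigma(0),S_\sigma(1):\sigma\in\Lambda_t\}$. The net intervals of generation $t$ are the elements of $\mathcal{F}_t=\{[h_j,h_{j+1}]:1\le j<s(t),\ (h_j,h_{j+1})\cap K\ne\emptyset\}$. A net interval is always considered together with its generation. $T_\Delta(x)=rx+a$ is the map with $r>0$ and $T_\Delta([0,1])=\Delta$. For $\Delta\in\mathcal F_t$, a neighbour of $\Delta$ is a map $f=T_\Delta^{-1}\circ S_\sigma$ with $\sigma\in\Lambda_t$ and $S_\sigma(K)\cap\Delta^\circ\ne\emptyset$; one says that $\sigma$ generates $f$. The neighbour set $\mathcal V(\Delta)=\mathcal V_t(\Delta)$ is the set of all distinct neighbours of $\Delta$. The transition generation is $\operatorname{tg}(\Delta)=\operatorname{diam}(\Delta)\cdot\max\{|R|:(x\mapsto Rx+a)\in\mathcal V(\Delta)\}$; the children of $\Delta$ are the net intervals of generation $\operatorname{tg}(\Delta)$ contained in $\Delta$ (considered with generation $\operatorname{tg}(\Delta)$), and $\Delta$ is their parent. The position index of a child $\Delta'=[a',b']$ of $\Delta=[a,b]$ is $q(\Delta,\Delta')=(a'-a)/\operatorname{diam}(\Delta)$.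 Transition graph. $\mathcal G$ is the directed graph (loops, multiple edges allowed) with vertices the distinct neighbour sets of net intervals, and with an edge $e=(\mathcal V(\Delta),\mathcal V(\Delta'),q(\Delta,\Delta'))$ from $\mathcal V(\Delta)$ to $\mathcal V(\Delta')$ for each net interval $\Delta$ and child $\Delta'$ of $\Delta$. The length of this edge is $L(e)=\operatorname{tg}(\Delta')/\operatorname{tg}(\Delta)\in(0,1)$ (it depends only on $e$). A path $\eta=(e_1,\dots,e_n)$ is a sequence of consecutive edges, and $L(\eta)=L(e_1)\cdots L(e_n)$; a cycle is a path beginning and ending at the same vertex. A symbolic representation of $x\in K$ is the infinite path $(e_i)_{i\ge1}$, $e_i=(\mathcal V(\Delta_{i-1}),\mathcal V(\Delta_i),q(\Delta_{i-1},\Delta_i))$, given by a sequence $\Delta_0=[0,1]$ (of generation $>1$), $\Delta_i$ a child of $\Delta_{i-1}$, $\{x\}=\bigcap_i\Delta_i$; each $x\in K$ has one symbolic representation, or possibly two if it is an endpoint of a net interval. A periodic point is a point $x\in K$ every symbolic representation of which has the form $(e_1,\dots,e_n,\theta,\theta,\dots)$ with $n$ minimal and $\theta$ a cycle of $\mathcal G$ of minimal length (number of edges); $\theta$ is called a period of that symbolic representation. Transition matrices. Fix a total order on the set of all neighbours of net intervals. For an edge $e=(\mathcal V(\Delta),\mathcal V(\Delta'),q(\Delta,\Delta'))$ with $\Delta$ the parent of $\Delta'$, $\mathcal V(\Delta)=\{f_1<\dots<f_k\}$, $\mathcal V(\Delta')=\{g_1<\dots<g_n\}$, $T(e)$ is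 the $k\times n$ matrix with $$T(e)_{i,j}=\frac{\mu_{\mathbf p}(g_j^{-1}((0,1)))}{\mu_{\mathbf p}(f_i^{-1}((0,1)))}\,p_\ell$$ if there is $\ell\in\mathcal I\cup\{\emptyset\}$ (with $p_\emptyset=1$) such that $f_i$ is generated by some $\sigma$ and $g_j$ is generated by $\sigma\ell$, and $T(e)_{i,j}=0$ otherwise. (This depends only on $e$.) $T(e_1,\dots,e_n)=T(e_1)\cdots T(e_n)$. $\operatorname{sp}(M)$ is the spectral radius of $M$. Local dimension: $\dim_{\mathrm{loc}}\mu(x)=\lim_{t\to0}\frac{\log\mu(B(x,t))}{\log t}$, with $B(x,t)$ the closed ball. *)

theory Defs
  imports "HOL-Probability.Probability_Measure" "Jordan_Normal_Form.Spectral_Radius"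
begin

record 'i ifs =
  idx :: "'i set"
  rat :: "'i \<Rightarrow> real"
  trl :: "'i \<Rightarrow> real"

definition ifs_map :: "('i, 'z) ifs_scheme \<Rightarrow> 'i \<Rightarrow> real \<Rightarrow> real" where
  "ifs_map \<Phi> i x = rat \<Phi> i * x + trl \<Phi> i"

definition is_ifs :: "('i, 'z) ifs_scheme \<Rightarrow> bool" where
  "is_ifs \<Phi> \<longleftrightarrow> finite (idx \<Phi>) \<and> card (idx \<Phi>) \<ge> 2 \<and>
     (\<forall>i\<in>idx \<Phi>. 0 < \<bar>rat \<Phi> i\<bar> \<and> \<bar>rat \<Phi> i\<bar> < 1) \<and> inj_on (ifs_map \<Phi>) (idx \<Phi>)"

definition is_attractor :: "('i, 'z) ifs_scheme \<Rightarrow> real set \<Rightarrow> bool" where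
  "is_attractor \<Phi> K \<longleftrightarrow> compact K \<and> K \<noteq> {} \<and> K = (\<Union>i\<in>idx \<Phi>. ifs_map \<Phi> i ` K)"

definition prob_weights :: "('i, 'z) ifs_scheme \<Rightarrow> ('i \<Rightarrow> real) \<Rightarrow> bool" where
  "prob_weights \<Phi> p \<longleftrightarrow> (\<forall>i\<in>idx \<Phi>. 0 < p i) \<and> (\<Sum>i\<in>idx \<Phi>. p i) = 1"

definition self_similar_measure ::
    "('i, 'z) ifs_scheme \<Rightarrow> ('i \<Rightarrow> real) \<Rightarrow> real measure \<Rightarrow> bool" where
  "self_similar_measure \<Phi> p \<mu> \<longleftrightarrow> prob_space \<mu> \<and> sets \<mu> = sets borel \<and>
     (\<forall>E\<in>sets borel. measure \<mu> E = (\<Sum>i\<in>idx \<Phi>. p i * measure \<mu> (ifs_map \<Phi> i -` E)))"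

text \<open>Words over the alphabet are lists; the first letter is the outermost map.\<close>

definition word_map :: "('i, 'z) ifs_scheme \<Rightarrow> 'i list \<Rightarrow> real \<Rightarrow> real" where
  "word_map \<Phi> \<sigma> = foldr (\<lambda>i f. ifs_map \<Phi> i \<circ> f) \<sigma> id"

definition word_rat :: "('i, 'z) ifs_scheme \<Rightarrow> 'i list \<Rightarrow> real" where
  "word_rat \<Phi> \<sigma> = prod_list (map (rat \<Phi>) \<sigma>)"

text \<open>The disjunct \<open>\<sigma> = []\<close> implements the convention that the ratio of the deleted empty
  word is infinite.\<close>

definition words_at :: "('i, 'z) ifs_scheme \<Rightarrow> real \<Rightarrow> 'i list set" where
  "words_at \<Phi> t = {\<sigma> \<in> lists (idx \<Phi>).
     \<bar>word_rat \<Phi> \<sigma>\<bar> < t \<and> (\<sigma> = [] \<or> t \<le> \<bar>word_rat \<Phi> (butlast \<sigma>)\<bar>)}"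

text \<open>An interval \<open>[lft, rgt]\<close> together with its generation.\<close>

datatype gen_ivl = Gen_Ivl (gen: real) (lft: real) (rgt: real)

definition end_pts :: "('i, 'z) ifs_scheme \<Rightarrow> real \<Rightarrow> real set" where
  "end_pts \<Phi> t = (\<Union>\<sigma>\<in>words_at \<Phi> t. {word_map \<Phi> \<sigma> 0, word_map \<Phi> \<sigma> 1})"

definition net_interval :: "('i, 'z) ifs_scheme \<Rightarrow> real set \<Rightarrow> gen_ivl \<Rightarrow> bool" where
  "net_interval \<Phi> K \<Delta> \<longleftrightarrow> gen \<Delta> > 0 \<and>
     lft \<Delta> \<in> end_pts \<Phi> (gen \<Delta>) \<and> rgt \<Delta> \<in> end_pts \<Phi> (gen \<Delta>) \<and> lft \<Delta> < rgt \<Delta> \<and>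
     {lft \<Delta><..<rgt \<Delta>} \<inter> end_pts \<Phi> (gen \<Delta>) = {} \<and> {lft \<Delta><..<rgt \<Delta>} \<inter> K \<noteq> {}"

definition diam_ivl :: "gen_ivl \<Rightarrow> real" where
  "diam_ivl \<Delta> = rgt \<Delta> - lft \<Delta>"

definition ivl_map :: "gen_ivl \<Rightarrow> real \<Rightarrow> real" where
  "ivl_map \<Delta> x = diam_ivl \<Delta> * x + lft \<Delta>"

definition generates ::
    "('i, 'z) ifs_scheme \<Rightarrow> real set \<Rightarrow> gen_ivl \<Rightarrow> 'i list \<Rightarrow> (real \<Rightarrow> real) \<Rightarrow> bool" where
  "generates \<Phi> K \<Delta> \<sigma> f \<longleftrightarrow> \<sigma> \<in> words_at \<Phi> (gen \<Delta>) \<and>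
     word_map \<Phi> \<sigma> ` K \<inter> {lft \<Delta><..<rgt \<Delta>} \<noteq> {} \<and> f = inv_into UNIV (ivl_map \<Delta>) \<circ> word_map \<Phi> \<sigma>"

definition nbs :: "('i, 'z) ifs_scheme \<Rightarrow> real set \<Rightarrow> gen_ivl \<Rightarrow> (real \<Rightarrow> real) set" where
  "nbs \<Phi> K \<Delta> = {f. \<exists>\<sigma>. generates \<Phi> K \<Delta> \<sigma> f}"

definition all_nbs :: "('i, 'z) ifs_scheme \<Rightarrow> real set \<Rightarrow> (real \<Rightarrow> real) set" where
  "all_nbs \<Phi> K = (\<Union>\<Delta>\<in>{\<Delta>. net_interval \<Phi> K \<Delta>}. nbs \<Phi> K \<Delta>)"

definition tg :: "('i, 'z) ifs_scheme \<Rightarrow> real set \<Rightarrow> gen_ivl \<Rightarrow> real" where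
  "tg \<Phi> K \<Delta> = diam_ivl \<Delta> * Max {\<bar>R\<bar> | R a. (\<lambda>x. R * x + a) \<in> nbs \<Phi> K \<Delta>}"

definition child_of :: "('i, 'z) ifs_scheme \<Rightarrow> real set \<Rightarrow> gen_ivl \<Rightarrow> gen_ivl \<Rightarrow> bool" where
  "child_of \<Phi> K \<Delta> \<Delta>' \<longleftrightarrow> net_interval \<Phi> K \<Delta> \<and> net_interval \<Phi> K \<Delta>' \<and>
     gen \<Delta>' = tg \<Phi> K \<Delta> \<and> {lft \<Delta>'..rgt \<Delta>'} \<subseteq> {lft \<Delta>..rgt \<Delta>}"

definition pos_index :: "gen_ivl \<Rightarrow> gen_ivl \<Rightarrow> real" where
  "pos_index \<Delta> \<Delta>' = (lft \<Delta>' - lft \<Delta>) / diam_ivl \<Delta>"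

type_synonym edge = "(real \<Rightarrow> real) set \<times> (real \<Rightarrow> real) set \<times> real"

definition edge_src :: "edge \<Rightarrow> (real \<Rightarrow> real) set" where
  "edge_src e = fst e"

definition edge_tgt :: "edge \<Rightarrow> (real \<Rightarrow> real) set" where
  "edge_tgt e = fst (snd e)"

definition edge_btw :: "('i, 'z) ifs_scheme \<Rightarrow> real set \<Rightarrow> gen_ivl \<Rightarrow> gen_ivl \<Rightarrow> edge" where
  "edge_btw \<Phi> K \<Delta> \<Delta>' = (nbs \<Phi> K \<Delta>, nbs \<Phi> K \<Delta>', pos_index \<Delta> \<Delta>')"

definition edges :: "('i, 'z) ifs_scheme \<Rightarrow> real set \<Rightarrow> edge set" where
  "edges \<Phi> K = {edge_btw \<Phi> K \<Delta> \<Delta>' | \<Delta> \<Delta>'. child_of \<Phi> K \<Delta> \<Delta>'}"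

text \<open>An edge is realised by many pairs (parent, child). Lengths and transition matrices are
  computed from an arbitrary realisation; they do not depend on its choice.\<close>

definition realisation :: "('i, 'z) ifs_scheme \<Rightarrow> real set \<Rightarrow> edge \<Rightarrow> gen_ivl \<times> gen_ivl" where
  "realisation \<Phi> K e =
     (SOME D. child_of \<Phi> K (fst D) (snd D) \<and> edge_btw \<Phi> K (fst D) (snd D) = e)"

definition edge_len :: "('i, 'z) ifs_scheme \<Rightarrow> real set \<Rightarrow> edge \<Rightarrow> real" where
  "edge_len \<Phi> K e = tg \<Phi> K (snd (realisation \<Phi> K e)) / tg \<Phi> K (fst (realisation \<Phi> K e))"

definition path_len :: "('i, 'z) ifs_scheme \<Rightarrow> real set \<Rightarrow> edge list \<Rightarrow> real" where
  "path_len \<Phi> K \<eta> = prod_list (map (edge_len \<Phi> K) \<eta>)"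

definition is_path :: "('i, 'z) ifs_scheme \<Rightarrow> real set \<Rightarrow> edge list \<Rightarrow> bool" where
  "is_path \<Phi> K \<eta> \<longleftrightarrow> \<eta> \<noteq> [] \<and> set \<eta> \<subseteq> edges \<Phi> K \<and>
     (\<forall>k. Suc k < length \<eta> \<longrightarrow> edge_tgt (\<eta> ! k) = edge_src (\<eta> ! Suc k))"

definition is_cycle :: "('i, 'z) ifs_scheme \<Rightarrow> real set \<Rightarrow> edge list \<Rightarrow> bool" where
  "is_cycle \<Phi> K \<eta> \<longleftrightarrow> is_path \<Phi> K \<eta> \<and> edge_src (hd \<eta>) = edge_tgt (last \<eta>)"

definition symbolic_rep ::
    "('i, 'z) ifs_scheme \<Rightarrow> real set \<Rightarrow> real \<Rightarrow> (nat \<Rightarrow> edge) \<Rightarrow> bool" where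
  "symbolic_rep \<Phi> K x e \<longleftrightarrow> (\<exists>\<Delta> :: nat \<Rightarrow> gen_ivl.
     gen (\<Delta> 0) > 1 \<and> lft (\<Delta> 0) = 0 \<and> rgt (\<Delta> 0) = 1 \<and>
     (\<forall>k. child_of \<Phi> K (\<Delta> k) (\<Delta> (Suc k))) \<and>
     {x} = (\<Inter>k. {lft (\<Delta> k)..rgt (\<Delta> k)}) \<and>
     (\<forall>k. e k = edge_btw \<Phi> K (\<Delta> k) (\<Delta> (Suc k))))"

definition ev_periodic_form ::
    "('i, 'z) ifs_scheme \<Rightarrow> real set \<Rightarrow> (nat \<Rightarrow> edge) \<Rightarrow> nat \<Rightarrow> edge list \<Rightarrow> bool" where
  "ev_periodic_form \<Phi> K e n \<theta> \<longleftrightarrow> is_cycle \<Phi> K \<theta> \<and>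
     (\<forall>k. e (n + k) = \<theta> ! (k mod length \<theta>))"

text \<open>The length of the preperiod and the length of the cycle can be minimised
  simultaneously.\<close>

definition is_period ::
    "('i, 'z) ifs_scheme \<Rightarrow> real set \<Rightarrow> (nat \<Rightarrow> edge) \<Rightarrow> edge list \<Rightarrow> bool" where
  "is_period \<Phi> K e \<theta> \<longleftrightarrow> (\<exists>n. ev_periodic_form \<Phi> K e n \<theta> \<and>
     (\<forall>n' \<theta>'. ev_periodic_form \<Phi> K e n' \<theta>' \<longrightarrow> n \<le> n' \<and> length \<theta> \<le> length \<theta>'))"

definition periodic_point :: "('i, 'z) ifs_scheme \<Rightarrow> real set \<Rightarrow> real \<Rightarrow> bool" where
  "periodic_point \<Phi> K x \<longleftrightarrow> x \<in> K \<and> (\<forall>e. symbolic_rep \<Phi> K x e \<longrightarrow> (\<exists>\<theta>. is_period \<Phi> K e \<theta>))"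

text \<open>The enumeration of a finite set of neighbours in increasing order with respect to a
  fixed total order \<open>ord\<close>.\<close>

definition enum_nbs ::
    "((real \<Rightarrow> real) \<times> (real \<Rightarrow> real)) set \<Rightarrow> (real \<Rightarrow> real) set \<Rightarrow> (real \<Rightarrow> real) list" where
  "enum_nbs ord V = (THE fs. set fs = V \<and> distinct fs \<and> sorted_wrt (\<lambda>f g. (f, g) \<in> ord) fs)"

text \<open>The optional letter \<open>l\<close> by which a generating word of \<open>f\<close> is prolonged to a
  generating word of \<open>g\<close> is a list of length at most one; it is unique if it exists because
  the maps of the system are distinct contractions.\<close>

definition prolongs :: "('i, 'z) ifs_scheme \<Rightarrow> real set \<Rightarrow> gen_ivl \<Rightarrow> gen_ivl \<Rightarrow>
    (real \<Rightarrow> real) \<Rightarrow> (real \<Rightarrow> real) \<Rightarrow> 'i list \<Rightarrow> bool" where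
  "prolongs \<Phi> K \<Delta> \<Delta>' f g l \<longleftrightarrow> l \<in> insert [] ((\<lambda>i. [i]) ` idx \<Phi>) \<and>
     (\<exists>\<sigma>. generates \<Phi> K \<Delta> \<sigma> f \<and> generates \<Phi> K \<Delta>' (\<sigma> @ l) g)"

definition trans_entry :: "('i, 'z) ifs_scheme \<Rightarrow> real set \<Rightarrow> ('i \<Rightarrow> real) \<Rightarrow> real measure \<Rightarrow>
    gen_ivl \<Rightarrow> gen_ivl \<Rightarrow> (real \<Rightarrow> real) \<Rightarrow> (real \<Rightarrow> real) \<Rightarrow> real" where
  "trans_entry \<Phi> K p \<mu> \<Delta> \<Delta>' f g =
     (if \<exists>l. prolongs \<Phi> K \<Delta> \<Delta>' f g l
      then measure \<mu> (g -` {0<..<1}) / measure \<mu> (f -` {0<..<1}) *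
             prod_list (map p (THE l. prolongs \<Phi> K \<Delta> \<Delta>' f g l))
      else 0)"

definition trans_mat :: "('i, 'z) ifs_scheme \<Rightarrow> real set \<Rightarrow> ('i \<Rightarrow> real) \<Rightarrow> real measure \<Rightarrow>
    ((real \<Rightarrow> real) \<times> (real \<Rightarrow> real)) set \<Rightarrow> edge \<Rightarrow> real Matrix.mat" where
  "trans_mat \<Phi> K p \<mu> ord e =
     (let (\<Delta>, \<Delta>') = realisation \<Phi> K e;
          fs = enum_nbs ord (edge_src e); gs = enum_nbs ord (edge_tgt e)
      in Matrix.mat (length fs) (length gs)
           (\<lambda>(i, j). trans_entry \<Phi> K p \<mu> \<Delta> \<Delta>' (fs ! i) (gs ! j)))"

text \<open>Only meaningful for nonempty paths.\<close>

definition path_mat :: "('i, 'z) ifs_scheme \<Rightarrow> real set \<Rightarrow> ('i \<Rightarrow> real) \<Rightarrow> real measure \<Rightarrow>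
    ((real \<Rightarrow> real) \<times> (real \<Rightarrow> real)) set \<Rightarrow> edge list \<Rightarrow> real Matrix.mat" where
  "path_mat \<Phi> K p \<mu> ord \<eta> =
     foldl (*) (trans_mat \<Phi> K p \<mu> ord (hd \<eta>)) (map (trans_mat \<Phi> K p \<mu> ord) (tl \<eta>))"

definition real_spectral_radius :: "real Matrix.mat \<Rightarrow> real" where
  "real_spectral_radius A = spectral_radius (map_mat complex_of_real A)"

definition period_quotient :: "('i, 'z) ifs_scheme \<Rightarrow> real set \<Rightarrow> ('i \<Rightarrow> real) \<Rightarrow> real measure \<Rightarrow>
    ((real \<Rightarrow> real) \<times> (real \<Rightarrow> real)) set \<Rightarrow> edge list \<Rightarrow> real" where
  "period_quotient \<Phi> K p \<mu> ord \<theta> =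
     ln (real_spectral_radius (path_mat \<Phi> K p \<mu> ord \<theta>)) / ln (path_len \<Phi> K \<theta>)"

definition has_local_dim :: "real measure \<Rightarrow> real \<Rightarrow> real \<Rightarrow> bool" where
  "has_local_dim \<mu> x D \<longleftrightarrow>
     ((\<lambda>t. ln (measure \<mu> (cball x t)) / ln t) \<longlongrightarrow> D) (at_right 0)"

end

theory Submission
  imports Defs
begin

text \<open>
  Let \<open>Q\<^sub>f(\<Delta>)\<close> be the mass which the words generating the neighbour \<open>f\<close> contribute to the interior
  of a net interval \<open>\<Delta>\<close>. Grouping the words of the next generation by their prefixes gives
  \<open>Q(\<Delta>') = Q(\<Delta>) T(e)\<close> for an edge \<open>e\<close> from \<open>\<Delta>\<close> to a child \<open>\<Delta>'\<close>, and the entries of \<open>Q(\<Delta>)\<close>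
  are positive and add up to the mass of the interior. Along a symbolic representation of period
  \<open>\<theta>\<close> the masses of the net intervals hence grow like the powers of \<open>sp T(\<theta>)\<close> by Gelfand's
  formula, while their diameters decrease exactly like the powers of \<open>L(\<theta>)\<close>; this bounds the
  mass of balls from below.

  For the upper bound, a one-sided neighbourhood of \<open>x\<close> either misses \<open>K\<close>, or \<open>K\<close> accumulates at
  \<open>x\<close> from that side and there is a symbolic representation by net intervals which extend
  beyond \<open>x\<close> on that side. The net intervals of consecutive periods are related by one affine map
  that fixes \<open>x\<close>, so they extend beyond \<open>x\<close> by a fixed proportion of their diameter and contain the
  one-sided part of a ball of comparable radius. As \<open>\<mu>\<close> has no atoms, the two sides add up.
\<close>


section \<open>Powers of nonnegative matrices\<close>

text \<open>The transition matrices are nonnegative but need not be irreducible, and the graph may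
  be infinite, so neither a common positive eigenvector nor bounds uniform over all net intervals
  are at hand. The substitute is the strict positivity of the row of masses: it gives positive
  weight to every row of the powers of \<open>T(\<theta>)\<close>, so the growth of the masses sees
  the full spectral radius. From below this yields a clean multiple of its k-th power; from above,
  Jordan blocks may add polynomial factors, which is why every upper bound carries an arbitrary loss
  \<delta> in the exponent that disappears only in the limit. A net interval ending at x says
  nothing about the mass beyond x, and adjacent net intervals cannot be compared. Hence each side
  gets its own symbolic representation, possibly with another period, and minimality of the quotient
  of \<theta> is what lets all exponents be replaced by that of \<theta>.\<close>

lemma map_mat_pow:
  fixes T :: "real Matrix.mat"
  assumes "T \<in> carrier_mat n n"
  shows "map_mat complex_of_real (T ^\<^sub>m k) = map_mat complex_of_real T ^\<^sub>m k"
  by (rule of_real_hom.mat_hom_pow[OF assms])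

text \<open>Scaling by \<open>1/s\<close> moves the spectral radius strictly below 1, where all
  powers are bounded entrywise. At \<open>s\<close> equal to the spectral radius the bound may fail,
  because of nontrivial Jordan blocks.\<close>

lemma pow_mat_le_real_spectral_radius:
  fixes T :: "real Matrix.mat"
  assumes T: "T \<in> carrier_mat n n" and n: "n > 0"
    and s: "s > 0" "real_spectral_radius T < s"
  shows "\<exists>c. \<forall>k. \<forall>i<n. \<forall>j<n. \<bar>(T ^\<^sub>m k) $$ (i, j)\<bar> \<le> c * s ^ k"
proof -
  define A where "A = map_mat complex_of_real T"
  define B where "B = complex_of_real (1/s) \<cdot>\<^sub>m A"
  have A: "A \<in> carrier_mat n n" and B: "B \<in> carrier_mat n n"
    using T by (auto simp: A_def B_def)
  have Bk: "B ^\<^sub>m k = complex_of_real ((1/s)^k) \<cdot>\<^sub>m (A ^\<^sub>m k)" for k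
  proof (induction k)
    case 0
    show ?case using A B by (auto intro!: eq_matI)
  next
    case (Suc k)
    have "B ^\<^sub>m Suc k = (complex_of_real ((1/s)^k) \<cdot>\<^sub>m (A ^\<^sub>m k)) * (complex_of_real (1/s) \<cdot>\<^sub>m A)"
      using Suc B_def by simp
    also have "\<dots> = complex_of_real ((1/s)^k) \<cdot>\<^sub>m (complex_of_real (1/s) \<cdot>\<^sub>m (A ^\<^sub>m k * A))"
      using A mult_smult_assoc_mat[of "A ^\<^sub>m k" n n "complex_of_real (1/s) \<cdot>\<^sub>m A" n]
      by (auto simp: mult_smult_distrib[of _ n n])
    also have "\<dots> = complex_of_real ((1/s)^Suc k) \<cdot>\<^sub>m (A ^\<^sub>m Suc k)"
      using A by (auto intro!: eq_matI)
    finally show ?case .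
  qed
  have "spectral_radius B < 1"
  proof -
    from spectral_radius_mem_max(1)[OF B n] obtain ev where ev: "ev \<in> spectrum B" "spectral_radius B = norm ev"
      by auto
    then obtain v where v: "v \<in> carrier_vec n" "v \<noteq> 0\<^sub>v n" "B *\<^sub>v v = ev \<cdot>\<^sub>v v"
      using B unfolding spectrum_def eigenvalue_def eigenvector_def by auto
    have "B *\<^sub>v v = complex_of_real (1/s) \<cdot>\<^sub>v (A *\<^sub>v v)"
      using A v(1) unfolding B_def by (intro eq_vecI) auto
    hence "A *\<^sub>v v = complex_of_real s \<cdot>\<^sub>v (B *\<^sub>v v)" using s A v(1) by (intro eq_vecI) (auto simp: )
    also have "\<dots> = (complex_of_real s * ev) \<cdot>\<^sub>v v" using v by (auto simp: smult_smult_assoc)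
    finally have "complex_of_real s * ev \<in> spectrum A"
      using A v unfolding spectrum_def eigenvalue_def eigenvector_def by auto
    hence "norm (complex_of_real s * ev) \<le> spectral_radius A"
      by (intro spectral_radius_mem_max(2)[OF A n]) auto
    also have "\<dots> < s" using s unfolding real_spectral_radius_def A_def by simp
    finally show ?thesis using s ev by (simp add: norm_mult)
  qed
  from spectral_radius_jnf_norm_bound_less_1_upper_triangular[OF B this]
  obtain c where c: "\<And>k. norm_bound (B ^\<^sub>m k) c" by blast
  show ?thesis
  proof (intro exI allI impI)
    fix k i j assume ij: "i < n" "j < n"
    have "norm ((B ^\<^sub>m k) $$ (i,j)) \<le> c"
      using c[of k] ij B unfolding norm_bound_def by auto
    moreover have "(B ^\<^sub>m k) $$ (i,j) = complex_of_real ((1/s)^k * (T ^\<^sub>m k) $$ (i,j))"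
      unfolding Bk A_def map_mat_pow[OF T, symmetric] using ij T by simp
    ultimately have "\<bar>(1/s)^k * (T ^\<^sub>m k) $$ (i,j)\<bar> \<le> c"
      by (metis norm_of_real)
    thus "\<bar>(T ^\<^sub>m k) $$ (i,j)\<bar> \<le> c * s ^ k" using s
      by (simp add: abs_mult power_one_over field_simps)
  qed
qed

lemma pow_mat_nonneg:
  fixes T :: "real Matrix.mat"
  assumes T: "T \<in> carrier_mat n n" and nonneg: "\<And>i j. i < n \<Longrightarrow> j < n \<Longrightarrow> 0 \<le> T $$ (i, j)"
    and "i < n" "j < n"
  shows "0 \<le> (T ^\<^sub>m k) $$ (i, j)"
  using assms(3,4)
proof (induction k arbitrary: i j)
  case 0
  then show ?case using T by auto
next
  case (Suc k)
  then show ?case using T nonneg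
    by (auto simp: scalar_prod_def intro!: sum_nonneg)
qed

text \<open>Take a complex eigenvector \<open>v\<close> of an eigenvalue of maximal modulus and read
  \<open>A^k v = ev^k v\<close> in a coordinate \<open>i\<close> with \<open>v_i\<close> nonzero. As
  the entries of the powers are nonnegative, the triangle inequality bounds the modulus by the i-th
  row sum times the largest \<open>|v_j|\<close>. Neither \<open>i\<close> nor the constant depends
  on \<open>k\<close>.\<close>

lemma real_spectral_radius_le_pow_mat:
  fixes T :: "real Matrix.mat"
  assumes T: "T \<in> carrier_mat n n" and n: "n > 0"
    and nonneg: "\<And>i j. i < n \<Longrightarrow> j < n \<Longrightarrow> 0 \<le> T $$ (i, j)"
  shows "\<exists>i<n. \<exists>c>0. \<forall>k. c * real_spectral_radius T ^ k \<le> (\<Sum>j<n. (T ^\<^sub>m k) $$ (i, j))"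
proof -
  define A where "A = map_mat complex_of_real T"
  have A: "A \<in> carrier_mat n n" using T by (auto simp: A_def)
  from spectral_radius_mem_max(1)[OF A n] obtain ev where ev: "ev \<in> spectrum A" "spectral_radius A = norm ev"
    by auto
  then obtain v where v: "eigenvector A v ev"
    unfolding spectrum_def eigenvalue_def by auto
  hence v': "v \<in> carrier_vec n" "v \<noteq> 0\<^sub>v n" using A unfolding eigenvector_def by auto
  then obtain i where i: "i < n" "vec_index v i \<noteq> 0" by (metis eq_vecI carrier_vecD index_zero_vec)
  define m where "m = Max ((\<lambda>j. norm (vec_index v j)) ` {..<n})"
  have m: "norm (vec_index v j) \<le> m" if "j < n" for j using that unfolding m_def by auto
  have m0: "m > 0" using m[OF i(1)] i(2) by (smt (verit) zero_less_norm_iff)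
  have bound: "(norm (vec_index v i) / m) * real_spectral_radius T ^ k \<le> (\<Sum>j<n. (T ^\<^sub>m k) $$ (i, j))" for k
  proof -
    have "vec_index (A ^\<^sub>m k *\<^sub>v v) i = ev ^ k * vec_index v i"
      using eigenvector_pow[OF A v, of k] i v'(1) by simp
    moreover have "vec_index (A ^\<^sub>m k *\<^sub>v v) i = (\<Sum>j<n. (A ^\<^sub>m k) $$ (i,j) * vec_index v j)"
      using i A v'(1) by (auto simp: scalar_prod_def intro!: sum.cong)
    moreover have "(A ^\<^sub>m k) $$ (i,j) = complex_of_real ((T ^\<^sub>m k) $$ (i,j))" if "j < n" for j
      using i that A T unfolding A_def by (simp flip: map_mat_pow[OF T])
    ultimately have "ev ^ k * vec_index v i = (\<Sum>j<n. complex_of_real ((T ^\<^sub>m k) $$ (i,j)) * vec_index v j)"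
      by simp
    hence "norm (ev ^ k * vec_index v i) \<le> (\<Sum>j<n. norm (complex_of_real ((T ^\<^sub>m k) $$ (i,j)) * vec_index v j))"
      by (metis norm_sum)
    also have "\<dots> \<le> (\<Sum>j<n. (T ^\<^sub>m k) $$ (i,j) * m)"
      using pow_mat_nonneg[OF T nonneg i(1)] m
      by (intro sum_mono) (auto simp: norm_mult intro!: mult_left_mono)
    finally have "norm ev ^ k * norm (vec_index v i) \<le> (\<Sum>j<n. (T ^\<^sub>m k) $$ (i,j)) * m"
      by (simp add: norm_mult norm_power sum_distrib_right)
    thus ?thesis using m0 ev(2) unfolding real_spectral_radius_def A_def by (simp add: field_simps)
  qed
  have pos: "norm (vec_index v i) / m > 0" using i(2) m0 by (intro divide_pos_pos) (auto simp only: zero_less_norm_iff)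
  show ?thesis
  proof (rule exI, rule conjI[OF i(1)], rule exI, rule conjI[OF pos], rule allI)
    show "(norm (vec_index v i) / m) * real_spectral_radius T ^ k \<le> (\<Sum>j<n. (T ^\<^sub>m k) $$ (i, j))" for k
      by (rule bound)
  qed
qed

text \<open>Gelfand's formula for the action on a strictly positive row vector.\<close>

lemma row_pow_growth:
  fixes T R :: "real Matrix.mat"
  assumes T: "T \<in> carrier_mat n n" and n: "n > 0"
    and nonneg: "\<And>i j. i < n \<Longrightarrow> j < n \<Longrightarrow> 0 \<le> T $$ (i, j)"
    and R: "R \<in> carrier_mat 1 n" and R_pos: "\<And>j. j < n \<Longrightarrow> 0 < R $$ (0, j)"
    and RT_pos: "\<And>j. j < n \<Longrightarrow> 0 < (R * T) $$ (0, j)"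
  defines "m \<equiv> \<lambda>k. \<Sum>j<n. (R * T ^\<^sub>m k) $$ (0, j)"
  shows "\<exists>c>0. \<forall>k. c * real_spectral_radius T ^ k \<le> m k"
    and "s > real_spectral_radius T \<Longrightarrow> s > 0 \<Longrightarrow> \<exists>c>0. \<forall>k. m k \<le> c * s ^ k"
    and "real_spectral_radius T > 0"
proof -
  have entry: "(R * T ^\<^sub>m k) $$ (0, j) = (\<Sum>i<n. R $$ (0, i) * (T ^\<^sub>m k) $$ (i, j))" if "j < n" for j k
    using R T that by (auto simp: scalar_prod_def intro!: sum.cong)
  show "\<exists>c>0. \<forall>k. c * real_spectral_radius T ^ k \<le> m k"
  proof -
    obtain i c where ic: "i < n" "c > 0" "\<And>k. c * real_spectral_radius T ^ k \<le> (\<Sum>j<n. (T ^\<^sub>m k) $$ (i, j))"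
      using real_spectral_radius_le_pow_mat[OF T n nonneg] by blast
    have "R $$ (0, i) * c * real_spectral_radius T ^ k \<le> m k" for k
    proof -
      have "R $$ (0, i) * c * real_spectral_radius T ^ k \<le> R $$ (0, i) * (\<Sum>j<n. (T ^\<^sub>m k) $$ (i, j))"
        using ic(3)[of k] R_pos[OF ic(1)] by (simp add: mult.assoc)
      also have "\<dots> = (\<Sum>j<n. R $$ (0, i) * (T ^\<^sub>m k) $$ (i, j))" by (simp add: sum_distrib_left)
      also have "\<dots> \<le> m k" unfolding m_def
      proof (rule sum_mono)
        fix j assume j: "j \<in> {..<n}"
        show "R $$ (0, i) * (T ^\<^sub>m k) $$ (i, j) \<le> (R * T ^\<^sub>m k) $$ (0, j)"
          using j ic(1) R_pos pow_mat_nonneg[OF T nonneg]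
          by (subst entry) (auto intro!: member_le_sum[of i "{..<n}" "\<lambda>i. R $$ (0, i) * (T ^\<^sub>m k) $$ (i, j)"] simp: less_imp_le)
      qed
      finally show ?thesis .
    qed
    thus ?thesis using ic R_pos by (intro exI[of _ "R $$ (0, i) * c"]) auto
  qed
  show upper: "\<exists>c>0. \<forall>k. m k \<le> c * s ^ k" if s: "s > real_spectral_radius T" "s > 0" for s
  proof -
    obtain c where c: "\<And>k i j. i < n \<Longrightarrow> j < n \<Longrightarrow> \<bar>(T ^\<^sub>m k) $$ (i, j)\<bar> \<le> c * s ^ k"
      using pow_mat_le_real_spectral_radius[OF T n s(2,1)] by blast
    define C where "C = (\<Sum>j<n. \<Sum>i<n. R $$ (0, i)) * c"
    have "m k \<le> C * s ^ k" for k
    proof -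
      have "m k = (\<Sum>j<n. \<Sum>i<n. R $$ (0, i) * (T ^\<^sub>m k) $$ (i, j))"
        unfolding m_def by (auto simp: entry intro!: sum.cong)
      also have "\<dots> \<le> (\<Sum>j<n. \<Sum>i<n. R $$ (0, i) * (c * s ^ k))"
        using c R_pos by (intro sum_mono mult_left_mono) (auto simp: less_imp_le dest!: abs_le_D1)
      finally show ?thesis by (simp add: C_def sum_distrib_right sum_distrib_left mult_ac)
    qed
    moreover have "C * s ^ k \<le> (max C 1) * s ^ k" for k using s by (intro mult_right_mono) auto
    ultimately show ?thesis by (intro exI[of _ "max C 1"]) (auto intro: order_trans)
  qed
  show "real_spectral_radius T > 0"
  proof (rule ccontr)
    assume neg: "\<not> real_spectral_radius T > 0"
    \<comment> \<open>The least factor by which an entry changes in one step: \<open>R * T\<close>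
      dominates \<open>c * R\<close> entrywise, and by iteration the k-th row dominates
      \<open>c^k * R\<close>.\<close>
    define c where "c = Min ((\<lambda>j. (R * T) $$ (0, j) / R $$ (0, j)) ` {..<n})"
    have c0: "c > 0" unfolding c_def using n R_pos RT_pos by (subst Min_gr_iff) auto
    have c1: "c * R $$ (0, j) \<le> (\<Sum>i<n. R $$ (0, i) * T $$ (i, j))" if "j < n" for j
    proof -
      have "c \<le> (R * T) $$ (0, j) / R $$ (0, j)"
        unfolding c_def using that by (intro Min_le) auto
      hence "c * R $$ (0, j) \<le> (R * T) $$ (0, j)"
        using R_pos[OF that] by (simp add: pos_le_divide_eq)
      thus ?thesis using entry[OF that, of 1] T by simp
    qed
    have mono: "c ^ k * R $$ (0, j) \<le> (R * T ^\<^sub>m k) $$ (0, j)" if "j < n" for j k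
      using that
    proof (induction k arbitrary: j)
      case 0
      then show ?case using T R by (auto simp: right_mult_one_mat)
    next
      case (Suc k)
      have "R * T ^\<^sub>m Suc k = (R * T ^\<^sub>m k) * T" using R T
        by (simp add: assoc_mult_mat[of R 1 n "T ^\<^sub>m k" n T n])
      hence "(R * T ^\<^sub>m Suc k) $$ (0, j) = (\<Sum>i<n. (R * T ^\<^sub>m k) $$ (0, i) * T $$ (i, j))"
        using R T Suc.prems by (auto simp: scalar_prod_def intro!: sum.cong)
      moreover have "c ^ Suc k * R $$ (0, j) \<le> c ^ k * (\<Sum>i<n. R $$ (0, i) * T $$ (i, j))"
        using c1[OF Suc.prems] c0 by (simp add: mult_ac mult_left_mono)
      moreover have "c ^ k * (\<Sum>i<n. R $$ (0, i) * T $$ (i, j)) = (\<Sum>i<n. (c ^ k * R $$ (0, i)) * T $$ (i, j))"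
        by (simp add: sum_distrib_left mult_ac)
      moreover have "\<dots> \<le> (\<Sum>i<n. (R * T ^\<^sub>m k) $$ (0, i) * T $$ (i, j))"
        using Suc nonneg by (intro sum_mono mult_right_mono) auto
      ultimately show ?case by linarith
    qed
    define r where "r = (\<Sum>j<n. R $$ (0, j))"
    have r0: "r > 0" unfolding r_def using n R_pos by (intro sum_pos) auto
    have lower: "c ^ k * r \<le> m k" for k
      unfolding r_def m_def sum_distrib_left using mono by (intro sum_mono) auto
    \<comment> \<open>If the spectral radius were not positive, the upper bound would apply with
      rate \<open>c / 2\<close>, which cannot dominate growth at rate \<open>c\<close>.\<close>
    obtain C where C: "C > 0" "\<And>k. m k \<le> C * (c / 2) ^ k"
      using upper[of "c / 2"] neg c0 by auto
    have "2 ^ k \<le> C / r" for k :: nat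
      using order_trans[OF lower C(2), of k] c0 r0 by (simp add: field_simps power_divide)
    moreover obtain k where "C / r < 2 ^ k" using real_arch_pow[of 2 "C / r"] by auto
    ultimately show False using not_le by blast
  qed
qed

section \<open>Words and their maps\<close>

lemma word_map_Nil [simp]: "word_map \<Phi> [] = id"
  and word_map_Cons [simp]: "word_map \<Phi> (i # \<sigma>) = ifs_map \<Phi> i \<circ> word_map \<Phi> \<sigma>"
  by (simp_all add: word_map_def)

lemma word_map_append: "word_map \<Phi> (\<sigma> @ \<tau>) = word_map \<Phi> \<sigma> \<circ> word_map \<Phi> \<tau>"
  by (induction \<sigma>) (auto simp: comp_assoc)

lemma word_rat_Nil [simp]: "word_rat \<Phi> [] = 1"
  and word_rat_Cons [simp]: "word_rat \<Phi> (i # \<sigma>) = rat \<Phi> i * word_rat \<Phi> \<sigma>"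
  and word_rat_append [simp]: "word_rat \<Phi> (\<sigma> @ \<tau>) = word_rat \<Phi> \<sigma> * word_rat \<Phi> \<tau>"
  by (simp_all add: word_rat_def)

lemma word_map_diff: "word_map \<Phi> \<sigma> x - word_map \<Phi> \<sigma> y = word_rat \<Phi> \<sigma> * (x - y)"
proof (induction \<sigma>)
  case (Cons i \<sigma>)
  have "word_map \<Phi> (i # \<sigma>) x - word_map \<Phi> (i # \<sigma>) y
      = rat \<Phi> i * (word_map \<Phi> \<sigma> x - word_map \<Phi> \<sigma> y)"
    by (simp add: ifs_map_def algebra_simps)
  then show ?case using Cons by simp
qed simp

lemma word_map_eq: "word_map \<Phi> \<sigma> x = word_rat \<Phi> \<sigma> * x + word_map \<Phi> \<sigma> 0"
  using word_map_diff[of \<Phi> \<sigma> x 0] by simp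

lemma word_map_dist: "dist (word_map \<Phi> \<sigma> x) (word_map \<Phi> \<sigma> y) = \<bar>word_rat \<Phi> \<sigma>\<bar> * dist x y"
  by (simp add: dist_real_def word_map_diff abs_mult)

lemma continuous_on_word_map: "continuous_on A (word_map \<Phi> \<sigma>)"
  using word_map_eq[of \<Phi> \<sigma>] by (subst ext[OF word_map_eq]) (intro continuous_intros)

lemma measurable_word_map [measurable]: "word_map \<Phi> \<sigma> \<in> borel \<rightarrow>\<^sub>M borel"
  by (intro borel_measurable_continuous_onI continuous_on_word_map)

lemma vimage_word_map_borel: "E \<in> sets borel \<Longrightarrow> word_map \<Phi> \<sigma> -` E \<in> sets borel"
  using measurable_sets[OF measurable_word_map, of E \<Phi> \<sigma>] by simp

section \<open>The standing assumptions and the attractor\<close>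

locale self_similar_setup =
  fixes \<Phi> :: "'i ifs" and K :: "real set" and p :: "'i \<Rightarrow> real" and \<mu> :: "real measure"
  assumes ifs: "is_ifs \<Phi>" and attractor: "is_attractor \<Phi> K"
    and not_singleton: "\<nexists>y. K = {y}" and hull: "convex hull K = {0..1}"
    and weights: "prob_weights \<Phi> p" and self_similar: "self_similar_measure \<Phi> p \<mu>"
begin

abbreviation "S \<equiv> word_map \<Phi>"
abbreviation "\<rho> \<equiv> word_rat \<Phi>"
abbreviation "\<Lambda> \<equiv> words_at \<Phi>"
abbreviation "P \<sigma> \<equiv> prod_list (map p \<sigma>)"

sublocale prob_space \<mu>
  using self_similar by (simp add: self_similar_measure_def)

lemma sets_\<mu> [simp, measurable_cong]: "sets \<mu> = sets borel"
  using self_similar by (simp add: self_similar_measure_def)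

lemma space_\<mu> [simp]: "space \<mu> = UNIV"
  using sets_eq_imp_space_eq[OF sets_\<mu>] by simp

lemma finite_idx: "finite (idx \<Phi>)" and idx_nonempty: "idx \<Phi> \<noteq> {}"
  and rat_bounds: "i \<in> idx \<Phi> \<Longrightarrow> 0 < \<bar>rat \<Phi> i\<bar>" "i \<in> idx \<Phi> \<Longrightarrow> \<bar>rat \<Phi> i\<bar> < 1"
  and inj_ifs_map: "inj_on (ifs_map \<Phi>) (idx \<Phi>)"
  using ifs by (auto simp: is_ifs_def)

lemma word_rat_pos: "\<sigma> \<in> lists (idx \<Phi>) \<Longrightarrow> 0 < \<bar>\<rho> \<sigma>\<bar>"
  by (induction \<sigma>) (use rat_bounds in \<open>auto simp: abs_mult\<close>)

lemma word_rat_le_1: "\<sigma> \<in> lists (idx \<Phi>) \<Longrightarrow> \<bar>\<rho> \<sigma>\<bar> \<le> 1"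
  by (induction \<sigma>) (use rat_bounds in \<open>auto simp: abs_mult less_imp_le intro!: mult_le_one\<close>)

lemma P_pos: "\<sigma> \<in> lists (idx \<Phi>) \<Longrightarrow> 0 < P \<sigma>"
  by (induction \<sigma>) (use weights in \<open>auto simp: prob_weights_def\<close>)

lemma compact_K: "compact K" and K_nonempty: "K \<noteq> {}"
  and K_eq: "K = (\<Union>i\<in>idx \<Phi>. ifs_map \<Phi> i ` K)"
  using attractor by (simp_all add: is_attractor_def)

lemma K_subset: "K \<subseteq> {0..1}"
  using hull_subset[of K convex] hull by simp

lemma zero_in_K: "0 \<in> K"
proof (rule ccontr)
  assume "0 \<notin> K"
  hence "K \<subseteq> {0<..1}" using K_subset by (force simp: less_le)
  hence "convex hull K \<subseteq> {0<..1}" by (intro hull_minimal) auto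
  hence "(0::real) \<in> {0<..1}" unfolding hull by (rule subsetD) simp
  thus False by simp
qed

lemma one_in_K: "1 \<in> K"
proof (rule ccontr)
  assume "1 \<notin> K"
  hence "K \<subseteq> {0..<1}" using K_subset by (force simp: less_le)
  hence "convex hull K \<subseteq> {0..<1}" by (intro hull_minimal) auto
  hence "(1::real) \<in> {0..<1}" unfolding hull by (rule subsetD) simp
  thus False by simp
qed

lemma word_map_K: "\<sigma> \<in> lists (idx \<Phi>) \<Longrightarrow> y \<in> K \<Longrightarrow> S \<sigma> y \<in> K"
proof (induction \<sigma>)
  case (Cons i \<sigma>)
  hence "S \<sigma> y \<in> K" "i \<in> idx \<Phi>" by auto
  then show ?case using K_eq by auto
qed simp

section \<open>The words of a given generation\<close>

lemma words_at_lists: "\<sigma> \<in> \<Lambda> t \<Longrightarrow> \<sigma> \<in> lists (idx \<Phi>)"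
  by (simp add: words_at_def)

lemma words_at_gt_1: assumes "t > 1" shows "\<Lambda> t = {[]}"
proof -
  have "\<sigma> = []" if "\<sigma> \<in> \<Lambda> t" for \<sigma>
  proof (rule ccontr)
    assume "\<sigma> \<noteq> []"
    hence "t \<le> \<bar>\<rho> (butlast \<sigma>)\<bar>" using that by (simp add: words_at_def)
    moreover have "butlast \<sigma> \<in> lists (idx \<Phi>)"
      using words_at_lists[OF that] in_set_butlastD by (fastforce simp: in_lists_conv_set)
    ultimately show False using word_rat_le_1 assms by fastforce
  qed
  moreover have "[] \<in> \<Lambda> t" using assms by (simp add: words_at_def)
  ultimately show ?thesis by auto
qed

text \<open>Dropping the outermost letter divides the ratios of the word and of its nonempty
  prefixes by the same number, so the stopping rule persists with a rescaled threshold. For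
  \<open>t \<le> 1\<close> the empty word is excluded, hence there is a first letter to
  drop.\<close>

lemma words_at_rec:
  assumes "0 < t" "t \<le> 1"
  shows "\<Lambda> t = (\<Union>i\<in>idx \<Phi>. (#) i ` \<Lambda> (t / \<bar>rat \<Phi> i\<bar>))"
proof -
  have *: "i # \<sigma> \<in> \<Lambda> t \<longleftrightarrow> \<sigma> \<in> \<Lambda> (t / \<bar>rat \<Phi> i\<bar>)" if "i \<in> idx \<Phi>" for i \<sigma>
    using that rat_bounds[OF that] assms unfolding words_at_def
    by (auto simp: abs_mult field_simps)
  show ?thesis
  proof (rule Set.set_eqI)
    fix \<sigma>
    show "\<sigma> \<in> \<Lambda> t \<longleftrightarrow> \<sigma> \<in> (\<Union>i\<in>idx \<Phi>. (#) i ` \<Lambda> (t / \<bar>rat \<Phi> i\<bar>))"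
    proof (cases \<sigma>)
      case Nil
      then show ?thesis using assms by (auto simp: words_at_def)
    next
      case (Cons i \<tau>)
      have "i \<in> idx \<Phi>" if "\<sigma> \<in> \<Lambda> t" using words_at_lists[OF that] Cons by simp
      then show ?thesis using *[of i \<tau>] unfolding Cons by blast
    qed
  qed
qed

text \<open>Each recursion step enlarges the threshold at least by the factor \<open>1 / m\<close>,
  where \<open>m < 1\<close> is the largest contraction ratio, so it exceeds 1 after finitely many
  steps. The inner induction is on the number of steps.\<close>

lemma words_at_induct [consumes 1, case_names large small]:
  assumes "0 < t" and large: "\<And>t. 1 < t \<Longrightarrow> Q t"
    and small: "\<And>t. 0 < t \<Longrightarrow> t \<le> 1 \<Longrightarrow> (\<And>i. i \<in> idx \<Phi> \<Longrightarrow> Q (t / \<bar>rat \<Phi> i\<bar>)) \<Longrightarrow> Q t"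
  shows "Q t"
proof -
  define m where "m = Max ((\<lambda>i. \<bar>rat \<Phi> i\<bar>) ` idx \<Phi>)"
  have m: "\<bar>rat \<Phi> i\<bar> \<le> m" if "i \<in> idx \<Phi>" for i using that finite_idx by (simp add: m_def)
  have m1: "m < 1" unfolding m_def using finite_idx idx_nonempty rat_bounds by (subst Max_less_iff) auto
  have m0: "0 < m" using m rat_bounds(1) idx_nonempty by fastforce
  have "\<forall>t>0. m ^ n < t \<longrightarrow> Q t" for n
  proof (induction n)
    case (Suc n)
    show ?case
    proof (intro allI impI)
      fix t :: real assume t: "0 < t" "m ^ Suc n < t"
      show "Q t"
      proof (cases "t > 1")
        case False
        show ?thesis
        proof (rule small)
          fix i assume i: "i \<in> idx \<Phi>"
          have "m ^ n * \<bar>rat \<Phi> i\<bar> \<le> m ^ n * m" using m[OF i] m0 by (intro mult_left_mono) auto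
          hence "m ^ n * \<bar>rat \<Phi> i\<bar> < t" using t by (simp add: mult.commute)
          hence "m ^ n < t / \<bar>rat \<Phi> i\<bar>" using rat_bounds(1)[OF i] by (simp add: pos_less_divide_eq)
          thus "Q (t / \<bar>rat \<Phi> i\<bar>)" using Suc rat_bounds(1)[OF i] t by simp
        qed (use t False in auto)
      qed (use large in auto)
    qed
  qed (use large in auto)
  moreover obtain n where "m ^ n < t" using real_arch_pow_inv[OF assms(1) m1] by blast
  ultimately show ?thesis using assms(1) by blast
qed

lemma finite_words_at: "0 < t \<Longrightarrow> finite (\<Lambda> t)"
  by (induction t rule: words_at_induct) (use finite_idx in \<open>auto simp: words_at_gt_1 words_at_rec\<close>)

lemma words_at_cover:
  assumes "0 < t" "y \<in> K"
  shows "\<exists>\<sigma>\<in>\<Lambda> t. y \<in> S \<sigma> ` K"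
  using assms
proof (induction t arbitrary: y rule: words_at_induct)
  case (large t)
  then show ?case by (simp add: words_at_gt_1)
next
  case (small t)
  then obtain i z where iz: "i \<in> idx \<Phi>" "z \<in> K" "y = ifs_map \<Phi> i z" using K_eq by blast
  then obtain \<sigma> w where "\<sigma> \<in> \<Lambda> (t / \<bar>rat \<Phi> i\<bar>)" "w \<in> K" "z = S \<sigma> w" using small.IH by blast
  then show ?case using iz small.hyps by (intro bexI[of _ "i # \<sigma>"]) (auto simp: words_at_rec)
qed

lemma measure_self_similar:
  assumes "0 < t" "E \<in> sets borel"
  shows "measure \<mu> E = (\<Sum>\<sigma>\<in>\<Lambda> t. P \<sigma> * measure \<mu> (S \<sigma> -` E))"
  using assms
proof (induction t arbitrary: E rule: words_at_induct)
  case (large t)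
  then show ?case by (simp add: words_at_gt_1)
next
  case (small t)
  have fin: "finite (\<Lambda> (t / \<bar>rat \<Phi> i\<bar>))" if "i \<in> idx \<Phi>" for i
    using rat_bounds(1)[OF that] small.hyps by (intro finite_words_at) auto
  have "measure \<mu> E = (\<Sum>i\<in>idx \<Phi>. p i * measure \<mu> (ifs_map \<Phi> i -` E))"
    using self_similar small.prems by (simp add: self_similar_measure_def)
  also have "\<dots> = (\<Sum>i\<in>idx \<Phi>. \<Sum>\<sigma>\<in>\<Lambda> (t / \<bar>rat \<Phi> i\<bar>). P (i # \<sigma>) * measure \<mu> (S (i # \<sigma>) -` E))"
  proof (rule sum.cong[OF refl])
    fix i assume i: "i \<in> idx \<Phi>"
    have "ifs_map \<Phi> i -` E \<in> sets borel"
      using vimage_word_map_borel[OF small.prems, of \<Phi> "[i]"] by simp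
    from small.IH[OF i this]
    show "p i * measure \<mu> (ifs_map \<Phi> i -` E)
        = (\<Sum>\<sigma>\<in>\<Lambda> (t / \<bar>rat \<Phi> i\<bar>). P (i # \<sigma>) * measure \<mu> (S (i # \<sigma>) -` E))"
      by (simp add: sum_distrib_left mult.assoc vimage_comp)
  qed
  also have "\<dots> = (\<Sum>i\<in>idx \<Phi>. \<Sum>\<sigma>\<in>(#) i ` \<Lambda> (t / \<bar>rat \<Phi> i\<bar>). P \<sigma> * measure \<mu> (S \<sigma> -` E))"
    by (rule sum.cong[OF refl], subst sum.reindex) (auto intro!: inj_onI)
  also have "\<dots> = (\<Sum>\<sigma>\<in>\<Lambda> t. P \<sigma> * measure \<mu> (S \<sigma> -` E))"
    unfolding words_at_rec[OF small.hyps(1,2)] using finite_idx fin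
    by (subst sum.UNION_disjoint) auto
  finally show ?case .
qed

text \<open>The hypothesis \<open>t' \<le> t\<close> matters for empty \<open>\<tau>\<close>: the
  condition on the parent of \<open>\<sigma>\<close> is known for \<open>t\<close> and has to be
  carried over to \<open>t'\<close>.\<close>

lemma words_at_append_iff:
  assumes "\<sigma> \<in> \<Lambda> t" "0 < t'" "t' \<le> t"
  shows "\<sigma> @ \<tau> \<in> \<Lambda> t' \<longleftrightarrow> \<tau> \<in> \<Lambda> (t' / \<bar>\<rho> \<sigma>\<bar>)"
proof -
  have "0 < \<bar>\<rho> \<sigma>\<bar>" using assms(1) words_at_lists word_rat_pos by blast
  then show ?thesis using assms unfolding words_at_def
    by (cases "\<tau> = []") (auto simp: abs_mult butlast_append field_simps)
qed

lemma words_at_1: "\<Lambda> 1 = (\<lambda>i. [i]) ` idx \<Phi>"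
proof -
  have "\<Lambda> (1 / \<bar>rat \<Phi> i\<bar>) = {[]}" if "i \<in> idx \<Phi>" for i
    using rat_bounds[OF that] by (intro words_at_gt_1) auto
  then show ?thesis by (subst words_at_rec) (auto simp: image_iff)
qed

lemma words_at_antichain:
  assumes "\<sigma> \<in> \<Lambda> t" "\<sigma> @ \<tau> \<in> \<Lambda> t" "0 < t"
  shows "\<tau> = []"
proof -
  have "\<tau> \<in> \<Lambda> (t / \<bar>\<rho> \<sigma>\<bar>)" using words_at_append_iff[of \<sigma> t t \<tau>] assms by simp
  moreover have "t / \<bar>\<rho> \<sigma>\<bar> > 1"
    using assms(1) word_rat_pos[of \<sigma>] by (simp add: words_at_def field_simps)
  ultimately show ?thesis using words_at_gt_1 by auto
qed

lemma words_at_prefix: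
  assumes "\<tau> \<in> \<Lambda> t'" "0 < t'" "t' \<le> t"
  shows "\<exists>\<sigma> \<tau>'. \<tau> = \<sigma> @ \<tau>' \<and> \<sigma> \<in> \<Lambda> t"
proof -
  define k where "k = (LEAST k. \<bar>\<rho> (take k \<tau>)\<bar> < t)"
  have "\<bar>\<rho> (take (length \<tau>) \<tau>)\<bar> < t" using assms by (simp add: words_at_def)
  hence k: "\<bar>\<rho> (take k \<tau>)\<bar> < t" and kl: "k \<le> length \<tau>"
    unfolding k_def by (rule LeastI, rule Least_le)
  have "take k \<tau> = [] \<or> t \<le> \<bar>\<rho> (butlast (take k \<tau>))\<bar>"
  proof (cases k)
    case (Suc j)
    hence "\<not> \<bar>\<rho> (take j \<tau>)\<bar> < t" using not_less_Least[of j "\<lambda>k. \<bar>\<rho> (take k \<tau>)\<bar> < t"] k_def by simp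
    moreover have "butlast (take k \<tau>) = take j \<tau>" using Suc kl by (simp add: butlast_take)
    ultimately show ?thesis by simp
  qed simp
  moreover have "take k \<tau> \<in> lists (idx \<Phi>)"
    using words_at_lists[OF assms(1)] by (auto simp: in_lists_conv_set dest: in_set_takeD)
  ultimately have "take k \<tau> \<in> \<Lambda> t" using k by (auto simp: words_at_def)
  thus ?thesis by (metis append_take_drop_id)
qed

section \<open>Basic properties of the measure\<close>

lemma infdist_word_map:
  assumes "\<sigma> \<in> lists (idx \<Phi>)"
  shows "infdist (S \<sigma> y) K \<le> \<bar>\<rho> \<sigma>\<bar> * infdist y K"
proof -
  obtain z where z: "z \<in> K" "infdist y K = dist y z"
    using infdist_attains_inf[OF compact_imp_closed[OF compact_K] K_nonempty] by blast
  have "infdist (S \<sigma> y) K \<le> dist (S \<sigma> y) (S \<sigma> z)"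
    using word_map_K[OF assms z(1)] by (rule infdist_le)
  thus ?thesis by (simp add: z word_map_dist)
qed

lemma sum_P: assumes "0 < t" shows "(\<Sum>\<sigma>\<in>\<Lambda> t. P \<sigma>) = 1"
  using measure_self_similar[OF assms, of UNIV] prob_space by simp

lemma open_infdist_gt: "open {x. infdist x K > \<epsilon>}"
  by (intro open_Collect_less continuous_intros)

text \<open>The maps send K into itself, so inverse branches along words of small ratio push points
  off K arbitrarily far away. Thus the mass at distance beyond \<open>\<epsilon>\<close> is at most
  the mass at distance beyond \<open>n\<close>, for every \<open>n\<close>, and the latter tends to
  0.\<close>

lemma measure_away_K:
  assumes "\<epsilon> > 0"
  shows "measure \<mu> {x. infdist x K > \<epsilon>} = 0"
proof -
  define E where "E = (\<lambda>\<epsilon>. {x. infdist x K > \<epsilon>})"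
  have E: "E \<epsilon> \<in> sets borel" for \<epsilon> unfolding E_def using open_infdist_gt by simp
  have le: "measure \<mu> (E \<epsilon>) \<le> measure \<mu> (E (real n))" for n
  proof (cases "n = 0")
    case True
    then show ?thesis using assms E by (auto intro!: finite_measure_mono simp: E_def)
  next
    case False
    \<comment> \<open>Words of ratio below \<open>\<epsilon> / n\<close> pull distances beyond
      \<open>\<epsilon>\<close> back to distances beyond \<open>n\<close>.\<close>
    define t where "t = \<epsilon> / real n"
    have t: "t > 0" using False assms by (simp add: t_def)
    have "measure \<mu> (E \<epsilon>) = (\<Sum>\<sigma>\<in>\<Lambda> t. P \<sigma> * measure \<mu> (S \<sigma> -` E \<epsilon>))"
      by (rule measure_self_similar[OF t E])
    also have "\<dots> \<le> (\<Sum>\<sigma>\<in>\<Lambda> t. P \<sigma> * measure \<mu> (E (real n)))"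
    proof (intro sum_mono mult_left_mono finite_measure_mono)
      fix \<sigma> assume \<sigma>: "\<sigma> \<in> \<Lambda> t"
      show "S \<sigma> -` E \<epsilon> \<subseteq> E (real n)"
      proof
        fix y assume "y \<in> S \<sigma> -` E \<epsilon>"
        hence "\<epsilon> < \<bar>\<rho> \<sigma>\<bar> * infdist y K"
          using infdist_word_map[OF words_at_lists[OF \<sigma>], of y] by (simp add: E_def)
        also have "\<dots> \<le> t * infdist y K"
          using \<sigma> by (intro mult_right_mono) (auto simp: words_at_def infdist_nonneg)
        finally show "y \<in> E (real n)" using False assms by (simp add: t_def E_def field_simps)
      qed
    qed (use E P_pos words_at_lists in \<open>auto simp: less_imp_le\<close>)
    also have "\<dots> = measure \<mu> (E (real n))"
      by (simp add: sum_P[OF t] flip: sum_distrib_right)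
    finally show ?thesis .
  qed
  have "(\<lambda>n. measure \<mu> (E (real n))) \<longlonglongrightarrow> measure \<mu> (\<Inter>n. E (real n))"
    using E by (intro finite_Lim_measure_decseq) (auto simp: decseq_def E_def)
  moreover have "(\<Inter>n. E (real n)) = {}"
  proof -
    have "\<exists>n. x \<notin> E (real n)" for x
      using real_arch_simple[of "infdist x K"] by (auto simp: E_def not_less)
    thus ?thesis by blast
  qed
  ultimately have "(\<lambda>n. measure \<mu> (E (real n))) \<longlonglongrightarrow> 0" by simp
  hence "measure \<mu> (E \<epsilon>) \<le> 0" by (rule LIMSEQ_le_const) (use le in auto)
  thus ?thesis by (simp add: E_def measure_le_0_iff)
qed

lemma measure_outside_K:
  assumes "E \<in> sets borel" "E \<inter> K = {}"
  shows "measure \<mu> E = 0"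
proof -
  define F where "F = (\<lambda>n. {x. infdist x K > 1 / real (Suc n)})"
  have F: "F n \<in> null_sets \<mu>" for n
    using measure_away_K[of "1 / real (Suc n)"] open_infdist_gt[of "1 / real (Suc n)"]
    by (auto simp: F_def null_sets_def emeasure_eq_measure)
  have "E \<subseteq> (\<Union>n. F n)"
  proof
    fix x assume "x \<in> E"
    hence "x \<notin> K" using assms by auto
    hence "infdist x K > 0"
      using infdist_pos_not_in_closed[OF compact_imp_closed[OF compact_K] K_nonempty] by blast
    then obtain n where "1 / real (Suc n) < infdist x K"
      using reals_Archimedean by (auto simp: inverse_eq_divide)
    thus "x \<in> (\<Union>n. F n)" by (auto simp: F_def)
  qed
  moreover have "(\<Union>n. F n) \<in> null_sets \<mu>" using F by blast
  ultimately have "E \<in> null_sets \<mu>" using assms by (auto intro: null_sets_subset)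
  thus ?thesis by (simp add: measure_eq_0_null_sets)
qed

lemma measure_K_superset:
  assumes "E \<in> sets borel" "K \<subseteq> E"
  shows "measure \<mu> E = 1"
  using measure_outside_K[of "- E"] prob_compl[of E] assms by (auto simp: Compl_eq_Diff_UNIV)

text \<open>K has diameter at most 1, so a cylinder around a point of U at a scale below the radius
  of a ball inside U maps all of K into U. The weight of its word is then a lower bound.\<close>

lemma measure_open_pos:
  assumes "open U" "U \<inter> K \<noteq> {}"
  shows "0 < measure \<mu> U"
proof -
  obtain y where y: "y \<in> U" "y \<in> K" using assms by auto
  then obtain \<epsilon> where \<epsilon>: "\<epsilon> > 0" "ball y \<epsilon> \<subseteq> U" using assms openE by blast
  obtain \<sigma> z where \<sigma>: "\<sigma> \<in> \<Lambda> \<epsilon>" "z \<in> K" "y = S \<sigma> z" using words_at_cover[OF \<epsilon>(1) y(2)] by blast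
  have "K \<subseteq> S \<sigma> -` U"
  proof
    fix k assume k: "k \<in> K"
    have "z \<in> {0..1}" "k \<in> {0..1}" using k \<sigma>(2) K_subset by auto
    hence "dist z k \<le> 1" by (auto simp: dist_real_def)
    hence "dist y (S \<sigma> k) \<le> \<bar>\<rho> \<sigma>\<bar> * 1" unfolding \<sigma>(3) word_map_dist by (intro mult_left_mono) auto
    also have "\<dots> < \<epsilon>" using \<sigma>(1) by (simp add: words_at_def)
    finally show "k \<in> S \<sigma> -` U" using \<epsilon>(2) by auto
  qed
  hence 1: "measure \<mu> (S \<sigma> -` U) = 1" using assms(1)
    by (intro measure_K_superset vimage_word_map_borel) auto
  have "P \<sigma> * measure \<mu> (S \<sigma> -` U) \<le> measure \<mu> U"
    unfolding measure_self_similar[OF \<epsilon>(1) borel_open[OF assms(1)]]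
    using finite_words_at[OF \<epsilon>(1)] P_pos words_at_lists
    by (intro member_le_sum[OF \<sigma>(1)]) (auto simp: less_imp_le)
  thus ?thesis using 1 P_pos[OF words_at_lists[OF \<sigma>(1)]] by simp
qed

text \<open>Consider a point of K farthest from a common fixed point \<open>a\<close>. It is the
  image of some point of K that is no farther away, under a map contracting distances to
  \<open>a\<close>; so the farthest distance is 0 and K would be \<open>{a}\<close>.\<close>

lemma no_common_fixed_point: "\<exists>i\<in>idx \<Phi>. ifs_map \<Phi> i a \<noteq> a"
proof (rule ccontr)
  assume "\<not> ?thesis"
  hence fp: "\<And>i. i \<in> idx \<Phi> \<Longrightarrow> ifs_map \<Phi> i a = a" by blast
  obtain y where y: "y \<in> K" "\<And>z. z \<in> K \<Longrightarrow> dist a z \<le> dist a y"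
    using distance_attains_sup[OF compact_K K_nonempty] by blast
  obtain i z where iz: "i \<in> idx \<Phi>" "z \<in> K" "y = ifs_map \<Phi> i z" using K_eq y(1) by blast
  have "dist a y = \<bar>rat \<Phi> i\<bar> * dist a z"
    using word_map_dist[of \<Phi> "[i]" a z] fp[OF iz(1)] iz(3) by simp
  also have "\<dots> \<le> \<bar>rat \<Phi> i\<bar> * dist a y" using y(2)[OF iz(2)] by (intro mult_left_mono) auto
  finally have "dist a y * (1 - \<bar>rat \<Phi> i\<bar>) \<le> 0" by (simp add: algebra_simps)
  hence "dist a y \<le> 0" using rat_bounds(2)[OF iz(1)] by (simp add: mult_le_0_iff)
  hence "\<And>z. z \<in> K \<Longrightarrow> z = a" using y(2) by force
  hence "K = {a}" using K_nonempty by blast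
  thus False using not_singleton by blast
qed

text \<open>The set of atoms of maximal mass is finite and closed under the inverse branches. As these
  are expansions, it only consists of the fixed point of each of them.\<close>

lemma measure_singleton: "measure \<mu> {x} = 0"
proof (rule ccontr)
  assume "measure \<mu> {x} \<noteq> 0"
  hence x: "measure \<mu> {x} > 0" by (simp add: less_le)
  \<comment> \<open>Atoms of at least this mass number at most \<open>1 / measure \<mu> {x}\<close>,
    which makes the maximal atom exist.\<close>
  define B where "B = {y. measure \<mu> {y} \<ge> measure \<mu> {x}}"
  have "finite B"
  proof (rule ccontr)
    assume inf: "infinite B"
    obtain n where n: "1 / measure \<mu> {x} < real n" using reals_Archimedean2 by blast
    obtain F where F: "F \<subseteq> B" "finite F" "card F = n" using infinite_arbitrarily_large[OF inf] by blast
    have "real n * measure \<mu> {x} \<le> (\<Sum>y\<in>F. measure \<mu> {y})"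
      using sum_bounded_below[of F "measure \<mu> {x}" "\<lambda>y. measure \<mu> {y}"] F by (auto simp: B_def)
    also have "\<dots> = measure \<mu> F" using F(2) by (subst finite_measure_eq_sum_singleton[of F]) auto
    also have "\<dots> \<le> 1" by simp
    finally show False using n x by (simp add: field_simps)
  qed
  define m where "m = Max ((\<lambda>y. measure \<mu> {y}) ` B)"
  define A where "A = {y. measure \<mu> {y} = m}"
  have xB: "x \<in> B" by (simp add: B_def)
  have m_ge: "measure \<mu> {y} \<le> m" for y
  proof (cases "y \<in> B")
    case True
    then show ?thesis unfolding m_def using \<open>finite B\<close> by auto
  next
    case False
    hence "measure \<mu> {y} \<le> measure \<mu> {x}" by (simp add: B_def)
    also have "\<dots> \<le> m" unfolding m_def using \<open>finite B\<close> xB by auto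
    finally show ?thesis .
  qed
  have "A \<subseteq> B" using m_ge[of x] by (auto simp: A_def B_def)
  hence finA: "finite A" using \<open>finite B\<close> finite_subset by blast
  have "m \<in> (\<lambda>y. measure \<mu> {y}) ` B" unfolding m_def using \<open>finite B\<close> xB by (intro Max_in) auto
  then obtain a where a: "a \<in> A" by (auto simp: A_def)
  have inv: "(y - trl \<Phi> i) / rat \<Phi> i \<in> A" if y: "y \<in> A" and i: "i \<in> idx \<Phi>" for y i
  proof -
    have vim: "ifs_map \<Phi> j -` {y} = {(y - trl \<Phi> j) / rat \<Phi> j}" if "j \<in> idx \<Phi>" for j
      using rat_bounds(1)[OF that] by (auto simp: ifs_map_def field_simps)
    have eq: "(\<Sum>j\<in>idx \<Phi>. p j * m) = (\<Sum>j\<in>idx \<Phi>. p j * measure \<mu> {(y - trl \<Phi> j) / rat \<Phi> j})"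
    proof -
      have "(\<Sum>j\<in>idx \<Phi>. p j * m) = m" using weights by (simp add: prob_weights_def flip: sum_distrib_right)
      also have "\<dots> = measure \<mu> {y}" using y by (simp add: A_def)
      also have "\<dots> = (\<Sum>j\<in>idx \<Phi>. p j * measure \<mu> (ifs_map \<Phi> j -` {y}))"
        using self_similar by (simp add: self_similar_measure_def)
      finally show ?thesis using vim by simp
    qed
    \<comment> \<open>Here \<open>m\<close> is an average, with positive weights, of numbers not
      exceeding \<open>m\<close>; so each of them equals \<open>m\<close>.\<close>
    have "p i * m = p i * measure \<mu> {(y - trl \<Phi> i) / rat \<Phi> i}"
      by (rule sum_mono_inv[OF eq[symmetric] _ i finite_idx, symmetric])
        (use m_ge weights in \<open>auto simp: prob_weights_def intro!: mult_left_mono less_imp_le\<close>)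
    thus ?thesis using i weights by (auto simp: A_def prob_weights_def)
  qed
  have fixed: "ifs_map \<Phi> i y = y" if y: "y \<in> A" and i: "i \<in> idx \<Phi>" for i y
  proof -
    \<comment> \<open>The fixed point of the map. Its inverse branch enlarges distances to
      \<open>c\<close> by the factor \<open>1 / |rat i|\<close>, so the point of \<open>A\<close>
      farthest from \<open>c\<close> can only be \<open>c\<close>.\<close>
    define c where "c = trl \<Phi> i / (1 - rat \<Phi> i)"
    have r: "rat \<Phi> i \<noteq> 0" "rat \<Phi> i \<noteq> 1" "\<bar>rat \<Phi> i\<bar> < 1" using rat_bounds[OF i] by auto
    have "finite ((\<lambda>y. \<bar>y - c\<bar>) ` A)" "(\<lambda>y. \<bar>y - c\<bar>) ` A \<noteq> {}" using finA a by auto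
    from Max_in[OF this] obtain z where z: "z \<in> A" "Max ((\<lambda>y. \<bar>y - c\<bar>) ` A) = \<bar>z - c\<bar>" by auto
    have zmax: "\<bar>y - c\<bar> \<le> \<bar>z - c\<bar>" if "y \<in> A" for y
      unfolding z(2)[symmetric] using finA that by auto
    have "(z - trl \<Phi> i) / rat \<Phi> i - c = (z - c) / rat \<Phi> i"
      using r by (simp add: c_def field_simps)
    hence "\<bar>z - c\<bar> / \<bar>rat \<Phi> i\<bar> \<le> \<bar>z - c\<bar>" using zmax[OF inv[OF z(1) i]] by (simp add: abs_divide)
    hence "\<bar>z - c\<bar> * (1 - \<bar>rat \<Phi> i\<bar>) \<le> 0" using r by (simp add: field_simps)
    hence "\<bar>z - c\<bar> \<le> 0" using r by (simp add: mult_le_0_iff)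
    hence "y = c" using zmax[OF y] by simp
    thus ?thesis using r by (simp add: ifs_map_def c_def field_simps)
  qed
  show False using no_common_fixed_point[of a] fixed[OF a] by blast
qed

end

section \<open>Neighbours as affine maps\<close>

text \<open>The scale-free part of \<open>tg\<close>: the transition generation is the diameter
  times this number, so it depends on the net interval only through its diameter and its neighbour
  set.\<close>

definition slope_max :: "(real \<Rightarrow> real) set \<Rightarrow> real" where
  "slope_max V = Max ((\<lambda>f. \<bar>f 1 - f 0\<bar>) ` V)"

definition rel_diam :: "gen_ivl \<Rightarrow> gen_ivl \<Rightarrow> real" where
  "rel_diam \<Delta> \<Delta>' = diam_ivl \<Delta>' / diam_ivl \<Delta>"

lemma generates_unique: "generates \<Phi> K \<Delta> \<sigma> f \<Longrightarrow> generates \<Phi> K \<Delta> \<sigma> f' \<Longrightarrow> f = f'"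
  by (simp add: generates_def)

lemma diam_pos: "net_interval \<Phi> K \<Delta> \<Longrightarrow> 0 < diam_ivl \<Delta>"
  by (simp add: net_interval_def diam_ivl_def)

lemma inv_ivl_map:
  assumes "0 < diam_ivl \<Delta>"
  shows "inv_into UNIV (ivl_map \<Delta>) y = (y - lft \<Delta>) / diam_ivl \<Delta>"
proof (rule inv_f_eq)
  show "inj (ivl_map \<Delta>)" using assms by (auto simp: ivl_map_def inj_def)
  show "ivl_map \<Delta> ((y - lft \<Delta>) / diam_ivl \<Delta>) = y" using assms by (simp add: ivl_map_def)
qed

lemma generates_iff:
  assumes "0 < diam_ivl \<Delta>"
  shows "generates \<Phi> K \<Delta> \<sigma> f \<longleftrightarrow> \<sigma> \<in> words_at \<Phi> (gen \<Delta>) \<and>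
     word_map \<Phi> \<sigma> ` K \<inter> {lft \<Delta><..<rgt \<Delta>} \<noteq> {} \<and> (\<forall>x. ivl_map \<Delta> (f x) = word_map \<Phi> \<sigma> x)"
proof -
  have "f = inv_into UNIV (ivl_map \<Delta>) \<circ> word_map \<Phi> \<sigma> \<longleftrightarrow> (\<forall>x. ivl_map \<Delta> (f x) = word_map \<Phi> \<sigma> x)"
    using assms by (auto simp: fun_eq_iff inv_ivl_map ivl_map_def field_simps)
  thus ?thesis by (simp add: generates_def)
qed

lemma generates_slope:
  assumes "0 < diam_ivl \<Delta>" "generates \<Phi> K \<Delta> \<sigma> f"
  shows "diam_ivl \<Delta> * (f x - f y) = word_rat \<Phi> \<sigma> * (x - y)"
proof -
  have "ivl_map \<Delta> (f x) - ivl_map \<Delta> (f y) = word_rat \<Phi> \<sigma> * (x - y)"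
    using assms by (simp add: generates_iff word_map_diff)
  thus ?thesis by (simp add: ivl_map_def algebra_simps)
qed

lemma nbs_affine:
  assumes "0 < diam_ivl \<Delta>" "f \<in> nbs \<Phi> K \<Delta>"
  shows "f = (\<lambda>x. (f 1 - f 0) * x + f 0)"
proof
  fix x
  obtain \<sigma> where \<sigma>: "generates \<Phi> K \<Delta> \<sigma> f" using assms by (auto simp: nbs_def)
  have "diam_ivl \<Delta> * (f x - f 0) = diam_ivl \<Delta> * ((f 1 - f 0) * x)"
    using generates_slope[OF assms(1) \<sigma>, of x 0] generates_slope[OF assms(1) \<sigma>, of 1 0]
    by (simp add: mult.assoc[symmetric])
  hence "f x - f 0 = (f 1 - f 0) * x" using assms(1) by (metis mult_cancel_left less_irrefl)
  thus "f x = (f 1 - f 0) * x + f 0" by simp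
qed

context self_similar_setup
begin

abbreviation "net \<equiv> net_interval \<Phi> K"
abbreviation "V \<equiv> nbs \<Phi> K"
abbreviation "generated \<equiv> generates \<Phi> K"
abbreviation "child \<equiv> child_of \<Phi> K"
abbreviation "TG \<equiv> tg \<Phi> K"

section \<open>End points and net intervals\<close>

text \<open>Both 0 and 1 are extreme points of the hull and lie in the image of K under some word of
  the generation. This image stays in \<open>[0,1]\<close>, and an affine map can reach an extreme
  point only from an end point.\<close>

lemma end_pts_01:
  assumes "0 < t" "z = 0 \<or> z = 1"
  shows "z \<in> end_pts \<Phi> t"
proof -
  have "z \<in> K" using assms zero_in_K one_in_K by auto
  then obtain \<sigma> y where \<sigma>: "\<sigma> \<in> \<Lambda> t" "y \<in> K" "z = S \<sigma> y" using words_at_cover[OF assms(1)] by blast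
  have K01: "S \<sigma> 0 \<in> {0..1}" "S \<sigma> 1 \<in> {0..1}" "y \<in> {0..1}"
    using word_map_K[OF words_at_lists[OF \<sigma>(1)]] zero_in_K one_in_K K_subset \<sigma>(2) by blast+
  have r: "\<rho> \<sigma> \<noteq> 0" using word_rat_pos[OF words_at_lists[OF \<sigma>(1)]] by auto
  have z: "z = \<rho> \<sigma> * y + S \<sigma> 0" and one: "S \<sigma> 1 = \<rho> \<sigma> + S \<sigma> 0"
    using word_map_eq[of \<Phi> \<sigma> y] word_map_eq[of \<Phi> \<sigma> 1] \<sigma>(3) by auto
  have "y = 0 \<or> y = 1"
  proof (rule ccontr)
    assume "\<not> ?thesis"
    hence y: "0 < y" "y < 1" using K01 by auto
    \<comment> \<open>From an interior \<open>y\<close> the value \<open>z\<close> would lie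
      strictly between \<open>S \<sigma> 0\<close> and \<open>S \<sigma> 1\<close>, hence strictly
      inside \<open>[0,1]\<close>.\<close>
    have "(0 < \<rho> \<sigma> * y \<and> \<rho> \<sigma> * y < \<rho> \<sigma>) \<or> (\<rho> \<sigma> < \<rho> \<sigma> * y \<and> \<rho> \<sigma> * y < 0)"
    proof (cases "\<rho> \<sigma> > 0")
      case True
      then show ?thesis using y by (simp)
    next
      case False
      hence "\<rho> \<sigma> < 0" using r by simp
      then show ?thesis using y by (auto simp: mult_less_0_iff)
    qed
    thus False using z one K01 assms(2) by auto
  qed
  thus ?thesis using \<sigma> unfolding end_pts_def by auto
qed

text \<open>An end point \<open>S \<sigma> z\<close> with \<open>z\<close> in \<open>{0,1}\<close>
  stays an end point after refining \<open>\<sigma>\<close>, since \<open>z\<close> itself is an end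
  point of the rescaled generation. Hence net intervals are subdivided by their children.\<close>

lemma end_pts_antimono:
  assumes "0 < t'" "t' \<le> t"
  shows "end_pts \<Phi> t \<subseteq> end_pts \<Phi> t'"
proof
  fix h assume "h \<in> end_pts \<Phi> t"
  then obtain \<sigma> z where \<sigma>: "\<sigma> \<in> \<Lambda> t" "z = 0 \<or> z = 1" "h = S \<sigma> z" by (auto simp: end_pts_def)
  have "0 < t' / \<bar>\<rho> \<sigma>\<bar>" using word_rat_pos[OF words_at_lists[OF \<sigma>(1)]] assms by simp
  from end_pts_01[OF this \<sigma>(2)] obtain \<tau> z' where
    \<tau>: "\<tau> \<in> \<Lambda> (t' / \<bar>\<rho> \<sigma>\<bar>)" "z' = 0 \<or> z' = 1" "z = S \<tau> z'" by (auto simp: end_pts_def)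
  have "\<sigma> @ \<tau> \<in> \<Lambda> t'" using words_at_append_iff[OF \<sigma>(1) assms] \<tau>(1) by simp
  moreover have "h = S (\<sigma> @ \<tau>) z'" using \<sigma>(3) \<tau>(3) by (simp add: word_map_append)
  ultimately show "h \<in> end_pts \<Phi> t'" using \<tau>(2) unfolding end_pts_def by blast
qed

lemma finite_end_pts: "0 < t \<Longrightarrow> finite (end_pts \<Phi> t)"
  unfolding end_pts_def using finite_words_at by blast

lemma nbs_subset: "V \<Delta> \<subseteq> (\<lambda>\<sigma>. inv_into UNIV (ivl_map \<Delta>) \<circ> S \<sigma>) ` \<Lambda> (gen \<Delta>)"
  by (auto simp: nbs_def generates_def)

lemma finite_nbs: "net \<Delta> \<Longrightarrow> finite (V \<Delta>)"
  using finite_subset[OF nbs_subset] finite_words_at by (auto simp: net_interval_def)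

lemma nbs_nonempty:
  assumes "net \<Delta>"
  shows "V \<Delta> \<noteq> {}"
proof -
  obtain y where y: "y \<in> K" "y \<in> {lft \<Delta><..<rgt \<Delta>}" using assms unfolding net_interval_def by blast
  obtain \<sigma> where "\<sigma> \<in> \<Lambda> (gen \<Delta>)" "y \<in> S \<sigma> ` K"
    using words_at_cover[of "gen \<Delta>" y] assms y by (auto simp: net_interval_def)
  hence "generated \<Delta> \<sigma> (inv_into UNIV (ivl_map \<Delta>) \<circ> S \<sigma>)" using y by (auto simp: generates_def)
  thus ?thesis by (auto simp: nbs_def)
qed

lemma generates_rat_pos: "generated \<Delta> \<sigma> f \<Longrightarrow> 0 < \<bar>\<rho> \<sigma>\<bar>"
  using word_rat_pos words_at_lists by (auto simp: generates_def)

text \<open>The image of \<open>[0,1]\<close> under \<open>\<sigma>\<close> meets the interior of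
  \<open>\<Delta>\<close> but neither of its ends lies there, so it covers
  \<open>\<Delta>\<close>.\<close>

lemma diam_le_word_rat:
  assumes "net \<Delta>" "generated \<Delta> \<sigma> f"
  shows "diam_ivl \<Delta> \<le> \<bar>\<rho> \<sigma>\<bar>"
proof -
  obtain k where k: "k \<in> K" "S \<sigma> k \<in> {lft \<Delta><..<rgt \<Delta>}" using assms(2) unfolding generates_def by blast
  have "S \<sigma> 0 \<in> end_pts \<Phi> (gen \<Delta>)" "S \<sigma> 1 \<in> end_pts \<Phi> (gen \<Delta>)"
    using assms(2) by (auto simp: generates_def end_pts_def)
  hence ends: "S \<sigma> 0 \<notin> {lft \<Delta><..<rgt \<Delta>}" "S \<sigma> 1 \<notin> {lft \<Delta><..<rgt \<Delta>}"
    using assms(1) unfolding net_interval_def by blast+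
  have k01: "0 \<le> k" "k \<le> 1" using k(1) K_subset by auto
  define m where "m = \<rho> \<sigma> * k"
  have eqs: "S \<sigma> k = m + S \<sigma> 0" "S \<sigma> 1 = \<rho> \<sigma> + S \<sigma> 0"
    using word_map_eq[of \<Phi> \<sigma> k] word_map_eq[of \<Phi> \<sigma> 1] by (auto simp: m_def)
  show ?thesis
  proof (cases "\<rho> \<sigma> \<ge> 0")
    case True
    hence "0 \<le> m" "m \<le> \<rho> \<sigma>" using k01 by (auto simp: m_def mult_left_le)
    thus ?thesis using k(2) ends eqs True by (auto simp: diam_ivl_def)
  next
    case False
    hence "m \<le> 0" "\<rho> \<sigma> \<le> m" using k01 mult_left_le[of k "- \<rho> \<sigma>"]
      by (auto simp: m_def mult_le_0_iff)
    thus ?thesis using k(2) ends eqs False by (auto simp: diam_ivl_def)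
  qed
qed

lemma diam_less_gen:
  assumes "net \<Delta>"
  shows "diam_ivl \<Delta> < gen \<Delta>"
proof -
  obtain \<sigma> f where "generated \<Delta> \<sigma> f" using nbs_nonempty[OF assms] by (auto simp: nbs_def)
  thus ?thesis using diam_le_word_rat[OF assms, of \<sigma> f] by (simp add: generates_def words_at_def)
qed

lemma tg_eq:
  assumes "net \<Delta>"
  shows "TG \<Delta> = diam_ivl \<Delta> * slope_max (V \<Delta>)"
proof -
  have "{\<bar>R\<bar> | R a. (\<lambda>x. R * x + a) \<in> V \<Delta>} = (\<lambda>f. \<bar>f 1 - f 0\<bar>) ` V \<Delta>"
  proof (intro equalityI subsetI)
    fix y assume "y \<in> {\<bar>R\<bar> | R a. (\<lambda>x. R * x + a) \<in> V \<Delta>}"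
    then obtain R a where "y = \<bar>R\<bar>" "(\<lambda>x. R * x + a) \<in> V \<Delta>" by auto
    thus "y \<in> (\<lambda>f. \<bar>f 1 - f 0\<bar>) ` V \<Delta>" by (intro image_eqI) auto
  next
    fix y assume "y \<in> (\<lambda>f. \<bar>f 1 - f 0\<bar>) ` V \<Delta>"
    then obtain f where f: "f \<in> V \<Delta>" "y = \<bar>f 1 - f 0\<bar>" by auto
    have "(\<lambda>x. (f 1 - f 0) * x + f 0) \<in> V \<Delta>" using nbs_affine[OF diam_pos[OF assms] f(1)] f(1) by simp
    thus "y \<in> {\<bar>R\<bar> | R a. (\<lambda>x. R * x + a) \<in> V \<Delta>}" using f(2) by blast
  qed
  thus ?thesis by (simp add: tg_def slope_max_def)
qed

lemma generates_abs_slope: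
  assumes "net \<Delta>" "generated \<Delta> \<sigma> f"
  shows "diam_ivl \<Delta> * \<bar>f 1 - f 0\<bar> = \<bar>\<rho> \<sigma>\<bar>"
proof -
  have "\<bar>diam_ivl \<Delta> * (f 1 - f 0)\<bar> = \<bar>\<rho> \<sigma>\<bar>"
    using generates_slope[OF diam_pos[OF assms(1)] assms(2), of 1 0] by simp
  thus ?thesis using diam_pos[OF assms(1)] by (simp add: abs_mult)
qed

lemma nbs_slope_pos:
  assumes "net \<Delta>" "f \<in> V \<Delta>"
  shows "0 < \<bar>f 1 - f 0\<bar>"
proof -
  obtain \<sigma> where \<sigma>: "generated \<Delta> \<sigma> f" using assms(2) by (auto simp: nbs_def)
  show ?thesis using generates_abs_slope[OF assms(1) \<sigma>] generates_rat_pos[OF \<sigma>] by auto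
qed

lemma slope_max_ge:
  assumes "net \<Delta>" "f \<in> V \<Delta>"
  shows "\<bar>f 1 - f 0\<bar> \<le> slope_max (V \<Delta>)"
  unfolding slope_max_def using finite_nbs assms by auto

lemma slope_max_attained:
  assumes "net \<Delta>"
  shows "\<exists>f\<in>V \<Delta>. slope_max (V \<Delta>) = \<bar>f 1 - f 0\<bar>"
proof -
  have "slope_max (V \<Delta>) \<in> (\<lambda>f. \<bar>f 1 - f 0\<bar>) ` V \<Delta>" unfolding slope_max_def
    using finite_nbs[OF assms] nbs_nonempty[OF assms] by (intro Max_in) auto
  thus ?thesis by auto
qed

lemma slope_max_pos: "net \<Delta> \<Longrightarrow> 0 < slope_max (V \<Delta>)"
  using slope_max_attained nbs_slope_pos by fastforce

lemma tg_attained: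
  assumes "net \<Delta>"
  shows "\<exists>\<sigma> f. generated \<Delta> \<sigma> f \<and> TG \<Delta> = \<bar>\<rho> \<sigma>\<bar>"
proof -
  obtain f where f: "f \<in> V \<Delta>" "slope_max (V \<Delta>) = \<bar>f 1 - f 0\<bar>" using slope_max_attained[OF assms] by blast
  then obtain \<sigma> where \<sigma>: "generated \<Delta> \<sigma> f" by (auto simp: nbs_def)
  thus ?thesis using generates_abs_slope[OF assms \<sigma>] tg_eq[OF assms] f(2) by auto
qed

lemma tg_bounds: assumes "net \<Delta>" shows "0 < TG \<Delta>" "TG \<Delta> < gen \<Delta>"
proof -
  obtain \<sigma> f where \<sigma>: "generated \<Delta> \<sigma> f" "TG \<Delta> = \<bar>\<rho> \<sigma>\<bar>" using tg_attained[OF assms] by blast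
  show "0 < TG \<Delta>" using generates_rat_pos[OF \<sigma>(1)] \<sigma>(2) by simp
  show "TG \<Delta> < gen \<Delta>" using \<sigma> by (simp add: generates_def words_at_def)
qed

text \<open>The threshold that decides how \<open>\<sigma>\<close> is prolonged is the same for all
  words generating \<open>f\<close> and for all net intervals with this neighbour set. This is the
  root of every invariance statement about edges.\<close>

lemma tg_div_word_rat:
  assumes "net \<Delta>" "generated \<Delta> \<sigma> f"
  shows "TG \<Delta> / \<bar>\<rho> \<sigma>\<bar> = slope_max (V \<Delta>) / \<bar>f 1 - f 0\<bar>"
  using diam_pos[OF assms(1)]
  by (simp add: tg_eq[OF assms(1)] flip: generates_abs_slope[OF assms])

lemma childD:
  assumes "child \<Delta> \<Delta>'"
  shows "net \<Delta>" "net \<Delta>'" "gen \<Delta>' = TG \<Delta>" "lft \<Delta> \<le> lft \<Delta>'" "rgt \<Delta>' \<le> rgt \<Delta>"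
  using assms by (auto simp: child_of_def net_interval_def)

text \<open>The suffixes that turn a word generating \<open>f\<close> into a word of the child
  generation, expressed by the neighbour set \<open>W\<close> alone.\<close>

abbreviation letters :: "(real \<Rightarrow> real) set \<Rightarrow> (real \<Rightarrow> real) \<Rightarrow> 'i list set" where
  "letters W f \<equiv> \<Lambda> (slope_max W / \<bar>f 1 - f 0\<bar>)"

text \<open>The relative threshold is at least 1, and equals 1 exactly for neighbours of maximal
  slope. Those are prolonged by one letter, all others are kept.\<close>

lemma letters_cases:
  assumes "net \<Delta>" "f \<in> V \<Delta>"
  shows "letters (V \<Delta>) f = {[]} \<or> letters (V \<Delta>) f = (\<lambda>i. [i]) ` idx \<Phi>"
proof -
  have "1 \<le> slope_max (V \<Delta>) / \<bar>f 1 - f 0\<bar>"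
    using slope_max_ge[OF assms] nbs_slope_pos[OF assms] by simp
  then consider "slope_max (V \<Delta>) / \<bar>f 1 - f 0\<bar> = 1" | "1 < slope_max (V \<Delta>) / \<bar>f 1 - f 0\<bar>"
    by linarith
  thus ?thesis
  proof cases
    case 1
    show ?thesis unfolding 1 words_at_1 by blast
  next
    case 2
    show ?thesis using words_at_gt_1[OF 2] by blast
  qed
qed

lemma child_ivl_map:
  assumes "net \<Delta>"
  shows "ivl_map \<Delta>' x = ivl_map \<Delta> (rel_diam \<Delta> \<Delta>' * x + pos_index \<Delta> \<Delta>')"
  using diam_pos[OF assms] by (simp add: ivl_map_def rel_diam_def pos_index_def field_simps)

lemma ivl_map_inject: "net \<Delta> \<Longrightarrow> ivl_map \<Delta> x = ivl_map \<Delta> y \<longleftrightarrow> x = y"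
  using diam_pos[of \<Phi> K \<Delta>] by (simp add: ivl_map_def)

text \<open>The right-hand side no longer mentions \<open>\<sigma>\<close>: in the coordinates of
  the parent, generating \<open>g\<close> by a prolonged word is an affine identity between
  \<open>f\<close>, \<open>g\<close> and the letter.\<close>

lemma child_generates_iff:
  assumes ch: "child \<Delta> \<Delta>'" and \<sigma>: "generated \<Delta> \<sigma> f"
  shows "generated \<Delta>' (\<sigma> @ l) g \<longleftrightarrow> g \<in> V \<Delta>' \<and> l \<in> letters (V \<Delta>) f \<and>
     (\<forall>x. f (S l x) = rel_diam \<Delta> \<Delta>' * g x + pos_index \<Delta> \<Delta>')"
proof -
  note net = childD(1,2)[OF ch]
  have mem: "\<sigma> @ l \<in> \<Lambda> (gen \<Delta>') \<longleftrightarrow> l \<in> letters (V \<Delta>) f"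
    using words_at_append_iff[of \<sigma> "gen \<Delta>" "TG \<Delta>" l] \<sigma> tg_bounds[OF net(1)]
    by (simp add: childD[OF ch] tg_div_word_rat[OF net(1) \<sigma>] generates_def)
  have S: "S (\<sigma> @ l) x = ivl_map \<Delta> (f (S l x))" for x
    using \<sigma> diam_pos[OF net(1)] by (simp add: generates_iff word_map_append)
  have maps: "(\<forall>x. ivl_map \<Delta>' (g x) = S (\<sigma> @ l) x) \<longleftrightarrow>
      (\<forall>x. f (S l x) = rel_diam \<Delta> \<Delta>' * g x + pos_index \<Delta> \<Delta>')"
    unfolding S child_ivl_map[OF net(1), of \<Delta>'] ivl_map_inject[OF net(1)] by auto
  \<comment> \<open>The map of the prolonged word coincides with that of some word already known to
    generate \<open>g\<close>, and meeting the interior depends only on the map.\<close>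
  have inter: "S (\<sigma> @ l) ` K \<inter> {lft \<Delta>'<..<rgt \<Delta>'} \<noteq> {}"
    if g: "g \<in> V \<Delta>'" and eq: "\<forall>x. ivl_map \<Delta>' (g x) = S (\<sigma> @ l) x"
  proof -
    obtain \<tau> where \<tau>: "generated \<Delta>' \<tau> g" using g by (auto simp: nbs_def)
    hence "S (\<sigma> @ l) = S \<tau>" using eq diam_pos[OF net(2)] by (auto simp: generates_iff)
    thus ?thesis using \<tau> by (simp add: generates_def)
  qed
  have "generated \<Delta>' (\<sigma> @ l) g \<longleftrightarrow> g \<in> V \<Delta>' \<and> generated \<Delta>' (\<sigma> @ l) g"
    by (auto simp: nbs_def)
  also have "\<dots> \<longleftrightarrow> g \<in> V \<Delta>' \<and> \<sigma> @ l \<in> \<Lambda> (gen \<Delta>') \<and> (\<forall>x. ivl_map \<Delta>' (g x) = S (\<sigma> @ l) x)"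
    using inter diam_pos[OF net(2)] by (auto simp: generates_iff)
  finally show ?thesis unfolding mem maps .
qed

text \<open>Ratios alone give a prefix in the generation of the parent. It generates a neighbour
  because its image of K contains that of the whole word, and the interior of the child lies in that
  of the parent.\<close>

lemma child_generates_prefix:
  assumes ch: "child \<Delta> \<Delta>'" and \<tau>: "generated \<Delta>' \<tau> g"
  shows "\<exists>\<sigma> l f. \<tau> = \<sigma> @ l \<and> generated \<Delta> \<sigma> f"
proof -
  have "\<tau> \<in> \<Lambda> (TG \<Delta>)" using \<tau> childD[OF ch] by (simp add: generates_def)
  then obtain \<sigma> l where \<sigma>: "\<tau> = \<sigma> @ l" "\<sigma> \<in> \<Lambda> (gen \<Delta>)"
    using words_at_prefix[of \<tau> "TG \<Delta>" "gen \<Delta>"] tg_bounds[OF childD(1)[OF ch]] by auto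
  have l: "l \<in> lists (idx \<Phi>)" using words_at_lists[OF \<open>\<tau> \<in> \<Lambda> (TG \<Delta>)\<close>] \<sigma>(1) by simp
  obtain k where "k \<in> K" "S \<tau> k \<in> {lft \<Delta>'<..<rgt \<Delta>'}" using \<tau> unfolding generates_def by blast
  hence "S l k \<in> K" "S \<sigma> (S l k) \<in> {lft \<Delta><..<rgt \<Delta>}"
    using word_map_K[OF l] childD(4,5)[OF ch] \<sigma>(1) by (auto simp: word_map_append)
  hence "generated \<Delta> \<sigma> (inv_into UNIV (ivl_map \<Delta>) \<circ> S \<sigma>)" using \<sigma>(2) by (auto simp: generates_def)
  thus ?thesis using \<sigma>(1) by blast
qed

lemma prolongs_iff:
  assumes ch: "child \<Delta> \<Delta>'"
  shows "prolongs \<Phi> K \<Delta> \<Delta>' f g l \<longleftrightarrow> f \<in> V \<Delta> \<and> g \<in> V \<Delta>' \<and> l \<in> letters (V \<Delta>) f \<and>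
     (\<forall>x. f (S l x) = rel_diam \<Delta> \<Delta>' * g x + pos_index \<Delta> \<Delta>')"
proof -
  have "l \<in> insert [] ((\<lambda>i. [i]) ` idx \<Phi>)" if "f \<in> V \<Delta>" "l \<in> letters (V \<Delta>) f"
    using letters_cases[OF childD(1)[OF ch] that(1)] that(2) by auto
  moreover have "(\<exists>\<sigma>. generated \<Delta> \<sigma> f \<and> generated \<Delta>' (\<sigma> @ l) g) \<longleftrightarrow> (\<exists>\<sigma>. generated \<Delta> \<sigma> f) \<and>
      g \<in> V \<Delta>' \<and> l \<in> letters (V \<Delta>) f \<and> (\<forall>x. f (S l x) = rel_diam \<Delta> \<Delta>' * g x + pos_index \<Delta> \<Delta>')"
    using child_generates_iff[OF ch] by blast
  moreover have "f \<in> V \<Delta> \<longleftrightarrow> (\<exists>\<sigma>. generated \<Delta> \<sigma> f)" by (simp add: nbs_def)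
  ultimately show ?thesis unfolding prolongs_def by blast
qed

lemma prolongs_unique:
  assumes ch: "child \<Delta> \<Delta>'" and l: "prolongs \<Phi> K \<Delta> \<Delta>' f g l" and l': "prolongs \<Phi> K \<Delta> \<Delta>' f g l'"
  shows "l = l'"
proof -
  note L = l[unfolded prolongs_iff[OF ch]] and L' = l'[unfolded prolongs_iff[OF ch]]
  have f: "f \<in> V \<Delta>" using L by simp
  have aff: "f x = (f 1 - f 0) * x + f 0" for x
    using nbs_affine[OF diam_pos f, THEN fun_cong] childD(1)[OF ch] by blast
  have "S l x = S l' x" for x
  proof -
    have "f (S l x) = f (S l' x)" using L L' by simp
    hence "(f 1 - f 0) * (S l x) = (f 1 - f 0) * (S l' x)"
      using aff[of "S l x"] aff[of "S l' x"] by linarith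
    thus ?thesis using nbs_slope_pos[OF childD(1)[OF ch] f] by simp
  qed
  hence "S l = S l'" by (rule ext)
  moreover have "l \<in> letters (V \<Delta>) f" "l' \<in> letters (V \<Delta>) f" using L L' by auto
  \<comment> \<open>Both words are empty or both are single letters, and distinct letters have
    distinct maps.\<close>
  ultimately show ?thesis using letters_cases[OF childD(1)[OF ch] f] inj_ifs_map
    by (auto simp: inj_on_def)
qed

section \<open>Edges determine relative diameters, lengths and transition matrices\<close>

text \<open>With the converse \<open>child_end_ptsI\<close>: in normalised coordinates the points
  dividing a net interval into children are the values \<open>f (S l z)\<close>, hence determined by
  the neighbour set.\<close>

lemma child_end_ptsD:
  assumes net: "net \<Delta>" and h: "h \<in> end_pts \<Phi> (TG \<Delta>)" "lft \<Delta> < h" "h < rgt \<Delta>"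
  shows "\<exists>f\<in>V \<Delta>. \<exists>l\<in>letters (V \<Delta>) f. \<exists>z\<in>{0,1}. h = ivl_map \<Delta> (f (S l z))"
proof -
  obtain \<tau> z where \<tau>: "\<tau> \<in> \<Lambda> (TG \<Delta>)" "z \<in> {0,1}" "h = S \<tau> z" using h by (auto simp: end_pts_def)
  obtain \<sigma> l where \<sigma>: "\<tau> = \<sigma> @ l" "\<sigma> \<in> \<Lambda> (gen \<Delta>)"
    using words_at_prefix[OF \<tau>(1) tg_bounds(1)[OF net]] tg_bounds(2)[OF net] less_imp_le by blast
  have l: "l \<in> lists (idx \<Phi>)" using words_at_lists[OF \<tau>(1)] \<sigma>(1) by simp
  have "S l z \<in> K" using word_map_K[OF l] \<tau>(2) zero_in_K one_in_K by auto
  hence "h \<in> S \<sigma> ` K" using \<tau>(3) \<sigma>(1) by (auto simp: word_map_append)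
  hence f: "generated \<Delta> \<sigma> (inv_into UNIV (ivl_map \<Delta>) \<circ> S \<sigma>)" (is "generated \<Delta> \<sigma> ?f")
    using \<sigma>(2) h by (auto simp: generates_def)
  have "l \<in> letters (V \<Delta>) ?f"
    using words_at_append_iff[OF \<sigma>(2), of "TG \<Delta>" l] tg_bounds[OF net] \<tau>(1) \<sigma>(1)
      tg_div_word_rat[OF net f] by simp
  moreover have "h = ivl_map \<Delta> (?f (S l z))"
    using f diam_pos[OF net] \<tau>(3) \<sigma>(1) unfolding generates_iff[OF diam_pos[OF net]]
    by (simp add: word_map_append)
  moreover have "?f \<in> V \<Delta>" using f by (auto simp: nbs_def)
  ultimately show ?thesis using \<tau>(2) by blast
qed

lemma child_end_ptsI:
  assumes net: "net \<Delta>" and f: "f \<in> V \<Delta>" "l \<in> letters (V \<Delta>) f" "z \<in> {0,1}"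
  shows "ivl_map \<Delta> (f (S l z)) \<in> end_pts \<Phi> (TG \<Delta>)"
proof -
  obtain \<sigma> where \<sigma>: "generated \<Delta> \<sigma> f" using f by (auto simp: nbs_def)
  have "\<sigma> @ l \<in> \<Lambda> (TG \<Delta>)"
    using words_at_append_iff[of \<sigma> "gen \<Delta>" "TG \<Delta>" l] tg_bounds[OF net] f(2) \<sigma>
    by (simp add: tg_div_word_rat[OF net \<sigma>] generates_def)
  moreover have "ivl_map \<Delta> (f (S l z)) = S (\<sigma> @ l) z"
    using \<sigma> diam_pos[OF net] by (simp add: generates_iff word_map_append)
  ultimately show ?thesis using f(3) unfolding end_pts_def by auto
qed

lemma child_ends:
  assumes "child \<Delta> \<Delta>'"
  shows "lft \<Delta>' = ivl_map \<Delta> (pos_index \<Delta> \<Delta>')"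
    and "rgt \<Delta>' = ivl_map \<Delta> (pos_index \<Delta> \<Delta>' + rel_diam \<Delta> \<Delta>')"
proof -
  have "diam_ivl \<Delta> * pos_index \<Delta> \<Delta>' = lft \<Delta>' - lft \<Delta>" "diam_ivl \<Delta> * rel_diam \<Delta> \<Delta>' = rgt \<Delta>' - lft \<Delta>'"
    using diam_pos[OF childD(1)[OF assms]] diam_ivl_def[of \<Delta>'] by (simp_all add: pos_index_def rel_diam_def)
  thus "lft \<Delta>' = ivl_map \<Delta> (pos_index \<Delta> \<Delta>')" "rgt \<Delta>' = ivl_map \<Delta> (pos_index \<Delta> \<Delta>' + rel_diam \<Delta> \<Delta>')"
    by (simp_all add: ivl_map_def distrib_left)
qed

lemma ivl_map_less: "net \<Delta> \<Longrightarrow> ivl_map \<Delta> x < ivl_map \<Delta> y \<longleftrightarrow> x < y"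
  using diam_pos[of \<Phi> K \<Delta>] by (simp add: ivl_map_def)

text \<open>An edge records only the left end of the child. The right end is recovered as the next
  division point: if the first child were relatively shorter, its right end would be a division
  point of the second parent inside the second child. Equality follows by exchanging the
  roles.\<close>

lemma rel_diam_le:
  assumes ch: "child \<Delta>\<^sub>1 \<Delta>\<^sub>1'" "child \<Delta>\<^sub>2 \<Delta>\<^sub>2'"
    and eq: "V \<Delta>\<^sub>1 = V \<Delta>\<^sub>2" "pos_index \<Delta>\<^sub>1 \<Delta>\<^sub>1' = pos_index \<Delta>\<^sub>2 \<Delta>\<^sub>2'"
  shows "rel_diam \<Delta>\<^sub>2 \<Delta>\<^sub>2' \<le> rel_diam \<Delta>\<^sub>1 \<Delta>\<^sub>1'"
proof (rule ccontr)
  assume "\<not> ?thesis"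
  hence less: "rel_diam \<Delta>\<^sub>1 \<Delta>\<^sub>1' < rel_diam \<Delta>\<^sub>2 \<Delta>\<^sub>2'" by simp
  define u where "u = pos_index \<Delta>\<^sub>1 \<Delta>\<^sub>1' + rel_diam \<Delta>\<^sub>1 \<Delta>\<^sub>1'"
  note net1 = childD(1)[OF ch(1)] and net2 = childD(1)[OF ch(2)]
  have top: "rgt \<Delta> = ivl_map \<Delta> 1" for \<Delta> by (simp add: ivl_map_def diam_ivl_def)
  have "pos_index \<Delta>\<^sub>2 \<Delta>\<^sub>2' + rel_diam \<Delta>\<^sub>2 \<Delta>\<^sub>2' \<le> 1"
  proof -
    have "\<not> ivl_map \<Delta>\<^sub>2 1 < ivl_map \<Delta>\<^sub>2 (pos_index \<Delta>\<^sub>2 \<Delta>\<^sub>2' + rel_diam \<Delta>\<^sub>2 \<Delta>\<^sub>2')"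
      using childD(5)[OF ch(2)] child_ends(2)[OF ch(2)] top[of \<Delta>\<^sub>2] by simp
    thus ?thesis unfolding ivl_map_less[OF net2] by simp
  qed
  hence "u < 1" using less eq by (simp add: u_def)
  have rgt1: "rgt \<Delta>\<^sub>1' = ivl_map \<Delta>\<^sub>1 u" using child_ends[OF ch(1)] by (simp add: u_def)
  have "rgt \<Delta>\<^sub>1' < rgt \<Delta>\<^sub>1" unfolding rgt1 top[of \<Delta>\<^sub>1] using \<open>u < 1\<close> ivl_map_less[OF net1] by simp
  moreover have "rgt \<Delta>\<^sub>1' \<in> end_pts \<Phi> (TG \<Delta>\<^sub>1)" "lft \<Delta>\<^sub>1 < rgt \<Delta>\<^sub>1'"
    using childD[OF ch(1)] by (auto simp: net_interval_def)
  ultimately obtain f l z where f: "f \<in> V \<Delta>\<^sub>1" "l \<in> letters (V \<Delta>\<^sub>1) f" "z \<in> {0,1}" "rgt \<Delta>\<^sub>1' = ivl_map \<Delta>\<^sub>1 (f (S l z))"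
    using child_end_ptsD[OF net1] by blast
  hence "u = f (S l z)" using rgt1 ivl_map_inject[OF net1] by simp
  hence "ivl_map \<Delta>\<^sub>2 u \<in> end_pts \<Phi> (gen \<Delta>\<^sub>2')"
    using child_end_ptsI[OF net2] f eq(1) childD(3)[OF ch(2)] by simp
  moreover have "lft \<Delta>\<^sub>2' < ivl_map \<Delta>\<^sub>2 u" "ivl_map \<Delta>\<^sub>2 u < rgt \<Delta>\<^sub>2'"
    unfolding child_ends[OF ch(2)] ivl_map_less[OF net2] u_def
    using less eq(2) diam_pos[OF childD(2)[OF ch(1)]] diam_pos[OF net1] by (auto simp: rel_diam_def)
  ultimately have "ivl_map \<Delta>\<^sub>2 u \<in> {lft \<Delta>\<^sub>2'<..<rgt \<Delta>\<^sub>2'} \<inter> end_pts \<Phi> (gen \<Delta>\<^sub>2')" by simp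
  moreover have "{lft \<Delta>\<^sub>2'<..<rgt \<Delta>\<^sub>2'} \<inter> end_pts \<Phi> (gen \<Delta>\<^sub>2') = {}"
    using childD(2)[OF ch(2)] by (simp add: net_interval_def)
  ultimately show False by blast
qed

definition same_edge :: "gen_ivl \<Rightarrow> gen_ivl \<Rightarrow> gen_ivl \<Rightarrow> gen_ivl \<Rightarrow> bool" where
  "same_edge \<Delta>\<^sub>1 \<Delta>\<^sub>1' \<Delta>\<^sub>2 \<Delta>\<^sub>2' \<longleftrightarrow> child \<Delta>\<^sub>1 \<Delta>\<^sub>1' \<and> child \<Delta>\<^sub>2 \<Delta>\<^sub>2' \<and>
     edge_btw \<Phi> K \<Delta>\<^sub>1 \<Delta>\<^sub>1' = edge_btw \<Phi> K \<Delta>\<^sub>2 \<Delta>\<^sub>2'"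

lemma same_edge_rel_diam:
  assumes "same_edge \<Delta>\<^sub>1 \<Delta>\<^sub>1' \<Delta>\<^sub>2 \<Delta>\<^sub>2'"
  shows "rel_diam \<Delta>\<^sub>1 \<Delta>\<^sub>1' = rel_diam \<Delta>\<^sub>2 \<Delta>\<^sub>2'"
  using assms rel_diam_le[of \<Delta>\<^sub>1 \<Delta>\<^sub>1' \<Delta>\<^sub>2 \<Delta>\<^sub>2'] rel_diam_le[of \<Delta>\<^sub>2 \<Delta>\<^sub>2' \<Delta>\<^sub>1 \<Delta>\<^sub>1']
  by (simp add: same_edge_def edge_btw_def)

lemma same_edge_prolongs:
  assumes "same_edge \<Delta>\<^sub>1 \<Delta>\<^sub>1' \<Delta>\<^sub>2 \<Delta>\<^sub>2'"
  shows "prolongs \<Phi> K \<Delta>\<^sub>1 \<Delta>\<^sub>1' = prolongs \<Phi> K \<Delta>\<^sub>2 \<Delta>\<^sub>2'"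
proof (intro ext)
  fix f g l
  have ch: "child \<Delta>\<^sub>1 \<Delta>\<^sub>1'" "child \<Delta>\<^sub>2 \<Delta>\<^sub>2'" using assms by (auto simp: same_edge_def)
  show "prolongs \<Phi> K \<Delta>\<^sub>1 \<Delta>\<^sub>1' f g l = prolongs \<Phi> K \<Delta>\<^sub>2 \<Delta>\<^sub>2' f g l"
    unfolding prolongs_iff[OF ch(1)] prolongs_iff[OF ch(2)] same_edge_rel_diam[OF assms]
    using assms by (simp add: same_edge_def edge_btw_def)
qed

lemma same_edge_realisation:
  assumes "child \<Delta> \<Delta>'"
  defines "D \<equiv> realisation \<Phi> K (edge_btw \<Phi> K \<Delta> \<Delta>')"
  shows "same_edge (fst D) (snd D) \<Delta> \<Delta>'"
proof -
  have "child (fst D) (snd D) \<and> edge_btw \<Phi> K (fst D) (snd D) = edge_btw \<Phi> K \<Delta> \<Delta>'"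
    unfolding D_def realisation_def by (rule someI[of _ "(\<Delta>, \<Delta>')"]) (use assms(1) in simp)
  thus ?thesis using assms(1) by (simp add: same_edge_def)
qed

lemma tg_quotient:
  assumes "child \<Delta> \<Delta>'"
  shows "TG \<Delta>' / TG \<Delta> = rel_diam \<Delta> \<Delta>' * (slope_max (V \<Delta>') / slope_max (V \<Delta>))"
  using childD[OF assms] by (simp add: tg_eq rel_diam_def)

lemma edge_len_eq:
  assumes "child \<Delta> \<Delta>'"
  shows "edge_len \<Phi> K (edge_btw \<Phi> K \<Delta> \<Delta>') = TG \<Delta>' / TG \<Delta>"
proof -
  define D where "D = realisation \<Phi> K (edge_btw \<Phi> K \<Delta> \<Delta>')"
  note same = same_edge_realisation[OF assms, folded D_def]
  have "TG (snd D) / TG (fst D) = TG \<Delta>' / TG \<Delta>"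
    using same same_edge_rel_diam[OF same] tg_quotient[OF assms] tg_quotient[of "fst D" "snd D"]
    by (simp add: same_edge_def edge_btw_def)
  thus ?thesis by (simp add: edge_len_def D_def)
qed

text \<open>Lets matrices be computed along an actual chain instead of at the realisation picked by
  \<open>SOME\<close>; words enter an entry only through \<open>prolongs\<close>, which is an
  invariant of the edge.\<close>

lemma trans_mat_eq:
  fixes ord :: "((real \<Rightarrow> real) \<times> (real \<Rightarrow> real)) set"
  assumes "child \<Delta> \<Delta>'"
  defines "fs \<equiv> enum_nbs ord (V \<Delta>)" and "gs \<equiv> enum_nbs ord (V \<Delta>')"
  shows "trans_mat \<Phi> K p \<mu> ord (edge_btw \<Phi> K \<Delta> \<Delta>') = Matrix.mat (length fs) (length gs)
     (\<lambda>(i, j). trans_entry \<Phi> K p \<mu> \<Delta> \<Delta>' (fs ! i) (gs ! j))"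
proof -
  define D where "D = realisation \<Phi> K (edge_btw \<Phi> K \<Delta> \<Delta>')"
  have "trans_entry \<Phi> K p \<mu> (fst D) (snd D) = trans_entry \<Phi> K p \<mu> \<Delta> \<Delta>'"
    by (intro ext) (simp add: trans_entry_def
      same_edge_prolongs[OF same_edge_realisation[OF assms(1), folded D_def]])
  thus ?thesis
    unfolding trans_mat_def Let_def D_def[symmetric] case_prod_beta fs_def gs_def
    by (simp add: edge_src_def edge_tgt_def edge_btw_def)
qed

section \<open>Measures of net intervals\<close>

text \<open>All words generating \<open>f\<close> have the same preimage of the interior, which
  gives the common first factor. The quotients of measures in the transition matrix are exactly what
  converts this factor for \<open>f\<close> into that for \<open>g\<close>.\<close>

definition Q :: "gen_ivl \<Rightarrow> (real \<Rightarrow> real) \<Rightarrow> real" where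
  "Q \<Delta> f = measure \<mu> (f -` {0<..<1}) * (\<Sum>\<sigma> | generated \<Delta> \<sigma> f. P \<sigma>)"

lemma finite_generates: "net \<Delta> \<Longrightarrow> finite {\<sigma>. generated \<Delta> \<sigma> f}"
  by (rule finite_subset[OF _ finite_words_at[of "gen \<Delta>"]]) (auto simp: generates_def net_interval_def)

lemma generates_vimage:
  assumes "net \<Delta>" "generated \<Delta> \<sigma> f"
  shows "f -` {0<..<1} = S \<sigma> -` {lft \<Delta><..<rgt \<Delta>}"
proof -
  have "lft \<Delta> = ivl_map \<Delta> 0" "rgt \<Delta> = ivl_map \<Delta> 1" by (simp_all add: ivl_map_def diam_ivl_def)
  moreover have "S \<sigma> x = ivl_map \<Delta> (f x)" for x
    using assms diam_pos[OF assms(1)] by (simp add: generates_iff)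
  ultimately show ?thesis using ivl_map_less[OF assms(1)] by auto
qed

lemma measure_nb_pos:
  assumes "net \<Delta>" "f \<in> V \<Delta>"
  shows "0 < measure \<mu> (f -` {0<..<1})"
proof -
  obtain \<sigma> where \<sigma>: "generated \<Delta> \<sigma> f" using assms by (auto simp: nbs_def)
  have "open (S \<sigma> -` {lft \<Delta><..<rgt \<Delta>})"
    by (intro open_vimage continuous_on_word_map) auto
  moreover have "S \<sigma> -` {lft \<Delta><..<rgt \<Delta>} \<inter> K \<noteq> {}" using \<sigma> by (auto simp: generates_def)
  ultimately show ?thesis unfolding generates_vimage[OF assms(1) \<sigma>] by (rule measure_open_pos)
qed

lemma Q_pos:
  assumes "net \<Delta>" "f \<in> V \<Delta>"
  shows "0 < Q \<Delta> f"
proof -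
  have "0 < (\<Sum>\<sigma> | generated \<Delta> \<sigma> f. P \<sigma>)"
    using finite_generates[OF assms(1)] assms(2) P_pos words_at_lists
    by (intro sum_pos) (auto simp: nbs_def generates_def)
  thus ?thesis unfolding Q_def using measure_nb_pos[OF assms] by simp
qed

lemma sum_Q:
  assumes "net \<Delta>"
  shows "(\<Sum>f\<in>V \<Delta>. Q \<Delta> f) = measure \<mu> {lft \<Delta><..<rgt \<Delta>}"
proof -
  let ?I = "{lft \<Delta><..<rgt \<Delta>}"
  have gen: "gen \<Delta> > 0" using assms by (simp add: net_interval_def)
  define G where "G = {\<sigma>. \<exists>f. generated \<Delta> \<sigma> f}"
  have G: "G = (\<Union>f\<in>V \<Delta>. {\<sigma>. generated \<Delta> \<sigma> f})" by (auto simp: G_def nbs_def)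
  have "measure \<mu> ?I = (\<Sum>\<sigma>\<in>\<Lambda> (gen \<Delta>). P \<sigma> * measure \<mu> (S \<sigma> -` ?I))"
    by (rule measure_self_similar[OF gen]) simp
  also have "\<dots> = (\<Sum>\<sigma>\<in>G. P \<sigma> * measure \<mu> (S \<sigma> -` ?I))"
  proof (rule sum.mono_neutral_right[OF finite_words_at[OF gen]])
    \<comment> \<open>A word generating no neighbour pulls the interior back to a set missing K,
      which is null.\<close>
    show "\<forall>\<sigma>\<in>\<Lambda> (gen \<Delta>) - G. P \<sigma> * measure \<mu> (S \<sigma> -` ?I) = 0"
    proof
      fix \<sigma> assume "\<sigma> \<in> \<Lambda> (gen \<Delta>) - G"
      hence "S \<sigma> ` K \<inter> ?I = {}" by (auto simp: G_def generates_def)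
      hence "S \<sigma> -` ?I \<inter> K = {}" by auto
      moreover have "S \<sigma> -` ?I \<in> sets borel" by (rule vimage_word_map_borel) simp
      ultimately have "measure \<mu> (S \<sigma> -` ?I) = 0" by (intro measure_outside_K)
      thus "P \<sigma> * measure \<mu> (S \<sigma> -` ?I) = 0" by simp
    qed
  qed (auto simp: G_def generates_def)
  also have "\<dots> = (\<Sum>f\<in>V \<Delta>. \<Sum>\<sigma> | generated \<Delta> \<sigma> f. P \<sigma> * measure \<mu> (S \<sigma> -` ?I))"
    unfolding G using finite_nbs[OF assms] finite_generates[OF assms] generates_unique
    by (intro sum.UNION_disjoint) blast+
  also have "\<dots> = (\<Sum>f\<in>V \<Delta>. Q \<Delta> f)"
    unfolding Q_def sum_distrib_left
    by (intro sum.cong refl) (auto simp: generates_vimage[OF assms])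
  finally show ?thesis by simp
qed

lemma prolongs_generates:
  assumes ch: "child \<Delta> \<Delta>'" and "prolongs \<Phi> K \<Delta> \<Delta>' f g l" "generated \<Delta> \<sigma> f"
  shows "generated \<Delta>' (\<sigma> @ l) g"
  using assms(2)[unfolded prolongs_iff[OF ch]] child_generates_iff[OF ch assms(3), of l g] by simp

lemma Q_step:
  assumes ch: "child \<Delta> \<Delta>'" and g: "g \<in> V \<Delta>'"
  shows "Q \<Delta>' g = (\<Sum>f\<in>V \<Delta>. Q \<Delta> f * trans_entry \<Phi> K p \<mu> \<Delta> \<Delta>' f g)"
proof -
  note net = childD(1,2)[OF ch]
  define F where "F = {f \<in> V \<Delta>. \<exists>l. prolongs \<Phi> K \<Delta> \<Delta>' f g l}"
  define L where "L = (\<lambda>f. THE l. prolongs \<Phi> K \<Delta> \<Delta>' f g l)"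
  have L: "prolongs \<Phi> K \<Delta> \<Delta>' f g (L f)" if fF: "f \<in> F" for f
  proof -
    obtain l where l: "prolongs \<Phi> K \<Delta> \<Delta>' f g l" using fF by (auto simp: F_def)
    have "L f = l" unfolding L_def using l prolongs_unique[OF ch _ l] by (rule the_equality)
    thus ?thesis using l by simp
  qed
  have gen_eq: "{\<tau>. generated \<Delta>' \<tau> g} = (\<Union>f\<in>F. (\<lambda>\<sigma>. \<sigma> @ L f) ` {\<sigma>. generated \<Delta> \<sigma> f})"
  proof (intro equalityI subsetI)
    fix \<tau> assume "\<tau> \<in> {\<tau>. generated \<Delta>' \<tau> g}"
    hence \<tau>: "generated \<Delta>' \<tau> g" by simp
    then obtain \<sigma> l f where \<sigma>: "\<tau> = \<sigma> @ l" "generated \<Delta> \<sigma> f" using child_generates_prefix[OF ch] by blast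
    have f: "f \<in> V \<Delta>" using \<sigma> by (auto simp: nbs_def)
    have l: "prolongs \<Phi> K \<Delta> \<Delta>' f g l"
      using \<tau> f unfolding \<sigma>(1) child_generates_iff[OF ch \<sigma>(2)] prolongs_iff[OF ch] by simp
    hence "f \<in> F" using f by (auto simp: F_def)
    moreover have "l = L f" using prolongs_unique[OF ch l L[OF \<open>f \<in> F\<close>]] .
    ultimately show "\<tau> \<in> (\<Union>f\<in>F. (\<lambda>\<sigma>. \<sigma> @ L f) ` {\<sigma>. generated \<Delta> \<sigma> f})" using \<sigma> by blast
  next
    fix \<tau> assume "\<tau> \<in> (\<Union>f\<in>F. (\<lambda>\<sigma>. \<sigma> @ L f) ` {\<sigma>. generated \<Delta> \<sigma> f})"
    thus "\<tau> \<in> {\<tau>. generated \<Delta>' \<tau> g}" using prolongs_generates[OF ch L] by auto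
  qed
  \<comment> \<open>Words of one generation form an antichain for the prefix order, so each word of
    the child has a unique prefix in the parent generation and is counted once.\<close>
  have prefix: "\<sigma> = \<sigma>'" if "\<sigma> @ l = \<sigma>' @ l'" "\<sigma> \<in> \<Lambda> (gen \<Delta>)" "\<sigma>' \<in> \<Lambda> (gen \<Delta>)" for \<sigma> \<sigma>' l l'
  proof -
    have gen: "gen \<Delta> > 0" using net by (simp add: net_interval_def)
    have "\<exists>us. \<sigma> = \<sigma>' @ us \<or> \<sigma>' = \<sigma> @ us" using that(1) by (auto simp: append_eq_append_conv2)
    thus ?thesis using words_at_antichain[OF that(2) _ gen] words_at_antichain[OF that(3) _ gen] that by auto
  qed
  have finF: "finite F" using finite_nbs[OF net(1)] by (simp add: F_def)
  have "(\<Sum>\<tau> | generated \<Delta>' \<tau> g. P \<tau>) = (\<Sum>f\<in>F. \<Sum>\<tau>\<in>(\<lambda>\<sigma>. \<sigma> @ L f) ` {\<sigma>. generated \<Delta> \<sigma> f}. P \<tau>)"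
    unfolding gen_eq
  proof (rule sum.UNION_disjoint[OF finF])
    show "\<forall>f\<in>F. finite ((\<lambda>\<sigma>. \<sigma> @ L f) ` {\<sigma>. generated \<Delta> \<sigma> f})"
      using finite_generates[OF net(1)] by blast
    show "\<forall>f\<in>F. \<forall>f'\<in>F. f \<noteq> f' \<longrightarrow>
        (\<lambda>\<sigma>. \<sigma> @ L f) ` {\<sigma>. generated \<Delta> \<sigma> f} \<inter> (\<lambda>\<sigma>. \<sigma> @ L f') ` {\<sigma>. generated \<Delta> \<sigma> f'} = {}"
    proof (intro ballI impI equals0I)
      fix f f' \<tau> assume "f \<noteq> f'"
        "\<tau> \<in> (\<lambda>\<sigma>. \<sigma> @ L f) ` {\<sigma>. generated \<Delta> \<sigma> f} \<inter> (\<lambda>\<sigma>. \<sigma> @ L f') ` {\<sigma>. generated \<Delta> \<sigma> f'}"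
      then obtain \<sigma> \<sigma>' where "\<sigma> @ L f = \<sigma>' @ L f'" "generated \<Delta> \<sigma> f" "generated \<Delta> \<sigma>' f'" by auto
      hence "f = f'" using prefix generates_unique by (metis generates_def)
      thus False using \<open>f \<noteq> f'\<close> by simp
    qed
  qed
  also have "\<dots> = (\<Sum>f\<in>F. P (L f) * (\<Sum>\<sigma> | generated \<Delta> \<sigma> f. P \<sigma>))"
    by (rule sum.cong[OF refl], subst sum.reindex)
      (auto intro: inj_onI simp: sum_distrib_left mult.commute)
  finally have sumP: "(\<Sum>\<tau> | generated \<Delta>' \<tau> g. P \<tau>) = (\<Sum>f\<in>F. P (L f) * (\<Sum>\<sigma> | generated \<Delta> \<sigma> f. P \<sigma>))" .
  have "Q \<Delta>' g = (\<Sum>f\<in>F. measure \<mu> (g -` {0<..<1}) * (P (L f) * (\<Sum>\<sigma> | generated \<Delta> \<sigma> f. P \<sigma>)))"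
    unfolding Q_def[of \<Delta>'] sumP by (rule sum_distrib_left)
  also have "\<dots> = (\<Sum>f\<in>F. Q \<Delta> f * trans_entry \<Phi> K p \<mu> \<Delta> \<Delta>' f g)"
  proof (rule sum.cong[OF refl])
    fix f assume f: "f \<in> F"
    have "trans_entry \<Phi> K p \<mu> \<Delta> \<Delta>' f g
        = measure \<mu> (g -` {0<..<1}) / measure \<mu> (f -` {0<..<1}) * P (L f)"
      using f by (auto simp: trans_entry_def F_def L_def)
    moreover have "measure \<mu> (f -` {0<..<1}) \<noteq> 0" using measure_nb_pos[OF net(1), of f] f by (auto simp: F_def)
    ultimately show "measure \<mu> (g -` {0<..<1}) * (P (L f) * (\<Sum>\<sigma> | generated \<Delta> \<sigma> f. P \<sigma>))
        = Q \<Delta> f * trans_entry \<Phi> K p \<mu> \<Delta> \<Delta>' f g" by (simp add: Q_def)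
  qed
  also have "\<dots> = (\<Sum>f\<in>V \<Delta>. Q \<Delta> f * trans_entry \<Phi> K p \<mu> \<Delta> \<Delta>' f g)"
    using finite_nbs[OF net(1)]
    by (intro sum.mono_neutral_left) (auto simp: F_def trans_entry_def)
  finally show ?thesis .
qed

lemma trans_entry_nonneg:
  assumes ch: "child \<Delta> \<Delta>'"
  shows "0 \<le> trans_entry \<Phi> K p \<mu> \<Delta> \<Delta>' f g"
proof (cases "\<exists>l. prolongs \<Phi> K \<Delta> \<Delta>' f g l")
  case True
  then obtain l where l: "prolongs \<Phi> K \<Delta> \<Delta>' f g l" by blast
  hence "(THE l. prolongs \<Phi> K \<Delta> \<Delta>' f g l) = l" using prolongs_unique[OF ch _ l] by (rule the_equality)
  moreover have "0 < P l" using l by (intro P_pos) (auto simp: prolongs_def)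
  ultimately show ?thesis using True by (auto simp: trans_entry_def)
next
  case False
  then show ?thesis by (simp add: trans_entry_def)
qed

end

section \<open>Geometric bounds and logarithmic limits\<close>

lemma power_scale:
  fixes l d t :: real
  assumes l: "0 < l" "l < 1" and t: "0 < t" "t < d"
  shows "\<exists>k. d * l ^ Suc k \<le> t \<and> t < d * l ^ k"
proof -
  have d: "0 < d" using t by simp
  define k where "k = (LEAST k. d * l ^ k \<le> t)"
  have "\<exists>k. d * l ^ k \<le> t"
  proof -
    obtain k where "l ^ k < t / d" using real_arch_pow_inv[of "t / d" l] l t d by auto
    thus ?thesis using d by (intro exI[of _ k]) (simp add: field_simps)
  qed
  hence 1: "d * l ^ k \<le> t" unfolding k_def by (rule LeastI_ex)
  hence "k \<noteq> 0" using t by (intro notI) simp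
  then obtain j where j: "k = Suc j" by (cases k) auto
  hence "\<not> d * l ^ j \<le> t" using not_less_Least[of j "\<lambda>k. d * l ^ k \<le> t"] by (simp add: k_def)
  thus ?thesis using 1 j by (intro exI[of _ j]) auto
qed

text \<open>No sign of the exponent is assumed, and the power is increasing or decreasing
  accordingly; \<open>min\<close> and \<open>max\<close> treat both cases at once.\<close>

lemma powr_between:
  fixes a b t u D :: real
  assumes "0 < a" "0 < t" "a * t \<le> u" "u \<le> b * t"
  shows "min (a powr D) (b powr D) * t powr D \<le> u powr D"
    and "u powr D \<le> max (a powr D) (b powr D) * t powr D"
proof -
  define v where "v = u / t"
  have v: "0 < a" "a \<le> v" "v \<le> b" using assms by (auto simp: v_def field_simps)
  have u: "u powr D = v powr D * t powr D" using v assms by (simp add: v_def flip: powr_mult)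
  have "a powr D \<le> v powr D \<and> v powr D \<le> b powr D" if "D \<ge> 0"
    using v that by (auto intro!: powr_mono2)
  moreover have "b powr D \<le> v powr D \<and> v powr D \<le> a powr D" if "D \<le> 0"
    using v that by (auto intro!: powr_mono2')
  ultimately have "min (a powr D) (b powr D) \<le> v powr D" "v powr D \<le> max (a powr D) (b powr D)"
    by (cases "D \<ge> 0"; force)+
  thus "min (a powr D) (b powr D) * t powr D \<le> u powr D"
    "u powr D \<le> max (a powr D) (b powr D) * t powr D"
    unfolding u by (intro mult_right_mono; simp)+
qed

text \<open>Origin of the quotient of logarithms: it is the exponent that turns the length of a
  period into its growth rate.\<close>

lemma power_eq_powr_quotient:
  fixes l r :: real
  assumes "0 < l" "l < 1" "0 < r"
  shows "r ^ k = (l ^ k) powr (ln r / ln l)"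
proof -
  have "l powr (ln r / ln l) = r" using assms by (simp add: powr_def)
  moreover have "(l ^ k) powr (ln r / ln l) = (l powr (ln r / ln l)) ^ k"
  proof -
    have "(l ^ k) powr (ln r / ln l) = (l powr real k) powr (ln r / ln l)"
      using assms(1) by (simp add: powr_realpow)
    also have "\<dots> = l powr (real k * (ln r / ln l))" by (rule powr_powr)
    also have "\<dots> = (l powr (ln r / ln l)) ^ k" using assms(1) by (subst powr_power) (auto simp: mult.commute)
    finally show ?thesis .
  qed
  ultimately show ?thesis by simp
qed

lemma geometric_lower_bound:
  fixes f :: "real \<Rightarrow> real"
  assumes l: "0 < l" "l < 1" and r: "0 < r" and c: "0 < c" and d: "0 < d"
    and bound: "\<And>k t. d * l ^ k \<le> t \<Longrightarrow> c * r ^ k \<le> f t"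
  shows "\<exists>C>0. \<forall>t. 0 < t \<longrightarrow> t < d \<longrightarrow> C * t powr (ln r / ln l) \<le> f t"
proof -
  define D where "D = ln r / ln l"
  \<comment> \<open>For the scale \<open>k\<close> chosen below, \<open>l ^ Suc k / t\<close> lies
    between \<open>l / d\<close> and \<open>1 / d\<close>. The index \<open>Suc k\<close> is needed
    because the bound applies only at scales not exceeding \<open>t\<close>.\<close>
  define C where "C = c * min ((l / d) powr D) ((1 / d) powr D)"
  have "C * t powr D \<le> f t" if t: "0 < t" "t < d" for t
  proof -
    obtain k where k: "d * l ^ Suc k \<le> t" "t < d * l ^ k" using power_scale[OF l t] by blast
    have "(l / d) * t \<le> l ^ Suc k" "l ^ Suc k \<le> (1 / d) * t"
      using k d l by (auto simp: field_simps)
    hence "min ((l / d) powr D) ((1 / d) powr D) * t powr D \<le> r ^ Suc k"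
      unfolding power_eq_powr_quotient[OF l r] D_def[symmetric] using l d t
      by (intro powr_between) auto
    hence "C * t powr D \<le> c * r ^ Suc k" using c by (simp add: C_def mult.assoc)
    thus ?thesis using bound[OF k(1)] by simp
  qed
  moreover have "C > 0" using c l d by (simp add: C_def)
  ultimately show ?thesis unfolding D_def by blast
qed

lemma geometric_upper_bound:
  fixes f :: "real \<Rightarrow> real"
  assumes l: "0 < l" "l < 1" and r: "0 < r" and c: "0 < c" and d: "0 < d"
    and bound: "\<And>k t. t \<le> d * l ^ k \<Longrightarrow> f t \<le> c * r ^ k"
  shows "\<exists>C>0. \<forall>t. 0 < t \<longrightarrow> t < d \<longrightarrow> f t \<le> C * t powr (ln r / ln l)"
proof -
  define D where "D = ln r / ln l"
  \<comment> \<open>Here the scale used is not below \<open>t\<close>, and \<open>l ^ k / t\<close>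
    lies between \<open>1 / d\<close> and \<open>1 / (d * l)\<close>.\<close>
  define C where "C = c * max ((1 / d) powr D) ((1 / (d * l)) powr D)"
  have "f t \<le> C * t powr D" if t: "0 < t" "t < d" for t
  proof -
    obtain k where k: "d * l ^ Suc k \<le> t" "t < d * l ^ k" using power_scale[OF l t] by blast
    have "(1 / d) * t \<le> l ^ k" "l ^ k \<le> (1 / (d * l)) * t"
      using k d l by (auto simp: field_simps)
    hence "r ^ k \<le> max ((1 / d) powr D) ((1 / (d * l)) powr D) * t powr D"
      unfolding power_eq_powr_quotient[OF l r] D_def[symmetric] using l d t
      by (intro powr_between) auto
    hence "c * r ^ k \<le> C * t powr D" using c by (simp add: C_def mult.assoc)
    thus ?thesis using bound[of t k] k(2) by simp
  qed
  moreover have "C > 0" using c l d by (simp add: C_def less_max_iff_disj)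
  ultimately show ?thesis unfolding D_def by blast
qed

text \<open>As \<open>ln t\<close> is negative near 0, a lower bound for \<open>f\<close> bounds the
  quotient from above and conversely. Multiplicative constants vanish since
  \<open>ln C / ln t\<close> tends to 0, and so does the loss \<open>\<delta>\<close>, being
  arbitrary.\<close>

lemma ln_quotient_tendsto:
  fixes f :: "real \<Rightarrow> real"
  assumes lower: "\<exists>C>0. \<exists>t\<^sub>0>0. \<forall>t. 0 < t \<longrightarrow> t < t\<^sub>0 \<longrightarrow> C * t powr D \<le> f t"
    and upper: "\<And>\<delta>. \<delta> > 0 \<Longrightarrow> \<exists>C>0. \<exists>t\<^sub>0>0. \<forall>t. 0 < t \<longrightarrow> t < t\<^sub>0 \<longrightarrow> f t \<le> C * t powr (D - \<delta>)"
  shows "((\<lambda>t. ln (f t) / ln t) \<longlongrightarrow> D) (at_right 0)"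
proof -
  have lim: "((\<lambda>t. ln C / ln t) \<longlongrightarrow> 0) (at_right 0)" for C :: real
    by (rule tendsto_divide_0[OF tendsto_const]) (rule filterlim_at_bot_imp_at_infinity[OF ln_at_0])
  have ev: "eventually (\<lambda>t. 0 < t \<and> t < s) (at_right 0)" if "s > 0" for s :: real
    using that by (auto simp: eventually_at_right[of 0 1])
  obtain c t\<^sub>0 where c: "c > 0" "t\<^sub>0 > 0" "\<And>t. 0 < t \<Longrightarrow> t < t\<^sub>0 \<Longrightarrow> c * t powr D \<le> f t"
    using lower by blast
  have up: "ln (f t) / ln t \<le> D + ln c / ln t" and pos: "0 < f t"
    if t: "0 < t" "t < min t\<^sub>0 1" for t
  proof -
    have 1: "c * t powr D \<le> f t" using c(3)[of t] t by simp
    have 2: "0 < c * t powr D" using c t by simp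
    show "0 < f t" using 1 2 by simp
    have "ln c + D * ln t = ln (c * t powr D)" using c t by (simp add: ln_mult ln_powr)
    also have "\<dots> \<le> ln (f t)" using 1 2 by simp
    finally show "ln (f t) / ln t \<le> D + ln c / ln t" using t by (simp add: field_simps)
  qed
  show ?thesis
  proof (rule order_tendstoI)
    fix a assume a: "a > D"
    have "eventually (\<lambda>t. ln c / ln t < a - D) (at_right 0)"
      using order_tendstoD(2)[OF lim] a by simp
    moreover have "eventually (\<lambda>t. 0 < t \<and> t < min t\<^sub>0 1) (at_right 0)" using c by (intro ev) auto
    ultimately show "eventually (\<lambda>t. ln (f t) / ln t < a) (at_right 0)"
    proof eventually_elim
      case (elim t)
      then show ?case using up[of t] by linarith
    qed
  next
    fix a assume a: "a < D"
    \<comment> \<open>Half of the gap is spent on the exponent, the other half absorbs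
      \<open>ln C / ln t\<close>.\<close>
    define \<delta> where "\<delta> = (D - a) / 2"
    have \<delta>: "\<delta> > 0" using a by (simp add: \<delta>_def)
    obtain C t\<^sub>1 where C: "C > 0" "t\<^sub>1 > 0" "\<And>t. 0 < t \<Longrightarrow> t < t\<^sub>1 \<Longrightarrow> f t \<le> C * t powr (D - \<delta>)"
      using upper[OF \<delta>] by blast
    have "eventually (\<lambda>t. - \<delta> < ln C / ln t) (at_right 0)"
      using order_tendstoD(1)[OF lim] \<delta> by simp
    moreover have "eventually (\<lambda>t. 0 < t \<and> t < min t\<^sub>1 (min t\<^sub>0 1)) (at_right 0)"
      using c C by (intro ev) auto
    ultimately show "eventually (\<lambda>t. a < ln (f t) / ln t) (at_right 0)"
    proof eventually_elim
      case (elim t)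
      have "ln (f t) \<le> ln (C * t powr (D - \<delta>))" using elim C(3)[of t] pos[of t] by simp
      also have "\<dots> = ln C + (D - \<delta>) * ln t" using C elim by (simp add: ln_mult ln_powr)
      finally have "(ln C + (D - \<delta>) * ln t) / ln t \<le> ln (f t) / ln t"
        using elim by (intro divide_right_mono_neg) auto
      hence "(D - \<delta>) + ln C / ln t \<le> ln (f t) / ln t" using elim by (simp add: add_divide_distrib)
      moreover have "a = (D - \<delta>) - \<delta>" by (simp add: \<delta>_def field_simps)
      ultimately show ?case using elim by linarith
    qed
  qed
qed

section \<open>Row vectors of masses along paths\<close>

lemma linear_order_minimum:
  assumes "linear_order_on A r" "finite V" "V \<noteq> {}" "V \<subseteq> A"
  shows "\<exists>m\<in>V. \<forall>v\<in>V. (m, v) \<in> r"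
  using assms(2,3,4)
proof (induction V rule: finite_ne_induct)
  case (singleton x)
  then show ?case using assms(1)
    by (auto simp: linear_order_on_def partial_order_on_def preorder_on_def refl_on_def)
next
  case (insert x F)
  then obtain m where m: "m \<in> F" "\<forall>v\<in>F. (m, v) \<in> r" by auto
  have tr: "trans r" and tot: "total_on A r" and rf: "\<forall>x\<in>A. (x, x) \<in> r"
    using assms(1) by (auto simp: linear_order_on_def partial_order_on_def preorder_on_def refl_on_def)
  have "(x, m) \<in> r \<or> (m, x) \<in> r" using tot rf insert.prems m(1) by (cases "x = m") (auto simp: total_on_def)
  then show ?case
  proof
    assume "(x, m) \<in> r"
    hence "\<forall>v\<in>insert x F. (x, v) \<in> r" using m(2) rf insert.prems transD[OF tr] by blast
    thus ?thesis by blast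
  next
    assume "(m, x) \<in> r"
    thus ?thesis using m by blast
  qed
qed

text \<open>Justifies the definite description in \<open>enum_nbs\<close>. Every sorted enumeration
  must begin with the least element, and the rest is unique by induction.\<close>

lemma ex1_sorted_enumeration:
  assumes "linear_order_on A r" "finite V" "V \<subseteq> A"
  shows "\<exists>!fs. set fs = V \<and> distinct fs \<and> sorted_wrt (\<lambda>f g. (f, g) \<in> r) fs"
  using assms(2,3)
proof (induction "card V" arbitrary: V)
  case 0
  then show ?case by (intro ex1I[of _ "[]"]) auto
next
  case (Suc n)
  hence "V \<noteq> {}" by auto
  from linear_order_minimum[OF assms(1) Suc.prems(1) this Suc.prems(2)]
  obtain m where m: "m \<in> V" "\<forall>v\<in>V. (m, v) \<in> r" by blast
  have anti: "antisym r" using assms(1) by (auto simp: linear_order_on_def partial_order_on_def)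
  have "\<exists>!fs. set fs = V - {m} \<and> distinct fs \<and> sorted_wrt (\<lambda>f g. (f, g) \<in> r) fs"
    using Suc.hyps(2) Suc.prems m(1) by (intro Suc.hyps(1)) auto
  then obtain fs where fs: "set fs = V - {m} \<and> distinct fs \<and> sorted_wrt (\<lambda>f g. (f, g) \<in> r) fs"
    and uniq: "\<forall>gs. set gs = V - {m} \<and> distinct gs \<and> sorted_wrt (\<lambda>f g. (f, g) \<in> r) gs \<longrightarrow> gs = fs"
    by (rule ex1E)
  show ?case
  proof (rule ex1I[of _ "m # fs"])
    show "set (m # fs) = V \<and> distinct (m # fs) \<and> sorted_wrt (\<lambda>f g. (f, g) \<in> r) (m # fs)"
      using fs m by auto
    fix gs assume gs: "set gs = V \<and> distinct gs \<and> sorted_wrt (\<lambda>f g. (f, g) \<in> r) gs"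
    then obtain g gs' where g: "gs = g # gs'" using m(1) by (cases gs) auto
    have "g = m"
    proof (rule ccontr)
      assume "g \<noteq> m"
      hence "m \<in> set gs'" using gs g m(1) by auto
      hence "(g, m) \<in> r" using gs g by auto
      moreover have "(m, g) \<in> r" using m(2) gs g by auto
      ultimately show False using \<open>g \<noteq> m\<close> anti by (auto simp: antisym_def)
    qed
    thus "gs = m # fs" using gs g uniq[rule_format, of gs'] by auto
  qed
qed

lemma enum_nbs_spec:
  assumes "linear_order_on A ord" "finite V" "V \<subseteq> A"
  shows "set (enum_nbs ord V) = V" "distinct (enum_nbs ord V)"
  using theI'[OF ex1_sorted_enumeration[OF assms]] unfolding enum_nbs_def by auto

lemma path_mat_single [simp]: "path_mat \<Phi> K p \<mu> ord [e] = trans_mat \<Phi> K p \<mu> ord e"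
  by (simp add: path_mat_def)

lemma path_mat_snoc:
  "\<eta> \<noteq> [] \<Longrightarrow> path_mat \<Phi> K p \<mu> ord (\<eta> @ [e]) = path_mat \<Phi> K p \<mu> ord \<eta> * trans_mat \<Phi> K p \<mu> ord e"
  by (cases \<eta>) (simp_all add: path_mat_def)

locale ordered_setup = self_similar_setup +
  fixes ord :: "((real \<Rightarrow> real) \<times> (real \<Rightarrow> real)) set"
  assumes linear: "linear_order_on (all_nbs \<Phi> K) ord"
begin

abbreviation "E \<Delta> \<equiv> enum_nbs ord (V \<Delta>)"
abbreviation "M \<equiv> trans_mat \<Phi> K p \<mu> ord"
abbreviation "PM \<equiv> path_mat \<Phi> K p \<mu> ord"
abbreviation "N \<Delta> \<equiv> length (E \<Delta>)"

lemma enum: assumes "net \<Delta>" shows "set (E \<Delta>) = V \<Delta>" "distinct (E \<Delta>)"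
  using enum_nbs_spec[OF linear finite_nbs[OF assms]] assms by (auto simp: all_nbs_def)

lemma N_pos: "net \<Delta> \<Longrightarrow> 0 < N \<Delta>"
  using enum(1) nbs_nonempty by fastforce

lemma sum_enum:
  assumes "net \<Delta>"
  shows "(\<Sum>f\<in>V \<Delta>. h f) = (\<Sum>i<N \<Delta>. h (E \<Delta> ! i))"
proof -
  have "bij_betw ((!) (E \<Delta>)) {..<N \<Delta>} (V \<Delta>)"
    using enum[OF assms] by (intro bij_betw_nth) auto
  from sum.reindex_bij_betw[OF this, of h] show ?thesis by simp
qed

definition row :: "gen_ivl \<Rightarrow> real Matrix.mat" where
  "row \<Delta> = Matrix.mat 1 (N \<Delta>) (\<lambda>(_, j). Q \<Delta> (E \<Delta> ! j))"

lemma row_carrier [simp]: "row \<Delta> \<in> carrier_mat 1 (N \<Delta>)"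
  by (simp add: row_def)

lemma row_pos: "net \<Delta> \<Longrightarrow> j < N \<Delta> \<Longrightarrow> 0 < row \<Delta> $$ (0, j)"
  using Q_pos enum(1) nth_mem by (fastforce simp: row_def)

lemma sum_row:
  assumes "net \<Delta>"
  shows "(\<Sum>j<N \<Delta>. row \<Delta> $$ (0, j)) = measure \<mu> {lft \<Delta><..<rgt \<Delta>}"
  using sum_Q[OF assms] sum_enum[OF assms, of "Q \<Delta>"] by (simp add: row_def)

lemma trans_mat_carrier: "child \<Delta> \<Delta>' \<Longrightarrow> M (edge_btw \<Phi> K \<Delta> \<Delta>') \<in> carrier_mat (N \<Delta>) (N \<Delta>')"
  by (simp add: trans_mat_eq)

lemma trans_mat_nonneg:
  "child \<Delta> \<Delta>' \<Longrightarrow> i < N \<Delta> \<Longrightarrow> j < N \<Delta>' \<Longrightarrow> 0 \<le> M (edge_btw \<Phi> K \<Delta> \<Delta>') $$ (i, j)"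
  by (simp add: trans_mat_eq trans_entry_nonneg)

lemma row_step:
  assumes "child \<Delta> \<Delta>'"
  shows "row \<Delta>' = row \<Delta> * M (edge_btw \<Phi> K \<Delta> \<Delta>')"
proof (rule eq_matI)
  fix i j assume "i < dim_row (row \<Delta> * M (edge_btw \<Phi> K \<Delta> \<Delta>'))" "j < dim_col (row \<Delta> * M (edge_btw \<Phi> K \<Delta> \<Delta>'))"
  hence ij: "i = 0" "j < N \<Delta>'" using trans_mat_carrier[OF assms] by (auto simp: row_def)
  note net = childD(1,2)[OF assms]
  have E: "E \<Delta>' ! j \<in> V \<Delta>'" using enum(1)[OF net(2)] ij nth_mem by blast
  have "Q \<Delta>' (E \<Delta>' ! j) = (\<Sum>i<N \<Delta>. Q \<Delta> (E \<Delta> ! i) * trans_entry \<Phi> K p \<mu> \<Delta> \<Delta>' (E \<Delta> ! i) (E \<Delta>' ! j))"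
    unfolding Q_step[OF assms E] by (rule sum_enum[OF net(1)])
  thus "row \<Delta>' $$ (i, j) = (row \<Delta> * M (edge_btw \<Phi> K \<Delta> \<Delta>')) $$ (i, j)"
    using ij by (auto simp: row_def trans_mat_eq[OF assms] scalar_prod_def intro!: sum.cong)
qed (use trans_mat_carrier[OF assms] in \<open>auto simp: row_def\<close>)

text \<open>A path of \<open>Suc m\<close> edges, since the product is meaningful only for nonempty
  paths. Dimensions, signs and the transport of masses are proved together because the induction
  step for the last two uses the dimensions.\<close>

lemma row_path:
  assumes ch: "\<And>k. child (\<Delta> k) (\<Delta> (Suc k))"
  defines "\<eta> \<equiv> \<lambda>n m. map (\<lambda>k. edge_btw \<Phi> K (\<Delta> k) (\<Delta> (Suc k))) [n..<n + Suc m]"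
  shows "PM (\<eta> n m) \<in> carrier_mat (N (\<Delta> n)) (N (\<Delta> (n + Suc m)))"
    and "i < N (\<Delta> n) \<Longrightarrow> j < N (\<Delta> (n + Suc m)) \<Longrightarrow> 0 \<le> PM (\<eta> n m) $$ (i, j)"
    and "row (\<Delta> (n + Suc m)) = row (\<Delta> n) * PM (\<eta> n m)"
proof (induction m arbitrary: i j)
  case 0
  have "\<eta> n 0 = [edge_btw \<Phi> K (\<Delta> n) (\<Delta> (Suc n))]" by (simp add: \<eta>_def)
  moreover case 1
  ultimately show ?case using trans_mat_carrier[OF ch] by simp
next
  case 0
  have "\<eta> n 0 = [edge_btw \<Phi> K (\<Delta> n) (\<Delta> (Suc n))]" by (simp add: \<eta>_def)
  moreover case 2
  ultimately show ?case using trans_mat_nonneg[OF ch] by simp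
next
  case 0
  have "\<eta> n 0 = [edge_btw \<Phi> K (\<Delta> n) (\<Delta> (Suc n))]" by (simp add: \<eta>_def)
  moreover case 3
  ultimately show ?case using row_step[OF ch] by simp
next
  case (Suc m)
  define e where "e = edge_btw \<Phi> K (\<Delta> (n + Suc m)) (\<Delta> (n + Suc (Suc m)))"
  have \<eta>: "\<eta> n (Suc m) = \<eta> n m @ [e]" "\<eta> n m \<noteq> []" by (simp_all add: \<eta>_def e_def)
  have e: "M e \<in> carrier_mat (N (\<Delta> (n + Suc m))) (N (\<Delta> (n + Suc (Suc m))))"
    unfolding e_def using trans_mat_carrier[OF ch[of "n + Suc m"]] by simp
  have enn: "0 \<le> M e $$ (i, j)" if "i < N (\<Delta> (n + Suc m))" "j < N (\<Delta> (n + Suc (Suc m)))" for i j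
    unfolding e_def using trans_mat_nonneg[OF ch[of "n + Suc m"], of i j] that by simp
  have PM: "PM (\<eta> n (Suc m)) = PM (\<eta> n m) * M e" using path_mat_snoc[OF \<eta>(2)] \<eta>(1) by simp
  {
    case 1
    show ?case unfolding PM using Suc.IH(1) e by simp
  next
    case 2
    have "(PM (\<eta> n m) * M e) $$ (i, j) = (\<Sum>k<N (\<Delta> (n + Suc m)). PM (\<eta> n m) $$ (i, k) * M e $$ (k, j))"
      using 2 Suc.IH(1) e by (auto simp: scalar_prod_def intro!: sum.cong)
    also have "\<dots> \<ge> 0" using 2 Suc.IH(2) enn by (intro sum_nonneg mult_nonneg_nonneg) auto
    finally show ?case unfolding PM .
  next
    case 3
    have "row (\<Delta> (n + Suc (Suc m))) = row (\<Delta> (n + Suc m)) * M e"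
      unfolding e_def using row_step[OF ch[of "n + Suc m"]] by simp
    also have "\<dots> = row (\<Delta> n) * (PM (\<eta> n m) * M e)"
      unfolding Suc.IH(3) using Suc.IH(1) e by (intro assoc_mult_mat[OF row_carrier]) auto
    finally show ?case unfolding PM .
  }
qed

end

text \<open>Below 1 a larger exponent gives a smaller power. This turns a bound coming from another
  period into one with the minimal quotient.\<close>

lemma powr_bound_mono:
  fixes g :: "real \<Rightarrow> real"
  assumes "\<exists>C>0. \<exists>t\<^sub>0>0. \<forall>t. 0 < t \<longrightarrow> t < t\<^sub>0 \<longrightarrow> g t \<le> C * t powr a" "b \<le> a"
  shows "\<exists>C>0. \<exists>t\<^sub>0>0. \<forall>t. 0 < t \<longrightarrow> t < t\<^sub>0 \<longrightarrow> g t \<le> C * t powr b"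
proof -
  obtain C t\<^sub>0 where C: "C > 0" "t\<^sub>0 > 0" "\<And>t. 0 < t \<Longrightarrow> t < t\<^sub>0 \<Longrightarrow> g t \<le> C * t powr a" using assms(1) by blast
  have "g t \<le> C * t powr b" if "0 < t" "t < min t\<^sub>0 1" for t
  proof -
    have "g t \<le> C * t powr a" using C(3) that by simp
    also have "\<dots> \<le> C * t powr b" using C(1) that assms(2) by (intro mult_left_mono powr_mono') auto
    finally show ?thesis .
  qed
  thus ?thesis using C by (intro exI[of _ C] conjI exI[of _ "min t\<^sub>0 1"]) auto
qed

context self_similar_setup
begin

section \<open>Chains of net intervals\<close>

lemma chain_mono:
  assumes "\<And>k. child (\<Delta> k) (\<Delta> (Suc k))" "i \<le> j"
  shows "lft (\<Delta> i) \<le> lft (\<Delta> j)" "rgt (\<Delta> j) \<le> rgt (\<Delta> i)"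
  using assms(2)
proof (induction j rule: dec_induct)
  case (step j)
  show "lft (\<Delta> i) \<le> lft (\<Delta> (Suc j))" "rgt (\<Delta> (Suc j)) \<le> rgt (\<Delta> i)"
    using step.IH childD(4,5)[OF assms(1)[of j]] by linarith+
qed auto

text \<open>The generations of a chain are ratios of prefixes of the finitely many words
  of a fixed generation, as long as they exceed it.\<close>

lemma chain_gen_small:
  assumes ch: "\<And>k. child (\<Delta> k) (\<Delta> (Suc k))" and "\<epsilon> > 0"
  shows "\<exists>k. gen (\<Delta> k) < \<epsilon>"
proof (rule ccontr)
  assume "\<not> ?thesis"
  hence ge: "\<epsilon> \<le> gen (\<Delta> k)" for k by (simp add: not_less)
  define F where "F = (\<lambda>(\<tau>, j). \<bar>\<rho> (take j \<tau>)\<bar>) ` (SIGMA \<tau>:\<Lambda> \<epsilon>. {..length \<tau>})"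
  have "finite F" unfolding F_def using finite_words_at[OF assms(2)] by auto
  have net: "net (\<Delta> k)" for k using childD(1)[OF ch] .
  have gen_Suc: "gen (\<Delta> (Suc k)) = TG (\<Delta> k)" for k using childD(3)[OF ch] .
  have "gen (\<Delta> (Suc k)) \<in> F" for k
  proof -
    obtain \<sigma> f where \<sigma>: "generated (\<Delta> k) \<sigma> f" "TG (\<Delta> k) = \<bar>\<rho> \<sigma>\<bar>" using tg_attained[OF net] by blast
    have pos: "0 < \<bar>\<rho> \<sigma>\<bar>" using generates_rat_pos[OF \<sigma>(1)] .
    have \<sigma>1: "\<sigma> \<in> \<Lambda> (gen (\<Delta> k))" using \<sigma> by (simp add: generates_def)
    \<comment> \<open>Covering a point of K provides some word of this generation; it prolongs
      \<open>\<sigma>\<close> to a word of generation \<open>\<epsilon>\<close>.\<close>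
    obtain \<tau> where "\<tau> \<in> \<Lambda> (\<epsilon> / \<bar>\<rho> \<sigma>\<bar>)"
      using words_at_cover[OF _ zero_in_K, of "\<epsilon> / \<bar>\<rho> \<sigma>\<bar>"] pos assms(2) by auto
    hence "\<sigma> @ \<tau> \<in> \<Lambda> \<epsilon>" using words_at_append_iff[OF \<sigma>1 assms(2) ge] by simp
    hence "(\<sigma> @ \<tau>, length \<sigma>) \<in> (SIGMA \<tau>:\<Lambda> \<epsilon>. {..length \<tau>})" by simp
    hence "(\<lambda>(\<tau>, j). \<bar>\<rho> (take j \<tau>)\<bar>) (\<sigma> @ \<tau>, length \<sigma>) \<in> F" unfolding F_def by (rule imageI)
    thus ?thesis using gen_Suc \<sigma>(2) by simp
  qed
  hence "finite (range (\<lambda>k. gen (\<Delta> (Suc k))))" using \<open>finite F\<close> by (auto intro: finite_subset)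
  \<comment> \<open>Generations strictly decrease along a chain, so they cannot repeat.\<close>
  moreover have "inj (\<lambda>k. gen (\<Delta> (Suc k)))"
  proof -
    have "strict_mono (\<lambda>k. - gen (\<Delta> (Suc k)))"
      unfolding strict_mono_Suc_iff
    proof
      fix m
      show "- gen (\<Delta> (Suc m)) < - gen (\<Delta> (Suc (Suc m)))"
        using tg_bounds(2)[OF net, of "Suc m"] gen_Suc[of "Suc m"] by simp
    qed
    hence "inj (\<lambda>k. - gen (\<Delta> (Suc k)))" by (rule strict_mono_imp_inj_on)
    thus ?thesis by (simp add: inj_def)
  qed
  ultimately have "finite (UNIV :: nat set)" by (rule finite_imageD)
  thus False by simp
qed

lemma chain_inter:
  assumes ch: "\<And>k. child (\<Delta> k) (\<Delta> (Suc k))" and x: "\<And>k. lft (\<Delta> k) \<le> x \<and> x \<le> rgt (\<Delta> k)"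
  shows "{x} = (\<Inter>k. {lft (\<Delta> k)..rgt (\<Delta> k)})"
proof (intro equalityI subsetI)
  fix y assume y: "y \<in> (\<Inter>k. {lft (\<Delta> k)..rgt (\<Delta> k)})"
  show "y \<in> {x}"
  proof (rule ccontr)
    assume "y \<notin> {x}"
    hence "\<bar>y - x\<bar> > 0" by simp
    then obtain k where k: "gen (\<Delta> k) < \<bar>y - x\<bar>" using chain_gen_small[where \<Delta> = \<Delta>, OF ch] by blast
    have "diam_ivl (\<Delta> k) < gen (\<Delta> k)" using diam_less_gen childD(1)[OF ch] by blast
    moreover have "lft (\<Delta> k) \<le> y" "y \<le> rgt (\<Delta> k)" using y by auto
    ultimately show False using k x[of k] by (auto simp: diam_ivl_def abs_if split: if_splits)
  qed
qed (use x in auto)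

text \<open>The generation 2 is an arbitrary number above 1, where the empty word is the only
  one.\<close>

lemma net_root:
  assumes "{0<..<1} \<inter> K \<noteq> {}"
  shows "net (Gen_Ivl 2 0 1)"
proof -
  have "end_pts \<Phi> 2 = {0, 1}" by (simp add: end_pts_def words_at_gt_1)
  thus ?thesis using assms by (simp add: net_interval_def)
qed

text \<open>\<open>A\<close> is the invariant by which one child is selected in each step; the two
  side chains below differ only in its choice.\<close>

lemma chainI:
  assumes base: "A (Gen_Ivl 2 0 1)" and bound: "\<And>\<Delta>. A \<Delta> \<Longrightarrow> lft \<Delta> \<le> x \<and> x \<le> rgt \<Delta>"
    and step: "\<And>\<Delta>. A \<Delta> \<Longrightarrow> \<exists>\<Delta>'. A \<Delta>' \<and> child \<Delta> \<Delta>'"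
  shows "\<exists>\<Delta>. (\<forall>k. A (\<Delta> k) \<and> child (\<Delta> k) (\<Delta> (Suc k))) \<and>
    symbolic_rep \<Phi> K x (\<lambda>k. edge_btw \<Phi> K (\<Delta> k) (\<Delta> (Suc k))) \<and>
    {x} = (\<Inter>k. {lft (\<Delta> k)..rgt (\<Delta> k)})"
proof -
  have "\<exists>\<Delta>. \<forall>n. (A (\<Delta> n) \<and> (n = 0 \<longrightarrow> \<Delta> n = Gen_Ivl 2 0 1)) \<and> child (\<Delta> n) (\<Delta> (Suc n))"
    by (rule dependent_nat_choice) (use base step in auto)
  then obtain \<Delta> where \<Delta>: "\<And>k. A (\<Delta> k)" "\<Delta> 0 = Gen_Ivl 2 0 1" "\<And>k. child (\<Delta> k) (\<Delta> (Suc k))"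
    by blast
  have inter: "{x} = (\<Inter>k. {lft (\<Delta> k)..rgt (\<Delta> k)})"
    by (rule chain_inter[of \<Delta>, OF \<Delta>(3) bound[OF \<Delta>(1)]])
  have "symbolic_rep \<Phi> K x (\<lambda>k. edge_btw \<Phi> K (\<Delta> k) (\<Delta> (Suc k)))"
    unfolding symbolic_rep_def using \<Delta>(2,3) inter by (intro exI[of _ \<Delta>]) simp
  thus ?thesis using \<Delta> inter by blast
qed

text \<open>Strictness of \<open>lft \<Delta> < x\<close> keeps every interval reaching to the left
  of x. Accumulation of K from the left guarantees that the gap selected next to x has points of K
  in its interior, even when x is its right end.\<close>

lemma left_chain:
  assumes acc: "\<And>\<eta>. \<eta> > 0 \<Longrightarrow> {x - \<eta><..<x} \<inter> K \<noteq> {}" and x: "x \<in> K"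
  shows "\<exists>\<Delta>. (\<forall>k. child (\<Delta> k) (\<Delta> (Suc k)) \<and> lft (\<Delta> k) < x) \<and>
    symbolic_rep \<Phi> K x (\<lambda>k. edge_btw \<Phi> K (\<Delta> k) (\<Delta> (Suc k))) \<and>
    {x} = (\<Inter>k. {lft (\<Delta> k)..rgt (\<Delta> k)})"
proof -
  define A where "A = (\<lambda>\<Delta>. net \<Delta> \<and> lft \<Delta> < x \<and> x \<le> rgt \<Delta>)"
  obtain y where y: "y \<in> K" "y < x" using acc[of 1] by auto
  have x01: "0 < x" "x \<le> 1" using x y K_subset by force+
  have "{x - x<..<x} \<subseteq> {0<..<1}" using x01 by auto
  hence "{0<..<1} \<inter> K \<noteq> {}" using acc[OF x01(1)] by blast
  hence base: "A (Gen_Ivl 2 0 1)" using net_root x01 by (simp add: A_def)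
  have step: "\<exists>\<Delta>'. A \<Delta>' \<and> child \<Delta> \<Delta>'" if "A \<Delta>" for \<Delta>
  proof -
    have \<Delta>: "net \<Delta>" "lft \<Delta> < x" "x \<le> rgt \<Delta>" using that by (auto simp: A_def)
    define H where "H = end_pts \<Phi> (TG \<Delta>)"
    have finH: "finite H" unfolding H_def using finite_end_pts tg_bounds(1)[OF \<Delta>(1)] .
    have ends: "lft \<Delta> \<in> H" "rgt \<Delta> \<in> H"
      using end_pts_antimono[of "TG \<Delta>" "gen \<Delta>"] tg_bounds[OF \<Delta>(1)] \<Delta>(1)
      by (auto simp: H_def net_interval_def)
    \<comment> \<open>The child is the gap between consecutive end points around x, where x itself
      counts as a right end.\<close>
    define a where "a = Max {h \<in> H. h < x}"
    define b where "b = Min {h \<in> H. x \<le> h}"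
    have "a \<in> {h \<in> H. h < x}" unfolding a_def using finH ends(1) \<Delta>(2) by (intro Max_in) auto
    hence a: "a \<in> H" "a < x" by auto
    have "b \<in> {h \<in> H. x \<le> h}" unfolding b_def using finH ends(2) \<Delta>(3) by (intro Min_in) auto
    hence b: "b \<in> H" "x \<le> b" by auto
    have a_max: "h \<le> a" if "h \<in> H" "h < x" for h unfolding a_def using that finH by (intro Max_ge) auto
    have b_min: "b \<le> h" if "h \<in> H" "x \<le> h" for h unfolding b_def using that finH by (intro Min_le) auto
    have gap: "{a<..<b} \<inter> H = {}"
    proof (intro equals0I)
      fix h assume "h \<in> {a<..<b} \<inter> H"
      thus False using a_max[of h] b_min[of h] by (cases "h < x") auto
    qed
    have "{a<..<x} \<inter> K \<noteq> {}" using acc[of "x - a"] a by simp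
    moreover have "{a<..<x} \<subseteq> {a<..<b}" using b by auto
    ultimately have "{a<..<b} \<inter> K \<noteq> {}" by blast
    hence "net (Gen_Ivl (TG \<Delta>) a b)"
      using gap a b tg_bounds[OF \<Delta>(1)] by (simp add: net_interval_def H_def)
    moreover have "lft \<Delta> \<le> a" "b \<le> rgt \<Delta>" using a_max[OF ends(1) \<Delta>(2)] b_min[OF ends(2) \<Delta>(3)] .
    ultimately show ?thesis using \<Delta> a b
      by (intro exI[of _ "Gen_Ivl (TG \<Delta>) a b"]) (auto simp: A_def child_of_def)
  qed
  have bound: "lft \<Delta> \<le> x \<and> x \<le> rgt \<Delta>" if "A \<Delta>" for \<Delta> using that by (simp add: A_def)
  from chainI[of A x, OF base bound step] show ?thesis by (auto simp: A_def)
qed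

text \<open>The mirror image: strict and weak inequalities are exchanged, so that x now counts as a
  left end.\<close>

lemma right_chain:
  assumes acc: "\<And>\<eta>. \<eta> > 0 \<Longrightarrow> {x<..<x + \<eta>} \<inter> K \<noteq> {}" and x: "x \<in> K"
  shows "\<exists>\<Delta>. (\<forall>k. child (\<Delta> k) (\<Delta> (Suc k)) \<and> x < rgt (\<Delta> k)) \<and>
    symbolic_rep \<Phi> K x (\<lambda>k. edge_btw \<Phi> K (\<Delta> k) (\<Delta> (Suc k))) \<and>
    {x} = (\<Inter>k. {lft (\<Delta> k)..rgt (\<Delta> k)})"
proof -
  define A where "A = (\<lambda>\<Delta>. net \<Delta> \<and> lft \<Delta> \<le> x \<and> x < rgt \<Delta>)"
  obtain y where y: "y \<in> K" "x < y" using acc[of 1] by auto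
  have x01: "0 \<le> x" "x < 1" using x y K_subset by force+
  have "{x<..<1} \<subseteq> {0<..<1}" using x01 by auto
  moreover have "{x<..<1} \<inter> K \<noteq> {}" using acc[of "1 - x"] x01 by simp
  ultimately have "{0<..<1} \<inter> K \<noteq> {}" by blast
  hence base: "A (Gen_Ivl 2 0 1)" using net_root x01 by (simp add: A_def)
  have step: "\<exists>\<Delta>'. A \<Delta>' \<and> child \<Delta> \<Delta>'" if "A \<Delta>" for \<Delta>
  proof -
    have \<Delta>: "net \<Delta>" "lft \<Delta> \<le> x" "x < rgt \<Delta>" using that by (auto simp: A_def)
    define H where "H = end_pts \<Phi> (TG \<Delta>)"
    have finH: "finite H" unfolding H_def using finite_end_pts tg_bounds(1)[OF \<Delta>(1)] .
    have ends: "lft \<Delta> \<in> H" "rgt \<Delta> \<in> H"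
      using end_pts_antimono[of "TG \<Delta>" "gen \<Delta>"] tg_bounds[OF \<Delta>(1)] \<Delta>(1)
      by (auto simp: H_def net_interval_def)
    define a where "a = Max {h \<in> H. h \<le> x}"
    define b where "b = Min {h \<in> H. x < h}"
    have "a \<in> {h \<in> H. h \<le> x}" unfolding a_def using finH ends(1) \<Delta>(2) by (intro Max_in) auto
    hence a: "a \<in> H" "a \<le> x" by auto
    have "b \<in> {h \<in> H. x < h}" unfolding b_def using finH ends(2) \<Delta>(3) by (intro Min_in) auto
    hence b: "b \<in> H" "x < b" by auto
    have a_max: "h \<le> a" if "h \<in> H" "h \<le> x" for h unfolding a_def using that finH by (intro Max_ge) auto
    have b_min: "b \<le> h" if "h \<in> H" "x < h" for h unfolding b_def using that finH by (intro Min_le) auto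
    have gap: "{a<..<b} \<inter> H = {}"
    proof (intro equals0I)
      fix h assume "h \<in> {a<..<b} \<inter> H"
      thus False using a_max[of h] b_min[of h] by (cases "h \<le> x") auto
    qed
    have "{x<..<b} \<inter> K \<noteq> {}" using acc[of "b - x"] b by simp
    moreover have "{x<..<b} \<subseteq> {a<..<b}" using a by auto
    ultimately have "{a<..<b} \<inter> K \<noteq> {}" by blast
    hence "net (Gen_Ivl (TG \<Delta>) a b)"
      using gap a b tg_bounds[OF \<Delta>(1)] by (simp add: net_interval_def H_def)
    moreover have "lft \<Delta> \<le> a" "b \<le> rgt \<Delta>" using a_max[OF ends(1) \<Delta>(2)] b_min[OF ends(2) \<Delta>(3)] .
    ultimately show ?thesis using \<Delta> a b
      by (intro exI[of _ "Gen_Ivl (TG \<Delta>) a b"]) (auto simp: A_def child_of_def)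
  qed
  have bound: "lft \<Delta> \<le> x \<and> x \<le> rgt \<Delta>" if "A \<Delta>" for \<Delta> using that by (simp add: A_def)
  from chainI[of A x, OF base bound step] show ?thesis by (auto simp: A_def)
qed

end

section \<open>Chains with an eventually periodic sequence of edges\<close>

locale periodic_chain = ordered_setup +
  fixes \<Delta> :: "nat \<Rightarrow> gen_ivl" and x :: real and n :: nat and \<theta> :: "edge list"
  assumes child: "\<And>k. child (\<Delta> k) (\<Delta> (Suc k))"
    and inter: "{x} = (\<Inter>k. {lft (\<Delta> k)..rgt (\<Delta> k)})"
    and periodic: "ev_periodic_form \<Phi> K (\<lambda>k. edge_btw \<Phi> K (\<Delta> k) (\<Delta> (Suc k))) n \<theta>"
begin

abbreviation "s \<equiv> length \<theta>"
abbreviation "e k \<equiv> edge_btw \<Phi> K (\<Delta> k) (\<Delta> (Suc k))"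
abbreviation "l \<equiv> path_len \<Phi> K \<theta>"
abbreviation "r \<equiv> real_spectral_radius (path_mat \<Phi> K p \<mu> ord \<theta>)"

lemma net: "net (\<Delta> k)"
  using childD(1)[OF child] .

lemma s_pos: "0 < s"
  using periodic by (auto simp: ev_periodic_form_def is_cycle_def is_path_def)

lemma edge_periodic: "e (n + (s + k)) = e (n + k)"
  using periodic by (auto simp: ev_periodic_form_def)

lemma edge_block: "map e [n + k * s..<n + k * s + s] = \<theta>"
proof (rule nth_equalityI)
  fix i assume i: "i < length (map e [n + k * s..<n + k * s + s])"
  have "e (n + (k * s + i)) = \<theta> ! ((k * s + i) mod s)"
    using periodic by (auto simp: ev_periodic_form_def)
  thus "map e [n + k * s..<n + k * s + s] ! i = \<theta> ! i" using i by (simp add: add.assoc)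
qed simp

lemma nbs_periodic: "V (\<Delta> (n + (s + k))) = V (\<Delta> (n + k))"
  using edge_periodic[of k] by (simp add: edge_btw_def)

lemma nbs_block: "V (\<Delta> (n + k * s)) = V (\<Delta> n)"
proof (induction k)
  case (Suc k)
  then show ?case using nbs_periodic[of "k * s"] by simp
qed simp

lemma tg_chain: "path_len \<Phi> K (map e [i..<i + m]) = TG (\<Delta> (i + m)) / TG (\<Delta> i)"
proof (induction m)
  case 0
  then show ?case using tg_bounds(1)[OF net, of i] by (simp add: path_len_def)
next
  case (Suc m)
  have "path_len \<Phi> K (map e [i..<i + Suc m]) = path_len \<Phi> K (map e [i..<i + m]) * edge_len \<Phi> K (e (i + m))"
    by (simp add: path_len_def)
  then show ?case using Suc edge_len_eq[OF child] tg_bounds(1)[OF net, of "i + m"] by simp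
qed

lemma l_eq: "l = TG (\<Delta> (n + s)) / TG (\<Delta> n)"
  using tg_chain[of n s] edge_block[of 0] by simp

lemma tg_less: "0 < m \<Longrightarrow> TG (\<Delta> (i + m)) < TG (\<Delta> i)"
proof (induction m)
  case (Suc m)
  have "TG (\<Delta> (i + Suc m)) < TG (\<Delta> (i + m))"
    using tg_bounds(2)[OF net, of "i + Suc m"] childD(3)[OF child, of "i + m"] by simp
  then show ?case using Suc by (cases "m = 0") auto
qed simp

lemma l_bounds: "0 < l" "l < 1"
  using tg_bounds(1)[OF net] tg_less[OF s_pos, of n] by (simp_all add: l_eq)

text \<open>The length of a cycle is a quotient of transition generations. The neighbour sets at
  both ends of a period agree, so the slopes cancel and it is also the quotient of the
  diameters.\<close>

lemma diam_block: "diam_ivl (\<Delta> (n + s)) = l * diam_ivl (\<Delta> n)"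
  using slope_max_pos[OF net[of n]] diam_pos[OF net[of n]] nbs_periodic[of 0]
  by (simp add: l_eq tg_eq[OF net])

lemma same_edge_periodic: "same_edge (\<Delta> (n + (s + k))) (\<Delta> (Suc (n + (s + k)))) (\<Delta> (n + k)) (\<Delta> (Suc (n + k)))"
  using child edge_periodic[of k] by (simp add: same_edge_def)

lemma diam_Suc: "diam_ivl (\<Delta> (Suc k)) = rel_diam (\<Delta> k) (\<Delta> (Suc k)) * diam_ivl (\<Delta> k)"
  using diam_pos[OF net, of k] by (simp add: rel_diam_def)

lemma lft_Suc: "lft (\<Delta> (Suc k)) = lft (\<Delta> k) + pos_index (\<Delta> k) (\<Delta> (Suc k)) * diam_ivl (\<Delta> k)"
  using diam_pos[OF net, of k] by (simp add: pos_index_def)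

lemma diam_periodic: "diam_ivl (\<Delta> (n + (s + k))) = l * diam_ivl (\<Delta> (n + k))"
proof (induction k)
  case (Suc k)
  then show ?case using diam_Suc[of "n + (s + k)"] diam_Suc[of "n + k"]
      same_edge_rel_diam[OF same_edge_periodic[of k]] by simp
qed (simp add: diam_block)

text \<open>The affine map which carries one period of the chain to the next, and therefore fixes
  \<open>x\<close>.\<close>

definition shift :: "real \<Rightarrow> real" where
  "shift y = lft (\<Delta> (n + s)) + l * (y - lft (\<Delta> n))"

lemma lft_periodic: "lft (\<Delta> (n + (s + k))) = shift (lft (\<Delta> (n + k)))"
proof (induction k)
  case (Suc k)
  have "pos_index (\<Delta> (n + (s + k))) (\<Delta> (Suc (n + (s + k)))) = pos_index (\<Delta> (n + k)) (\<Delta> (Suc (n + k)))"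
    using edge_periodic[of k] by (simp add: edge_btw_def)
  then show ?case using Suc lft_Suc[of "n + (s + k)"] lft_Suc[of "n + k"] diam_periodic[of k]
    by (simp add: shift_def algebra_simps)
qed (simp add: shift_def)

lemma rgt_periodic: "rgt (\<Delta> (n + (s + k))) = shift (rgt (\<Delta> (n + k)))"
  using lft_periodic[of k] diam_periodic[of k] by (simp add: diam_ivl_def shift_def algebra_simps)

lemma x_in: "lft (\<Delta> k) \<le> x" "x \<le> rgt (\<Delta> k)"
proof -
  have "x \<in> (\<Inter>k. {lft (\<Delta> k)..rgt (\<Delta> k)})" using inter by blast
  thus "lft (\<Delta> k) \<le> x" "x \<le> rgt (\<Delta> k)" by auto
qed

text \<open>The map carries each interval of the periodic tail onto the interval one period later,
  so the image of x lies in all of them, and their intersection is a single point.\<close>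

lemma shift_x: "shift x = x"
proof -
  have mono: "shift y \<le> shift z" if "y \<le> z" for y z
    using that l_bounds by (simp add: shift_def)
  have "shift x \<in> {lft (\<Delta> k)..rgt (\<Delta> k)}" for k
  proof -
    have "lft (\<Delta> k) \<le> lft (\<Delta> (n + (s + k)))" "rgt (\<Delta> (n + (s + k))) \<le> rgt (\<Delta> k)"
      using chain_mono[of \<Delta> k "n + (s + k)", OF child] by auto
    moreover have "lft (\<Delta> (n + (s + k))) \<le> shift x" "shift x \<le> rgt (\<Delta> (n + (s + k)))"
      unfolding lft_periodic rgt_periodic using mono x_in by auto
    ultimately show ?thesis by simp
  qed
  thus ?thesis using inter by blast
qed

lemma shift_diff: "shift y - shift z = l * (y - z)"
  by (simp add: shift_def algebra_simps)

lemma block_diam: "diam_ivl (\<Delta> (n + k * s)) = diam_ivl (\<Delta> n) * l ^ k"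
proof (induction k)
  case (Suc k)
  then show ?case using diam_periodic[of "k * s"] by simp
qed simp

lemma block_left: "x - lft (\<Delta> (n + k * s)) = (x - lft (\<Delta> n)) * l ^ k"
proof (induction k)
  case (Suc k)
  have "x - lft (\<Delta> (n + Suc k * s)) = shift x - shift (lft (\<Delta> (n + k * s)))"
    using lft_periodic[of "k * s"] by (simp add: shift_x)
  then show ?case using Suc by (simp add: shift_diff)
qed simp

lemma block_right: "rgt (\<Delta> (n + k * s)) - x = (rgt (\<Delta> n) - x) * l ^ k"
proof (induction k)
  case (Suc k)
  have "rgt (\<Delta> (n + Suc k * s)) - x = shift (rgt (\<Delta> (n + k * s))) - shift x"
    using rgt_periodic[of "k * s"] by (simp add: shift_x)
  then show ?case using Suc by (simp add: shift_diff)
qed simp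

lemma
  shows PM_carrier: "PM \<theta> \<in> carrier_mat (N (\<Delta> n)) (N (\<Delta> n))"
    and PM_nonneg: "i < N (\<Delta> n) \<Longrightarrow> j < N (\<Delta> n) \<Longrightarrow> 0 \<le> PM \<theta> $$ (i, j)"
    and row_block_Suc: "row (\<Delta> (n + Suc k * s)) = row (\<Delta> (n + k * s)) * PM \<theta>"
proof -
  \<comment> \<open>\<open>row_path\<close> counts edges as \<open>Suc m\<close>.\<close>
  obtain m where m: "s = Suc m" using s_pos by (cases s) auto
  note path = row_path[of \<Delta>, OF child, where m = m, folded m]
  \<comment> \<open>Equal neighbour sets have the same enumeration, so the matrix of the period is
    square and maps rows of a block to rows indexed alike.\<close>
  have [simp]: "V (\<Delta> (n + s)) = V (\<Delta> n)" using nbs_block[of 1] by simp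
  show "PM \<theta> \<in> carrier_mat (N (\<Delta> n)) (N (\<Delta> n))"
    using path(1)[of n] edge_block[of 0] by simp
  show "i < N (\<Delta> n) \<Longrightarrow> j < N (\<Delta> n) \<Longrightarrow> 0 \<le> PM \<theta> $$ (i, j)"
    using path(2)[of i n j] edge_block[of 0] by simp
  show "row (\<Delta> (n + Suc k * s)) = row (\<Delta> (n + k * s)) * PM \<theta>"
    using path(3)[of "n + k * s"] edge_block[of k] by (simp add: add_ac)
qed

lemma row_block: "row (\<Delta> (n + k * s)) = row (\<Delta> n) * PM \<theta> ^\<^sub>m k"
proof (induction k)
  case 0
  then show ?case using right_mult_one_mat[OF row_carrier, of "\<Delta> n"] PM_carrier by simp
next
  case (Suc k)
  then show ?case using row_block_Suc[of k] PM_carrier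
    by (simp add: assoc_mult_mat[OF row_carrier, of "PM \<theta> ^\<^sub>m k" "\<Delta> n" "N (\<Delta> n)" "PM \<theta>" "N (\<Delta> n)"])
qed

lemma measure_block:
  "measure \<mu> {lft (\<Delta> (n + k * s))<..<rgt (\<Delta> (n + k * s))} = (\<Sum>j<N (\<Delta> n). (row (\<Delta> n) * PM \<theta> ^\<^sub>m k) $$ (0, j))"
  using sum_row[OF net, of "n + k * s"] by (simp add: row_block nbs_block)

text \<open>The product is the row of masses one period later. Its positivity excludes spectral
  radius 0, for which the logarithm in the quotient would have no meaning.\<close>

lemma row_PM_pos: "j < N (\<Delta> n) \<Longrightarrow> 0 < (row (\<Delta> n) * PM \<theta>) $$ (0, j)"
  using row_pos[OF net, of j "n + 1 * s"] nbs_block[of 1] row_block_Suc[of 0] by simp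

lemma
  shows measure_block_lower:
      "\<exists>c>0. \<forall>k. c * r ^ k \<le> measure \<mu> {lft (\<Delta> (n + k * s))<..<rgt (\<Delta> (n + k * s))}"
    and measure_block_upper: "r < q \<Longrightarrow> 0 < q \<Longrightarrow>
      \<exists>c>0. \<forall>k. measure \<mu> {lft (\<Delta> (n + k * s))<..<rgt (\<Delta> (n + k * s))} \<le> c * q ^ k"
    and r_pos: "0 < r"
proof -
  note growth = row_pow_growth[OF PM_carrier N_pos[OF net] _ row_carrier, folded measure_block]
  show "\<exists>c>0. \<forall>k. c * r ^ k \<le> measure \<mu> {lft (\<Delta> (n + k * s))<..<rgt (\<Delta> (n + k * s))}"
    by (rule growth(1)) (auto intro: PM_nonneg row_pos[OF net] row_PM_pos)
  show "\<exists>c>0. \<forall>k. measure \<mu> {lft (\<Delta> (n + k * s))<..<rgt (\<Delta> (n + k * s))} \<le> c * q ^ k"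
    if "r < q" "0 < q"
    by (rule growth(2)) (use that in \<open>auto intro: PM_nonneg row_pos[OF net] row_PM_pos\<close>)
  show "0 < r"
    by (rule row_pow_growth(3)[OF PM_carrier N_pos[OF net] _ row_carrier])
      (auto intro: PM_nonneg row_pos[OF net] row_PM_pos)
qed

lemma measure_cball_lower:
  "\<exists>C>0. \<exists>t\<^sub>0>0. \<forall>t. 0 < t \<longrightarrow> t < t\<^sub>0 \<longrightarrow> C * t powr (ln r / ln l) \<le> measure \<mu> (cball x t)"
proof -
  obtain c where c: "c > 0" "\<And>k. c * r ^ k \<le> measure \<mu> {lft (\<Delta> (n + k * s))<..<rgt (\<Delta> (n + k * s))}"
    using measure_block_lower by blast
  have "c * r ^ k \<le> measure \<mu> (cball x t)" if "diam_ivl (\<Delta> n) * l ^ k \<le> t" for k t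
  proof -
    have "{lft (\<Delta> (n + k * s))<..<rgt (\<Delta> (n + k * s))} \<subseteq> cball x t"
      using that x_in[of "n + k * s"] unfolding block_diam[symmetric]
      by (auto simp: diam_ivl_def dist_real_def)
    hence "measure \<mu> {lft (\<Delta> (n + k * s))<..<rgt (\<Delta> (n + k * s))} \<le> measure \<mu> (cball x t)"
      by (intro finite_measure_mono) auto
    thus ?thesis using c(2)[of k] by linarith
  qed
  with geometric_lower_bound[OF l_bounds r_pos c(1) diam_pos[OF net], of n "\<lambda>t. measure \<mu> (cball x t)"]
  have "\<exists>C>0. \<forall>t. 0 < t \<longrightarrow> t < diam_ivl (\<Delta> n) \<longrightarrow> C * t powr (ln r / ln l) \<le> measure \<mu> (cball x t)"
    by blast
  thus ?thesis using diam_pos[OF net, of n] by blast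
qed

text \<open>Serves both sides: \<open>A t\<close> is one half of the ball, and \<open>d\<close>
  scales with the period like the part of the block interval on that side of x.\<close>

lemma measure_side_upper:
  assumes d: "d > 0" and \<delta>: "\<delta> > 0"
    and sub: "\<And>k t. t \<le> d * l ^ k \<Longrightarrow> A t \<subseteq> {lft (\<Delta> (n + k * s))<..<rgt (\<Delta> (n + k * s))}"
  shows "\<exists>C>0. \<exists>t\<^sub>0>0. \<forall>t. 0 < t \<longrightarrow> t < t\<^sub>0 \<longrightarrow> measure \<mu> (A t) \<le> C * t powr (ln r / ln l - \<delta>)"
proof -
  \<comment> \<open>Chosen so that \<open>ln q / ln l\<close> is the desired quotient minus
    \<open>\<delta>\<close>; as \<open>l < 1\<close>, this rate is strictly larger than the spectral
    radius, as the upper bound requires.\<close>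
  define q where "q = r * l powr (- \<delta>)"
  have "1 < l powr (- \<delta>)" using l_bounds mult_pos_neg[OF \<delta>, of "ln l"] by (simp add: powr_def)
  hence q: "r < q" using r_pos by (simp add: q_def)
  hence q0: "0 < q" using r_pos by linarith
  have "ln q = ln r - \<delta> * ln l" using r_pos l_bounds by (simp add: q_def ln_mult ln_powr)
  hence quot: "ln q / ln l = ln r / ln l - \<delta>" using l_bounds by (simp add: field_simps)
  obtain c where c: "c > 0" "\<And>k. measure \<mu> {lft (\<Delta> (n + k * s))<..<rgt (\<Delta> (n + k * s))} \<le> c * q ^ k"
    using measure_block_upper[OF q q0] by blast
  have "measure \<mu> (A t) \<le> c * q ^ k" if "t \<le> d * l ^ k" for k t
  proof -
    have "measure \<mu> (A t) \<le> measure \<mu> {lft (\<Delta> (n + k * s))<..<rgt (\<Delta> (n + k * s))}"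
      using sub[OF that] by (intro finite_measure_mono) auto
    thus ?thesis using c(2)[of k] by linarith
  qed
  with geometric_upper_bound[OF l_bounds q0 c(1) d, of "\<lambda>t. measure \<mu> (A t)"]
  have "\<exists>C>0. \<forall>t. 0 < t \<longrightarrow> t < d \<longrightarrow> measure \<mu> (A t) \<le> C * t powr (ln q / ln l)" by blast
  thus ?thesis using d unfolding quot by blast
qed

lemma measure_left_upper:
  assumes "lft (\<Delta> n) < x" "\<delta> > 0"
  shows "\<exists>C>0. \<exists>t\<^sub>0>0. \<forall>t. 0 < t \<longrightarrow> t < t\<^sub>0 \<longrightarrow> measure \<mu> {x - t..<x} \<le> C * t powr (ln r / ln l - \<delta>)"
\<comment> \<open>The factor 1/2 keeps the included end \<open>x - t\<close> strictly inside the
  open interval.\<close>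
proof (rule measure_side_upper[of "(x - lft (\<Delta> n)) / 2"])
  fix k t assume "t \<le> (x - lft (\<Delta> n)) / 2 * l ^ k"
  hence "t \<le> (x - lft (\<Delta> (n + k * s))) / 2" by (simp add: block_left)
  moreover have "0 < x - lft (\<Delta> (n + k * s))" unfolding block_left using assms l_bounds by simp
  ultimately show "{x - t..<x} \<subseteq> {lft (\<Delta> (n + k * s))<..<rgt (\<Delta> (n + k * s))}"
    using x_in(2)[of "n + k * s"] by auto
qed (use assms in auto)

lemma measure_right_upper:
  assumes "x < rgt (\<Delta> n)" "\<delta> > 0"
  shows "\<exists>C>0. \<exists>t\<^sub>0>0. \<forall>t. 0 < t \<longrightarrow> t < t\<^sub>0 \<longrightarrow> measure \<mu> {x<..x + t} \<le> C * t powr (ln r / ln l - \<delta>)"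
proof (rule measure_side_upper[of "(rgt (\<Delta> n) - x) / 2"])
  fix k t assume "t \<le> (rgt (\<Delta> n) - x) / 2 * l ^ k"
  hence "t \<le> (rgt (\<Delta> (n + k * s)) - x) / 2" by (simp add: block_right)
  moreover have "0 < rgt (\<Delta> (n + k * s)) - x" unfolding block_right using assms l_bounds by simp
  ultimately show "{x<..x + t} \<subseteq> {lft (\<Delta> (n + k * s))<..<rgt (\<Delta> (n + k * s))}"
    using x_in(1)[of "n + k * s"] by auto
qed (use assms in auto)

end

section \<open>The local dimension at a periodic point\<close>

text \<open>The lower bound for balls comes from the given representation alone. For the upper
  bound, each side may produce a different representation; periodicity of all representations gives
  it a period, and minimality makes its exponent at least that of \<open>\<theta>\<close>.\<close>

lemma (in ordered_setup) local_dim_periodic_point: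
  assumes x: "periodic_point \<Phi> K x" and rep: "symbolic_rep \<Phi> K x e" and per: "is_period \<Phi> K e \<theta>"
    and minimal: "\<And>e' \<phi>. symbolic_rep \<Phi> K x e' \<Longrightarrow> is_period \<Phi> K e' \<phi> \<Longrightarrow>
      period_quotient \<Phi> K p \<mu> ord \<theta> \<le> period_quotient \<Phi> K p \<mu> ord \<phi>"
  shows "has_local_dim \<mu> x (period_quotient \<Phi> K p \<mu> ord \<theta>)"
proof -
  define D where "D = period_quotient \<Phi> K p \<mu> ord \<theta>"
  have xK: "x \<in> K" using x by (simp add: periodic_point_def)
  have chain: "\<exists>n. periodic_chain \<Phi> K p \<mu> ord \<Delta> x n \<phi>"
    if "\<And>k. child (\<Delta> k) (\<Delta> (Suc k))" "{x} = (\<Inter>k. {lft (\<Delta> k)..rgt (\<Delta> k)})"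
      "is_period \<Phi> K (\<lambda>k. edge_btw \<Phi> K (\<Delta> k) (\<Delta> (Suc k))) \<phi>" for \<Delta> \<phi>
    using that ordered_setup_axioms
    by (auto simp: is_period_def periodic_chain_def periodic_chain_axioms_def)
  have period: "\<exists>\<phi>. is_period \<Phi> K e' \<phi> \<and> D \<le> period_quotient \<Phi> K p \<mu> ord \<phi>"
    if "symbolic_rep \<Phi> K x e'" for e'
  proof -
    obtain \<phi> where "is_period \<Phi> K e' \<phi>" using x \<open>symbolic_rep \<Phi> K x e'\<close> unfolding periodic_point_def by blast
    thus ?thesis using minimal[OF \<open>symbolic_rep \<Phi> K x e'\<close>] unfolding D_def by blast
  qed
  have lower: "\<exists>C>0. \<exists>t\<^sub>0>0. \<forall>t. 0 < t \<longrightarrow> t < t\<^sub>0 \<longrightarrow> C * t powr D \<le> measure \<mu> (cball x t)"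
  proof -
    obtain \<Delta> where \<Delta>: "\<And>k. child (\<Delta> k) (\<Delta> (Suc k))" "{x} = (\<Inter>k. {lft (\<Delta> k)..rgt (\<Delta> k)})"
        "\<And>k. e k = edge_btw \<Phi> K (\<Delta> k) (\<Delta> (Suc k))"
      using rep unfolding symbolic_rep_def by blast
    have e: "e = (\<lambda>k. edge_btw \<Phi> K (\<Delta> k) (\<Delta> (Suc k)))" using \<Delta>(3) by blast
    obtain n where "periodic_chain \<Phi> K p \<mu> ord \<Delta> x n \<theta>"
      using chain[OF \<Delta>(1,2) per[unfolded e]] by blast
    from periodic_chain.measure_cball_lower[OF this] show ?thesis by (simp add: D_def period_quotient_def)
  qed
  have left: "\<exists>C>0. \<exists>t\<^sub>0>0. \<forall>t. 0 < t \<longrightarrow> t < t\<^sub>0 \<longrightarrow> measure \<mu> {x - t..<x} \<le> C * t powr (D - \<delta>)"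
    if \<delta>: "\<delta> > 0" for \<delta>
  proof (cases "\<exists>\<eta>>0. {x - \<eta><..<x} \<inter> K = {}")
    case True
    then obtain \<eta> where \<eta>: "\<eta> > 0" "{x - \<eta><..<x} \<inter> K = {}" by blast
    have "measure \<mu> {x - t..<x} \<le> 1 * t powr (D - \<delta>)" if "0 < t" "t < \<eta>" for t
    proof -
      have "{x - t..<x} \<subseteq> {x - \<eta><..<x}" using that by auto
      hence "measure \<mu> {x - t..<x} = 0" using \<eta>(2) by (intro measure_outside_K) auto
      thus ?thesis by simp
    qed
    thus ?thesis using \<eta>(1) by (intro exI[of _ "1::real"] conjI exI[of _ \<eta>]) auto
  next
    case False
    hence acc: "\<And>\<eta>. \<eta> > 0 \<Longrightarrow> {x - \<eta><..<x} \<inter> K \<noteq> {}" by blast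
    obtain \<Delta> where \<Delta>: "\<And>k. child (\<Delta> k) (\<Delta> (Suc k))" "\<And>k. lft (\<Delta> k) < x"
        "symbolic_rep \<Phi> K x (\<lambda>k. edge_btw \<Phi> K (\<Delta> k) (\<Delta> (Suc k)))"
        "{x} = (\<Inter>k. {lft (\<Delta> k)..rgt (\<Delta> k)})"
      using left_chain[OF acc xK] by blast
    obtain \<phi> where \<phi>: "is_period \<Phi> K (\<lambda>k. edge_btw \<Phi> K (\<Delta> k) (\<Delta> (Suc k))) \<phi>"
      "D \<le> period_quotient \<Phi> K p \<mu> ord \<phi>" using period[OF \<Delta>(3)] by blast
    obtain n where "periodic_chain \<Phi> K p \<mu> ord \<Delta> x n \<phi>" using chain[OF \<Delta>(1,4) \<phi>(1)] by blast
    from periodic_chain.measure_left_upper[OF this \<Delta>(2) \<delta>]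
    show ?thesis by (rule powr_bound_mono) (use \<phi>(2) in \<open>simp add: period_quotient_def\<close>)
  qed
  have right: "\<exists>C>0. \<exists>t\<^sub>0>0. \<forall>t. 0 < t \<longrightarrow> t < t\<^sub>0 \<longrightarrow> measure \<mu> {x<..x + t} \<le> C * t powr (D - \<delta>)"
    if \<delta>: "\<delta> > 0" for \<delta>
  proof (cases "\<exists>\<eta>>0. {x<..<x + \<eta>} \<inter> K = {}")
    case True
    then obtain \<eta> where \<eta>: "\<eta> > 0" "{x<..<x + \<eta>} \<inter> K = {}" by blast
    have "measure \<mu> {x<..x + t} \<le> 1 * t powr (D - \<delta>)" if "0 < t" "t < \<eta>" for t
    proof -
      have "{x<..x + t} \<subseteq> {x<..<x + \<eta>}" using that by auto
      hence "measure \<mu> {x<..x + t} = 0" using \<eta>(2) by (intro measure_outside_K) auto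
      thus ?thesis by simp
    qed
    thus ?thesis using \<eta>(1) by (intro exI[of _ "1::real"] conjI exI[of _ \<eta>]) auto
  next
    case False
    hence acc: "\<And>\<eta>. \<eta> > 0 \<Longrightarrow> {x<..<x + \<eta>} \<inter> K \<noteq> {}" by blast
    obtain \<Delta> where \<Delta>: "\<And>k. child (\<Delta> k) (\<Delta> (Suc k))" "\<And>k. x < rgt (\<Delta> k)"
        "symbolic_rep \<Phi> K x (\<lambda>k. edge_btw \<Phi> K (\<Delta> k) (\<Delta> (Suc k)))"
        "{x} = (\<Inter>k. {lft (\<Delta> k)..rgt (\<Delta> k)})"
      using right_chain[OF acc xK] by blast
    obtain \<phi> where \<phi>: "is_period \<Phi> K (\<lambda>k. edge_btw \<Phi> K (\<Delta> k) (\<Delta> (Suc k))) \<phi>"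
      "D \<le> period_quotient \<Phi> K p \<mu> ord \<phi>" using period[OF \<Delta>(3)] by blast
    obtain n where "periodic_chain \<Phi> K p \<mu> ord \<Delta> x n \<phi>" using chain[OF \<Delta>(1,4) \<phi>(1)] by blast
    from periodic_chain.measure_right_upper[OF this \<Delta>(2) \<delta>]
    show ?thesis by (rule powr_bound_mono) (use \<phi>(2) in \<open>simp add: period_quotient_def\<close>)
  qed
  have upper: "\<exists>C>0. \<exists>t\<^sub>0>0. \<forall>t. 0 < t \<longrightarrow> t < t\<^sub>0 \<longrightarrow> measure \<mu> (cball x t) \<le> C * t powr (D - \<delta>)"
    if \<delta>: "\<delta> > 0" for \<delta>
  proof -
    obtain C\<^sub>1 t\<^sub>1 where 1: "C\<^sub>1 > 0" "t\<^sub>1 > 0"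
      "\<And>t. 0 < t \<Longrightarrow> t < t\<^sub>1 \<Longrightarrow> measure \<mu> {x - t..<x} \<le> C\<^sub>1 * t powr (D - \<delta>)" using left[OF \<delta>] by blast
    obtain C\<^sub>2 t\<^sub>2 where 2: "C\<^sub>2 > 0" "t\<^sub>2 > 0"
      "\<And>t. 0 < t \<Longrightarrow> t < t\<^sub>2 \<Longrightarrow> measure \<mu> {x<..x + t} \<le> C\<^sub>2 * t powr (D - \<delta>)" using right[OF \<delta>] by blast
    have "measure \<mu> (cball x t) \<le> (C\<^sub>1 + C\<^sub>2) * t powr (D - \<delta>)" if t: "0 < t" "t < min t\<^sub>1 t\<^sub>2" for t
    proof -
      \<comment> \<open>The centre is split off because neither half contains it: when x is an end
        point of the chain intervals, the open intervals bounding the halves omit x.\<close>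
      have "cball x t = ({x - t..<x} \<union> {x}) \<union> {x<..x + t}" using t by (auto simp: dist_real_def)
      also have "measure \<mu> \<dots> \<le> measure \<mu> ({x - t..<x} \<union> {x}) + measure \<mu> {x<..x + t}"
        by (intro measure_Un_le) simp_all
      also have "measure \<mu> ({x - t..<x} \<union> {x}) \<le> measure \<mu> {x - t..<x} + measure \<mu> {x}"
        by (intro measure_Un_le) simp_all
      finally have "measure \<mu> (cball x t) \<le> measure \<mu> {x - t..<x} + measure \<mu> {x<..x + t}"
        using measure_singleton[of x] by simp
      also have "\<dots> \<le> C\<^sub>1 * t powr (D - \<delta>) + C\<^sub>2 * t powr (D - \<delta>)" using 1(3) 2(3) t by (intro add_mono) auto
      finally show ?thesis by (simp add: distrib_right)
    qed
    thus ?thesis using 1 2 by (intro exI[of _ "C\<^sub>1 + C\<^sub>2"] conjI exI[of _ "min t\<^sub>1 t\<^sub>2"]) auto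
  qed
  show ?thesis unfolding has_local_dim_def D_def[symmetric] by (rule ln_quotient_tendsto[OF lower upper])
qed

theorem proposition3p16:
  fixes \<Phi> :: "'i ifs" and K :: "real set" and p :: "'i \<Rightarrow> real" and \<mu> :: "real measure"
    and ord :: "((real \<Rightarrow> real) \<times> (real \<Rightarrow> real)) set"
    and x :: real and e :: "nat \<Rightarrow> edge" and \<theta> :: "edge list"
  assumes "is_ifs \<Phi>"
    and "is_attractor \<Phi> K"
    and "\<nexists>y. K = {y}"
    and "convex hull K = {0..1}"
    and "prob_weights \<Phi> p"
    and "self_similar_measure \<Phi> p \<mu>"
    and "linear_order_on (all_nbs \<Phi> K) ord"
    and "periodic_point \<Phi> K x"
    and "symbolic_rep \<Phi> K x e" and "is_period \<Phi> K e \<theta>"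
    and "\<And>e' \<phi>. symbolic_rep \<Phi> K x e' \<Longrightarrow> is_period \<Phi> K e' \<phi> \<Longrightarrow>
           period_quotient \<Phi> K p \<mu> ord \<theta> \<le> period_quotient \<Phi> K p \<mu> ord \<phi>"
  shows "has_local_dim \<mu> x
           (ln (real_spectral_radius (path_mat \<Phi> K p \<mu> ord \<theta>)) / ln (path_len \<Phi> K \<theta>))"
proof -
  interpret ordered_setup \<Phi> K p \<mu> ord
    using assms(1-7) by unfold_locales
  show ?thesis
    using local_dim_periodic_point[OF assms(8-11)] by (simp add: period_quotient_def)
qed

end
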